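(* Let $q = 2^n$ with $n > 1$. If $q+1$ is prime or $q^2-q+1$ is prime, then the projective special unitary group $PSU_4(q)$ has a minimal logarithmic signature.
   Context: All groups are finite. For a finite group $G$, a logarithmic signature of $G$ is an ordered tuple $[A_1,\ldots,A_s]$ of subsets $A_i \subseteq G$ such that every element $g \in G$ can be written uniquely as a product $g = a_1a_2\cdots a_s$ with $a_i \in A_i$ for each $i$. Its length is $\sum_{i=1}^s |A_i|$. If $|G| = p_1^{\beta_1}\cdots p_k^{\beta_k}$ with $p_1,\ldots,p_k$ distinct primes and $\beta_j \ge 1$, every logarithmic signature has length at least $\sum_{j=1}^k \beta_j p_j$, and a logarithmic signature is called minimal (an MLS) if its length equals $\sum_{j=1}^k \beta_j p_j$. $PSU_4(q)$ is the projective special unitary group $SU_4(q)/Z(SU_4(q))$, where $SU_4(q)$ is the special unitary group of dimension $4$ over $GF(q^2)$. *)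

theory Defs
  imports "HOL-Analysis.Analysis" "HOL-Algebra.Coset"
begin

definition log_signature :: "('g, 'b) monoid_scheme \<Rightarrow> 'g set list \<Rightarrow> bool" where
  "log_signature G As \<longleftrightarrow>
     (\<forall>A \<in> set As. A \<subseteq> carrier G) \<and>
     bij_betw (\<lambda>xs. foldr (\<lambda>a b. a \<otimes>\<^bsub>G\<^esub> b) xs \<one>\<^bsub>G\<^esub>) (listset As) (carrier G)"

definition ls_length :: "'g set list \<Rightarrow> nat" where
  "ls_length As = sum_list (map card As)"

definition minimal_log_signature :: "('g, 'b) monoid_scheme \<Rightarrow> 'g set list \<Rightarrow> bool" where
  "minimal_log_signature G As \<longleftrightarrow> log_signature G As \<and>
     ls_length As = (\<Sum>p \<in> prime_factors (order G). multiplicity p (order G) * p)"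

definition has_MLS :: "('g, 'b) monoid_scheme \<Rightarrow> bool" where
  "has_MLS G \<longleftrightarrow> (\<exists>As. minimal_log_signature G As)"

definition grp_center :: "('g, 'b) monoid_scheme \<Rightarrow> 'g set" where
  "grp_center G = {z \<in> carrier G. \<forall>g \<in> carrier G. z \<otimes>\<^bsub>G\<^esub> g = g \<otimes>\<^bsub>G\<^esub> z}"

(* Over a field F = GF(q^2), the involutive field automorphism x |-> x^q; conjugate transpose *)
definition conj_transpose :: "nat \<Rightarrow> 'a::field^4^4 \<Rightarrow> 'a^4^4" where
  "conj_transpose q A = (\<chi> i j. (A $ j $ i) ^ q)"

(* SU_4(q): 4x4 matrices over GF(q^2) of determinant 1 preserving the standard
   (nondegenerate) Hermitian form, i.e. A^* A = I. *)
definition SU4 :: "nat \<Rightarrow> ('a::{field,finite}^4^4) monoid" where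
  "SU4 q = \<lparr> carrier = {A. conj_transpose q A ** A = mat 1 \<and> det A = 1},
             mult = (\<lambda>A B. A ** B), one = mat 1 \<rparr>"

definition PSU4 :: "nat \<Rightarrow> ('a::{field,finite}^4^4) set monoid" where
  "PSU4 q = SU4 q Mod grp_center (SU4 q)"

end

theory Submission
  imports Defs "HOL-Algebra.Sylow" "HOL-Algebra.Left_Coset" "HOL-Algebra.Multiplicative_Group"
begin

text \<open>
  Call a set \<open>prime-factorable\<close> if it is the exact product of blocks of prime size; a group with this
  property has a minimal logarithmic signature. Abelian groups, \<open>p\<close>-groups and extensions of such
  groups are prime-factorable, and so is any exact product of prime-factorable sets.

  For even \<open>q\<close> the centre of \<open>G = SU(4, q)\<close> is trivial. \<open>G\<close> is transitive on the
  \<open>(q + 1)^2 (q^2 - q + 1)\<close> totally isotropic lines of the Hermitian space. The stabiliser of such a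
  line is the exact product of a non-split torus of \<open>SL(2, q^2)\<close>, which is regular on the points of the
  line, and of the stabiliser of a flag, which is a 2-group extended by an abelian group. It remains to
  find an abelian group acting freely on the isotropic lines with a prime number \<open>r\<close> of orbits: orbit
  representatives then supply one further block, of size \<open>r\<close>.

  If \<open>q^2 - q + 1\<close> is prime, the diagonal matrices \<open>diag(a, b, c, 1)\<close> with \<open>a b c = 1\<close> serve; there are
  \<open>(q + 1)^2\<close> of them. If \<open>q + 1\<close> is prime, then 3 does not divide \<open>n\<close>, so \<open>x^3 + x^2 + 1\<close> is irreducible
  over \<open>GF(q^2)\<close>, and the norm-one group of \<open>GF(q^6)\<close> over \<open>GF(q^3)\<close>, of order \<open>q^3 + 1\<close>, embeds in the
  unitary group of a nondegenerate hyperplane and acts freely.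
\<close>

section \<open>Exact products of blocks of prime size\<close>

text \<open>The free abelian group has \<open>q^2 - q + 1\<close> orbits in the diagonal case and
  \<open>q + 1\<close> in the norm-one case, since (q + 1)^2 (q^2 - q + 1) = (q + 1) (q^3 + 1). The
  condition a b c = 1 excludes the matrices diag(s, s, 1, 1), which fix every line spanned by (1, x,
  0, 0) and (0, 0, 1, y).

  Freeness rests on the fourth coordinate, which both tori leave unchanged. A matrix with this
  property that preserves an isotropic line has an eigenvector u on it with last coordinate 0, and
  moves some w on it with last coordinate 1 by a multiple of u; isotropy of u and w then restricts
  the eigenvalue.

  The constructions live in the full unitary group, where determinants are unconstrained. For n > 1
  the number 4 divides q, and a matrix of determinant d is brought into SU by the scalar d^(q/4),
  which changes no line. In characteristic 2 the vectors (s, t, s, t) form an isotropic line of the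
  standard form, and most other lines are graphs of 2 by 2 unitary matrices; this gives both
  transitivity and the count.\<close>

inductive prime_fact :: "('g, 'b) monoid_scheme \<Rightarrow> 'g set \<Rightarrow> bool" for G where
  one: "prime_fact G {\<one>\<^bsub>G\<^esub>}"
| block: "A \<subseteq> carrier G \<Longrightarrow> prime (card A) \<Longrightarrow> prime_fact G X \<Longrightarrow>
    inj_on (\<lambda>(a, x). a \<otimes>\<^bsub>G\<^esub> x) (A \<times> X) \<Longrightarrow> prime_fact G (A <#>\<^bsub>G\<^esub> X)"

lemma set_mult_eq_image: "A <#>\<^bsub>G\<^esub> X = (\<lambda>(a, x). a \<otimes>\<^bsub>G\<^esub> x) ` (A \<times> X)"
  by (auto simp: set_mult_def)

lemma prime_fact_subset:
  assumes "group G" "prime_fact G X"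
  shows "X \<subseteq> carrier G"
proof -
  interpret group G by fact
  show ?thesis using assms(2)
    by induction (auto simp: set_mult_def)
qed

lemma prime_fact_list:
  assumes "prime_fact G X"
  obtains As where "\<forall>A\<in>set As. A \<subseteq> carrier G \<and> prime (card A)"
    "bij_betw (\<lambda>xs. foldr (\<lambda>a b. a \<otimes>\<^bsub>G\<^esub> b) xs \<one>\<^bsub>G\<^esub>) (listset As) X"
proof -
  have "\<exists>As. (\<forall>A\<in>set As. A \<subseteq> carrier G \<and> prime (card A)) \<and>
    bij_betw (\<lambda>xs. foldr (\<lambda>a b. a \<otimes>\<^bsub>G\<^esub> b) xs \<one>\<^bsub>G\<^esub>) (listset As) X"
    using assms
  proof induction
    case one
    show ?case by (rule exI[of _ "[]"]) (auto simp: bij_betw_def)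
  next
    case (block A X)
    then obtain As where As: "\<forall>A\<in>set As. A \<subseteq> carrier G \<and> prime (card A)"
      and bij: "bij_betw (\<lambda>xs. foldr (\<lambda>a b. a \<otimes>\<^bsub>G\<^esub> b) xs \<one>\<^bsub>G\<^esub>) (listset As) X"
      by blast
    let ?f = "\<lambda>xs. foldr (\<lambda>a b. a \<otimes>\<^bsub>G\<^esub> b) xs \<one>\<^bsub>G\<^esub>"
    have f_img: "?f ` listset As = X" and f_inj: "inj_on ?f (listset As)"
      using bij by (auto simp: bij_betw_def)
    have "inj_on ?f (listset (A # As))"
    proof (rule inj_onI)
      fix u v assume "u \<in> listset (A # As)" "v \<in> listset (A # As)" and eq: "?f u = ?f v"
      then obtain a xs b ys where u: "u = a # xs" "a \<in> A" "xs \<in> listset As"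
        and v: "v = b # ys" "b \<in> A" "ys \<in> listset As"
        by (auto simp: set_Cons_def)
      have "(a, ?f xs) \<in> A \<times> X" "(b, ?f ys) \<in> A \<times> X" using u v f_img by auto
      moreover have "a \<otimes>\<^bsub>G\<^esub> ?f xs = b \<otimes>\<^bsub>G\<^esub> ?f ys" using eq u v by simp
      ultimately have "a = b \<and> ?f xs = ?f ys"
        using inj_onD[OF block.hyps(4), of "(a, ?f xs)" "(b, ?f ys)"] by auto
      then show "u = v" using u v f_inj by (auto dest: inj_onD)
    qed
    moreover have "?f ` listset (A # As) = A <#>\<^bsub>G\<^esub> X"
      unfolding set_mult_eq_image using f_img by (force simp: set_Cons_def)
    ultimately show ?case using As block.hyps(1,2)
      by (intro exI[of _ "A # As"]) (auto simp: bij_betw_def)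
  qed
  then show ?thesis using that by blast
qed

lemma card_listset: "card (listset As) = prod_list (map card As)"
proof (induction As)
  case (Cons A As)
  have "set_Cons A (listset As) = (\<lambda>(a, xs). a # xs) ` (A \<times> listset As)"
    by (auto simp: set_Cons_def)
  moreover have "inj_on (\<lambda>(a, xs). a # xs) (A \<times> listset As)"
    by (auto simp: inj_on_def)
  ultimately show ?case using Cons by (simp add: card_image card_cartesian_product)
qed simp

lemma sum_mset_eq_sum_count: "sum_mset M = (\<Sum>x\<in>set_mset M. count M x * x)" for M :: "nat multiset"
proof (induction M)
  case (add y M)
  have "(\<Sum>x\<in>set_mset (add_mset y M). count (add_mset y M) x * x)
      = (\<Sum>x\<in>insert y (set_mset M). count M x * x + (if x = y then y else 0))"
    by (intro sum.cong) auto
  also have "\<dots> = (\<Sum>x\<in>insert y (set_mset M). count M x * x) + y"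
    by (simp add: sum.distrib)
  also have "(\<Sum>x\<in>insert y (set_mset M). count M x * x) = (\<Sum>x\<in>set_mset M. count M x * x)"
    by (rule sum.mono_neutral_right) (auto simp: not_in_iff)
  finally show ?case using add by simp
qed simp

text \<open>By unique factorisation the block sizes, as a multiset, are the prime factorisation of
  the group order, so their sum is exactly the minimal length.\<close>

lemma has_MLS_if_prime_fact:
  assumes "prime_fact G (carrier G)"
  shows "has_MLS G"
proof -
  obtain As where As: "\<forall>A\<in>set As. A \<subseteq> carrier G \<and> prime (card A)"
    and bij: "bij_betw (\<lambda>xs. foldr (\<lambda>a b. a \<otimes>\<^bsub>G\<^esub> b) xs \<one>\<^bsub>G\<^esub>) (listset As) (carrier G)"
    using prime_fact_list[OF assms] by blast
  have "order G = prod_list (map card As)"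
    using bij_betw_same_card[OF bij] by (simp add: order_def card_listset)
  then have ord: "order G = prod_mset (mset (map card As))"
    by (metis prod_mset_prod_list)
  have pf: "prime_factorization (order G) = mset (map card As)"
    unfolding ord by (rule prime_factorization_prod_mset_primes) (use As in auto)
  have "ls_length As = sum_mset (prime_factorization (order G))"
    unfolding ls_length_def pf by (metis sum_mset_sum_list)
  also have "\<dots> = (\<Sum>p \<in> prime_factors (order G). multiplicity p (order G) * p)"
    unfolding sum_mset_eq_sum_count
    by (intro sum.cong) (auto simp: count_prime_factorization_prime in_prime_factors_iff)
  finally show ?thesis
    using As bij unfolding has_MLS_def minimal_log_signature_def log_signature_def by blast
qed

lemma prime_fact_mult:
  assumes "group G" "prime_fact G X" "prime_fact G Y"
    "inj_on (\<lambda>(x, y). x \<otimes>\<^bsub>G\<^esub> y) (X \<times> Y)"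
  shows "prime_fact G (X <#>\<^bsub>G\<^esub> Y)"
proof -
  interpret group G by fact
  have Y: "Y \<subseteq> carrier G" using assms(1,3) by (rule prime_fact_subset)
  show ?thesis using assms(2,4)
  proof induction
    case one
    have "{\<one>\<^bsub>G\<^esub>} <#>\<^bsub>G\<^esub> Y = Y" using Y by (force simp: set_mult_def)
    then show ?case using assms(3) by simp
  next
    case (block A X)
    have X: "X \<subseteq> carrier G" using assms(1) block.hyps(3) by (rule prime_fact_subset)
    have A: "A \<subseteq> carrier G" by fact
    have "A \<noteq> {}" using block.hyps(2) by auto
    then obtain a0 where a0: "a0 \<in> A" by blast
    have inj: "x = x' \<and> y = y'" if "x \<in> A <#>\<^bsub>G\<^esub> X" "x' \<in> A <#>\<^bsub>G\<^esub> X" "y \<in> Y" "y' \<in> Y" "x \<otimes>\<^bsub>G\<^esub> y = x' \<otimes>\<^bsub>G\<^esub> y'"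
      for x x' y y'
      using inj_onD[OF block.prems, of "(x, y)" "(x', y')"] that by auto
    have inX: "a \<otimes>\<^bsub>G\<^esub> x \<in> A <#>\<^bsub>G\<^esub> X" if "a \<in> A" "x \<in> X" for a x
      using that by (auto simp: set_mult_def)
    have injAX: "a = a' \<and> x = x'" if "a \<in> A" "a' \<in> A" "x \<in> X" "x' \<in> X" "a \<otimes>\<^bsub>G\<^esub> x = a' \<otimes>\<^bsub>G\<^esub> x'"
      for a a' x x'
      using inj_onD[OF block.hyps(4), of "(a, x)" "(a', x')"] that by auto
    \<comment> \<open>Left multiplication by the fixed \<open>a0\<close> carries \<open>X\<close>
      into \<open>A <#> X\<close>, so the injectivity assumed for the larger set descends to
      \<open>X\<close>.\<close>
    have "inj_on (\<lambda>(x, y). x \<otimes>\<^bsub>G\<^esub> y) (X \<times> Y)"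
    proof (rule inj_onI, clarify)
      fix x y x' y' assume *: "x \<in> X" "y \<in> Y" "x' \<in> X" "y' \<in> Y" "x \<otimes>\<^bsub>G\<^esub> y = x' \<otimes>\<^bsub>G\<^esub> y'"
      then have "(a0 \<otimes>\<^bsub>G\<^esub> x) \<otimes>\<^bsub>G\<^esub> y = (a0 \<otimes>\<^bsub>G\<^esub> x') \<otimes>\<^bsub>G\<^esub> y'"
        using a0 A X Y by (simp add: m_assoc subset_iff)
      with inj * a0 inX have "a0 \<otimes>\<^bsub>G\<^esub> x = a0 \<otimes>\<^bsub>G\<^esub> x' \<and> y = y'" by blast
      with injAX * a0 show "x = x' \<and> y = y'" by blast
    qed
    then have IH: "prime_fact G (X <#>\<^bsub>G\<^esub> Y)" by (rule block.IH)
    have "inj_on (\<lambda>(a, x). a \<otimes>\<^bsub>G\<^esub> x) (A \<times> (X <#>\<^bsub>G\<^esub> Y))"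
    proof (rule inj_onI, clarify)
      fix a z a' z' assume *: "a \<in> A" "z \<in> X <#>\<^bsub>G\<^esub> Y" "a' \<in> A" "z' \<in> X <#>\<^bsub>G\<^esub> Y" "a \<otimes>\<^bsub>G\<^esub> z = a' \<otimes>\<^bsub>G\<^esub> z'"
      then obtain x y x' y' where z: "z = x \<otimes>\<^bsub>G\<^esub> y" "z' = x' \<otimes>\<^bsub>G\<^esub> y'" "x \<in> X" "y \<in> Y" "x' \<in> X" "y' \<in> Y"
        by (auto simp: set_mult_def)
      have "(a \<otimes>\<^bsub>G\<^esub> x) \<otimes>\<^bsub>G\<^esub> y = (a' \<otimes>\<^bsub>G\<^esub> x') \<otimes>\<^bsub>G\<^esub> y'"
        using * z A X Y by (simp add: m_assoc subset_iff)
      with inj inX * z have "a \<otimes>\<^bsub>G\<^esub> x = a' \<otimes>\<^bsub>G\<^esub> x' \<and> y = y'" by blast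
      with injAX * z show "a = a' \<and> z = z'" by blast
    qed
    then have "prime_fact G (A <#>\<^bsub>G\<^esub> (X <#>\<^bsub>G\<^esub> Y))"
      by (rule prime_fact.block[OF block.hyps(1,2) IH])
    then show ?case using set_mult_assoc[OF A X Y] by simp
  qed
qed

lemma prime_fact_mono:
  assumes "prime_fact (G\<lparr>carrier := K\<rparr>) X" "K \<subseteq> carrier G"
  shows "prime_fact G X"
  using assms(1)
proof induction
  case one
  then show ?case using prime_fact.one[of G] by simp
next
  case (block A X)
  then have "prime_fact G (A <#>\<^bsub>G\<^esub> X)"
    using assms(2) by (intro prime_fact.block) auto
  then show ?case by (simp add: set_mult_def)
qed

section \<open>Blocks from group actions, complements and extensions\<close>

context group
begin

text \<open>\<open>A\<close> acts freely, so picking one point in each of its orbits and one group element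
  moving \<open>w\<close> to that point gives a block \<open>B\<close> with \<open>G = A B Stab(w)\<close>.\<close>

lemma prime_fact_orbits:
  fixes act :: "'a \<Rightarrow> 'x \<Rightarrow> 'x"
  assumes "subgroup A G" "finite (carrier G)"
    and act_mult: "\<And>g h x. g \<in> carrier G \<Longrightarrow> h \<in> carrier G \<Longrightarrow> act (g \<otimes> h) x = act g (act h x)"
    and act_one: "\<And>x. act \<one> x = x"
    and free: "\<And>a g. a \<in> A \<Longrightarrow> g \<in> carrier G \<Longrightarrow> act a (act g w) = act g w \<Longrightarrow> a = \<one>"
    and card: "card ((\<lambda>g. act g w) ` carrier G) = card A * p" and p: "prime p"
    and pA: "prime_fact G A" and pS: "prime_fact G {g \<in> carrier G. act g w = w}"
  shows "prime_fact G (carrier G)"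
proof -
  define \<Omega> where "\<Omega> = (\<lambda>g. act g w) ` carrier G"
  define S where "S = {g \<in> carrier G. act g w = w}"
  \<comment> \<open>The chosen predicate depends only on the \<open>A\<close>-orbit of
    \<open>x\<close>, so all points of an orbit get the same representative.\<close>
  define rep where "rep x = (SOME y. \<exists>a\<in>A. y = act a x)" for x
  have A: "A \<subseteq> carrier G" and one_A: "\<one> \<in> A"
    using assms(1) by (auto dest: subgroup.subset subgroup.one_closed)
  have inv_A: "inv a \<in> A" "a \<in> carrier G" if "a \<in> A" for a
    using that assms(1) A by (auto intro: subgroup.m_inv_closed)
  have mult_A: "a \<otimes> b \<in> A" if "a \<in> A" "b \<in> A" for a b
    using that assms(1) by (auto intro: subgroup.m_closed)
  have act_inv: "act (inv a) (act a x) = x" "act a (act (inv a) x) = x" if "a \<in> carrier G" for a x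
    using that act_mult[of "inv a" a x] act_mult[of a "inv a" x] act_one by auto
  have rep: "\<exists>a\<in>A. rep x = act a x" for x
    unfolding rep_def by (rule someI[of "\<lambda>y. \<exists>a\<in>A. y = act a x" x])
      (rule bexI[OF _ one_A], simp add: act_one)
  have rep_act: "rep (act a x) = rep x" if "a \<in> A" for a x
  proof -
    have "(\<exists>b\<in>A. y = act b (act a x)) \<longleftrightarrow> (\<exists>b\<in>A. y = act b x)" for y
    proof
      assume "\<exists>b\<in>A. y = act b (act a x)"
      then obtain b where "b \<in> A" "y = act b (act a x)" by blast
      then show "\<exists>b\<in>A. y = act b x"
        using that mult_A[of b a] act_mult[of b a x] inv_A by metis
    next
      assume "\<exists>b\<in>A. y = act b x"
      then obtain b where b: "b \<in> A" "y = act b x" by blast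
      have "act (b \<otimes> inv a) (act a x) = y"
        using that b inv_A act_mult[of b "inv a"] act_inv by auto
      then show "\<exists>b\<in>A. y = act b (act a x)"
        using that b mult_A inv_A by metis
    qed
    then show ?thesis unfolding rep_def by simp
  qed
  have \<Omega>_act: "act g x \<in> \<Omega>" if g: "g \<in> carrier G" and x: "x \<in> \<Omega>" for g x
  proof -
    obtain h where h: "h \<in> carrier G" "x = act h w" using x unfolding \<Omega>_def by blast
    then have "act g x = act (g \<otimes> h) w" using g act_mult by simp
    then show ?thesis using g h unfolding \<Omega>_def by auto
  qed
  define R where "R = rep ` \<Omega>"
  have R_sub: "R \<subseteq> \<Omega>" unfolding R_def using rep \<Omega>_act A by (metis image_subset_iff subsetD)
  have rep_R: "rep r = r" if "r \<in> R" for r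
    using that rep rep_act unfolding R_def by (metis imageE)
  \<comment> \<open>Freeness lets \<open>(a, r)\<close> be recovered from \<open>act a r\<close>:
    the orbit of \<open>w\<close> splits into \<open>card R\<close> copies of \<open>A\<close>, and
    hence \<open>card R = p\<close>.\<close>
  have bij: "bij_betw (\<lambda>(a, r). act a r) (A \<times> R) \<Omega>"
  proof (rule bij_betwI')
    show "((\<lambda>(a, r). act a r) x = (\<lambda>(a, r). act a r) y) = (x = y)"
      if mem: "x \<in> A \<times> R" "y \<in> A \<times> R" for x y
    proof -
      obtain a r b s where xy: "x = (a, r)" "y = (b, s)" "a \<in> A" "r \<in> R" "b \<in> A" "s \<in> R"
        using mem by blast
      have "a = b \<and> r = s" if eq: "act a r = act b s"
      proof -
        have rs: "r = s" using eq rep_act rep_R xy by metis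
        obtain g where g: "g \<in> carrier G" "r = act g w" using xy R_sub unfolding \<Omega>_def by blast
        have "act (inv b \<otimes> a) r = r"
          using eq rs xy inv_A act_mult[of "inv b" a r] act_inv by auto
        then have "inv b \<otimes> a = \<one>" using free g xy mult_A inv_A by blast
        then have "a = b" using xy inv_A by (metis inv_equality inv_inv inv_closed)
        with rs show ?thesis by simp
      qed
      then show ?thesis using xy by auto
    qed
    show "(\<lambda>(a, r). act a r) x \<in> \<Omega>" if "x \<in> A \<times> R" for x
      using that R_sub A \<Omega>_act by auto
    show "\<exists>x\<in>A \<times> R. y = (\<lambda>(a, r). act a r) x" if "y \<in> \<Omega>" for y
    proof -
      obtain a where a: "a \<in> A" "rep y = act a y" using rep by blast
      have "y = act (inv a) (rep y)" using a inv_A act_inv by auto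
      moreover have "rep y \<in> R" using that R_def by auto
      ultimately show ?thesis using a inv_A by auto
    qed
  qed
  have "finite A" using A assms(2) finite_subset by auto
  then have "card A > 0" using one_A by (auto simp: card_gt_0_iff)
  then have cardR: "card R = p"
    using bij_betw_same_card[OF bij] card unfolding \<Omega>_def by (simp add: card_cartesian_product)
  define t where "t r = (SOME g. g \<in> carrier G \<and> act g w = r)" for r
  have t: "t r \<in> carrier G" "act (t r) w = r" if "r \<in> R" for r
  proof -
    have "\<exists>g. g \<in> carrier G \<and> act g w = r" using that R_sub unfolding \<Omega>_def by auto
    from someI_ex[OF this] show "t r \<in> carrier G" "act (t r) w = r" unfolding t_def by auto
  qed
  define B where "B = t ` R"
  have "inj_on t R" by (rule inj_onI) (metis t(2))
  then have cardB: "card B = p" unfolding B_def by (simp add: card_image cardR)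
  have B: "B \<subseteq> carrier G" unfolding B_def using t by auto
  have S: "S \<subseteq> carrier G" unfolding S_def by auto
  have pB: "prime_fact G (B <#> S)"
  proof (rule prime_fact.block[OF B])
    show "prime (card B)" using cardB p by simp
    show "prime_fact G S" using pS unfolding S_def .
    show "inj_on (\<lambda>(a, x). a \<otimes> x) (B \<times> S)"
    proof (rule inj_onI, clarify)
      fix b s b' s' assume *: "b \<in> B" "s \<in> S" "b' \<in> B" "s' \<in> S" "b \<otimes> s = b' \<otimes> s'"
      then obtain r r' where r: "r \<in> R" "r' \<in> R" "b = t r" "b' = t r'" unfolding B_def by auto
      have "act (t x \<otimes> y) w = x" if "x \<in> R" "y \<in> S" for x y
        using that t act_mult unfolding S_def by simp
      then have "r = r'" using * r by metis
      then have "b = b'" using r by simp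
      then show "b = b' \<and> s = s'" using * B S by (auto simp: subset_iff)
    qed
  qed
  have BS: "act z w \<in> R \<and> z \<in> carrier G" if "z \<in> B <#> S" for z
    using that t act_mult unfolding set_mult_def B_def S_def by auto
  have "prime_fact G (A <#> (B <#> S))"
  proof (rule prime_fact_mult[OF is_group pA pB], rule inj_onI, clarify)
    fix a z a' z' assume *: "a \<in> A" "z \<in> B <#> S" "a' \<in> A" "z' \<in> B <#> S" "a \<otimes> z = a' \<otimes> z'"
    then have "act a (act z w) = act a' (act z' w)" using BS A act_mult by (metis subsetD)
    then have "(a, act z w) = (a', act z' w)"
      using inj_onD[OF bij_betw_imp_inj_on[OF bij], of "(a, act z w)" "(a', act z' w)"] BS * by auto
    then have "a = a'" by simp
    moreover have "a \<in> carrier G" "z \<in> carrier G" "z' \<in> carrier G" using * BS A by auto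
    ultimately show "a = a' \<and> z = z'" using * by simp
  qed
  moreover have "A <#> (B <#> S) = carrier G"
  proof
    show "A <#> (B <#> S) \<subseteq> carrier G" using A BS set_mult_closed by blast
    show "carrier G \<subseteq> A <#> (B <#> S)"
    proof
      fix g assume g: "g \<in> carrier G"
      then have "act g w \<in> \<Omega>" unfolding \<Omega>_def by auto
      then obtain a r where ar: "a \<in> A" "r \<in> R" "act g w = act a r"
        using bij unfolding bij_betw_def by auto
      define s where "s = inv (t r) \<otimes> (inv a \<otimes> g)"
      have cl: "a \<in> carrier G" "t r \<in> carrier G" using ar A t by auto
      have "act (inv (t r)) (act (t r) w) = w" using act_inv cl by blast
      then have "act s w = w"
        using ar g cl t act_mult act_inv unfolding s_def by simp
      then have s: "s \<in> S" using g cl unfolding S_def s_def by auto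
      have "g = a \<otimes> (t r \<otimes> s)" using g cl unfolding s_def by (simp add: m_assoc[symmetric])
      moreover have "t r \<in> B" using ar unfolding B_def by blast
      ultimately show "g \<in> A <#> (B <#> S)" using s ar unfolding set_mult_def by blast
    qed
  qed
  ultimately show ?thesis by simp
qed

text \<open>An exact factorisation of \<open>K\<close> as \<open>S\<close> times \<open>U\<close>.
  The existence of \<open>s\<close> says that \<open>S\<close> is transitive on the cosets of
  \<open>U\<close> in \<open>K\<close>, and the trivial intersection says that it acts freely on
  them.\<close>

lemma prime_fact_complement:
  assumes "subgroup S G" "subgroup U G" "subgroup K G" "S \<subseteq> K" "U \<subseteq> K" "S \<inter> U \<subseteq> {\<one>}"
    and ex: "\<And>k. k \<in> K \<Longrightarrow> \<exists>s\<in>S. inv s \<otimes> k \<in> U"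
    and "prime_fact G S" "prime_fact G U"
  shows "prime_fact G K"
proof -
  interpret S: subgroup S G by fact
  interpret U: subgroup U G by fact
  interpret K: subgroup K G by fact
  have "S <#> U = K"
  proof
    show "S <#> U \<subseteq> K" using assms(4,5) by (auto simp: set_mult_def)
    show "K \<subseteq> S <#> U"
    proof
      fix k assume k: "k \<in> K"
      then obtain s where s: "s \<in> S" "inv s \<otimes> k \<in> U" using ex by blast
      then have "k = s \<otimes> (inv s \<otimes> k)" using k by (simp add: m_assoc[symmetric])
      then show "k \<in> S <#> U" using s unfolding set_mult_def by blast
    qed
  qed
  moreover have "prime_fact G (S <#> U)"
  proof (rule prime_fact_mult[OF is_group assms(8,9)], rule inj_onI, clarify)
    fix s u s' u' assume *: "s \<in> S" "u \<in> U" "s' \<in> S" "u' \<in> U" "s \<otimes> u = s' \<otimes> u'"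
    then have "inv s' \<otimes> (s \<otimes> u) = inv s' \<otimes> (s' \<otimes> u')" by simp
    then have "(inv s' \<otimes> s) \<otimes> u = (inv s' \<otimes> s') \<otimes> u'"
      using * m_assoc S.mem_carrier U.mem_carrier inv_closed by metis
    then have "(inv s' \<otimes> s) \<otimes> u = u'" using * by simp
    then have "inv s' \<otimes> s = u' \<otimes> inv u" using * by (metis S.mem_carrier S.m_closed S.m_inv_closed U.mem_carrier inv_solve_right)
    moreover have "inv s' \<otimes> s \<in> S" "u' \<otimes> inv u \<in> U" using * by auto
    ultimately have "inv s' \<otimes> s \<in> S \<inter> U" by simp
    then have "inv s' \<otimes> s = \<one>" using assms(6) by blast
    then have "s = s'" using * by (metis S.mem_carrier inv_closed inv_equality inv_inv)
    then show "s = s' \<and> u = u'" using * by (auto simp: subset_iff)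
  qed
  ultimately show ?thesis by simp
qed

text \<open>The blocks of \<open>H\<close> are lifted to \<open>G\<close> one at a time along a
  set-theoretic section of \<open>f\<close>. The induction runs over full preimages and starts at
  the preimage of the identity, the kernel.\<close>

lemma prime_fact_hom:
  assumes "group H" and hom: "f \<in> hom G H" and surj: "f ` carrier G = carrier H"
    and pH: "prime_fact H (carrier H)" and pK: "prime_fact G (kernel G H f)"
  shows "prime_fact G (carrier G)"
proof -
  interpret H: group H by fact
  interpret group_hom G H f by unfold_locales (rule hom)
  have "prime_fact G {g \<in> carrier G. f g \<in> X}" if "prime_fact H X" for X
    using that
  proof induction
    case one
    then show ?case using pK by (simp add: kernel_def)
  next
    case (block A X)
    have X: "X \<subseteq> carrier H" using assms(1) block.hyps(3) by (rule prime_fact_subset)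
    define s where "s a = (SOME g. g \<in> carrier G \<and> f g = a)" for a
    have s: "s a \<in> carrier G" "f (s a) = a" if "a \<in> A" for a
    proof -
      have "\<exists>g. g \<in> carrier G \<and> f g = a" using that surj block.hyps(1) by (metis imageE subsetD)
      from someI_ex[OF this] show "s a \<in> carrier G" "f (s a) = a" unfolding s_def by auto
    qed
    let ?Y = "{g \<in> carrier G. f g \<in> X}"
    have "inj_on s A" by (rule inj_onI) (metis s(2))
    then have "prime (card (s ` A))" using block.hyps(2) by (simp add: card_image)
    then have "prime_fact G (s ` A <#> ?Y)"
    proof (rule prime_fact.block[rotated])
      show "s ` A \<subseteq> carrier G" using s by auto
      show "prime_fact G ?Y" by (rule block.IH)
      show "inj_on (\<lambda>(a, x). a \<otimes> x) (s ` A \<times> ?Y)"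
      proof (rule inj_onI, clarify)
        fix a y b z assume *: "a \<in> A" "b \<in> A" "y \<in> carrier G" "z \<in> carrier G"
          "f y \<in> X" "f z \<in> X" "s a \<otimes> y = s b \<otimes> z"
        then have "a \<otimes>\<^bsub>H\<^esub> f y = b \<otimes>\<^bsub>H\<^esub> f z" using s hom_mult by metis
        then have "a = b" using inj_onD[OF block.hyps(4), of "(a, f y)" "(b, f z)"] * by auto
        then show "s a = s b \<and> y = z" using * s by (auto simp: subset_iff)
      qed
    qed
    moreover have "s ` A <#> ?Y = {g \<in> carrier G. f g \<in> A <#>\<^bsub>H\<^esub> X}"
    proof
      show "s ` A <#> ?Y \<subseteq> {g \<in> carrier G. f g \<in> A <#>\<^bsub>H\<^esub> X}"
        using s by (force simp: set_mult_def)
      show "{g \<in> carrier G. f g \<in> A <#>\<^bsub>H\<^esub> X} \<subseteq> s ` A <#> ?Y"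
      proof clarify
        fix g assume g: "g \<in> carrier G" "f g \<in> A <#>\<^bsub>H\<^esub> X"
        then obtain a x where ax: "a \<in> A" "x \<in> X" "f g = a \<otimes>\<^bsub>H\<^esub> x" by (auto simp: set_mult_def)
        have cl: "a \<in> carrier H" "x \<in> carrier H" using ax block.hyps(1) X by auto
        have "f (inv (s a) \<otimes> g) = inv\<^bsub>H\<^esub> a \<otimes>\<^bsub>H\<^esub> (a \<otimes>\<^bsub>H\<^esub> x)" using g ax s by simp
        also have "\<dots> = x" using cl by (simp add: H.m_assoc[symmetric])
        finally have "inv (s a) \<otimes> g \<in> ?Y" using ax g s by simp
        moreover have "g = s a \<otimes> (inv (s a) \<otimes> g)" using g ax s by (simp add: m_assoc[symmetric])
        ultimately show "g \<in> s ` A <#> ?Y" using ax unfolding set_mult_def by blast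
      qed
    qed
    ultimately show ?case by simp
  qed
  from this[OF pH] have "prime_fact G {g \<in> carrier G. f g \<in> carrier H}" .
  moreover have "{g \<in> carrier G. f g \<in> carrier H} = carrier G" by auto
  ultimately show ?thesis by simp
qed

end

section \<open>Groups of prime power order and abelian groups\<close>

lemma (in group) prime_fact_index_prime:
  assumes "finite (carrier G)" "subgroup H G" "order G = p * card H" "prime p" "prime_fact G H"
  shows "prime_fact G (carrier G)"
proof -
  interpret H: subgroup H G by fact
  \<comment> \<open>Sets that leave the carrier are fixed by convention, so that the laws of an
    action hold for arbitrary sets.\<close>
  define act where "act g X = (if X \<subseteq> carrier G then g <# X else X)" for g X
  have act_H: "act g H = g <# H" for g
    unfolding act_def using H.subset by simp
  have "prime_fact G {g \<in> carrier G. act g H = H}"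
  proof -
    have "g \<in> H" if "g \<in> carrier G" "g <# H = H" for g
      using that lcos_self[OF that(1) assms(2)] by simp
    then have "{g \<in> carrier G. act g H = H} = H"
      unfolding act_H using coset_join3[OF _ assms(2)] H.subset by auto
    then show ?thesis using assms(5) by simp
  qed
  moreover have "card ((\<lambda>g. act g H) ` carrier G) = card {\<one>} * p"
  proof -
    have "(\<lambda>g. act g H) ` carrier G = lcosets H"
      unfolding act_H LCOSETS_def by auto
    moreover have "card H > 0"
      using H.one_closed finite_subset[OF H.subset assms(1)] by (metis card_gt_0_iff empty_iff)
    ultimately show ?thesis using l_lagrange[OF assms(1,2)] assms(3) by simp
  qed
  moreover have "act (g \<otimes> h) X = act g (act h X)" if "g \<in> carrier G" "h \<in> carrier G" for g h X
    using that l_coset_subset_G[of X h] lcos_m_assoc[of X g h] unfolding act_def by simp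
  moreover have "act \<one> X = X" for X
    unfolding act_def by (simp add: lcos_mult_one)
  ultimately show ?thesis
    \<comment> \<open>With the trivial group as \<open>A\<close>, every left coset of
      \<open>H\<close> is an orbit of its own, and coset representatives form one block of size
      \<open>p\<close>.\<close>
    by (intro prime_fact_orbits[where act = act and w = H and A = "{\<one>}" and p = p])
      (use triv_subgroup assms(1,4) prime_fact.one[of G] in simp_all)
qed

text \<open>Sylow's theorem, applied to a power below the full one, provides a subgroup of index
  \<open>p\<close>; induction on the exponent does the rest.\<close>

lemma prime_fact_p_group:
  assumes "group G" "prime p" "order G = p ^ k"
  shows "prime_fact G (carrier G)"
  using assms(1,3)
proof (induction k arbitrary: G)
  case 0
  then interpret group G by simp
  have "carrier G = {\<one>\<^bsub>G\<^esub>}" using 0 by (metis card_1_singletonE one_closed order_def power_0 singletonD)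
  then show ?case using prime_fact.one[of G] by simp
next
  case (Suc k)
  interpret group G by (rule Suc.prems(1))
  have fin: "finite (carrier G)"
    using Suc.prems(2) prime_gt_0_nat[OF assms(2)] unfolding order_def
    by (intro card_ge_0_finite) simp
  obtain H where H: "subgroup H G" "card H = p ^ k"
    using sylow_thm[OF assms(2) is_group, of k p] Suc.prems(2) fin by auto
  have "prime_fact (G\<lparr>carrier := H\<rparr>) (carrier (G\<lparr>carrier := H\<rparr>))"
    by (rule Suc.IH[OF subgroup_imp_group[OF H(1)]]) (simp add: order_def H(2))
  then have "prime_fact G H"
    using prime_fact_mono[OF _ subgroup.subset[OF H(1)]] by simp
  then show ?case
    using prime_fact_index_prime[OF fin H(1) _ assms(2)] Suc.prems(2) H(2) by simp
qed

lemma (in group) cauchy_element: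
  assumes "finite (carrier G)" "prime r" "r dvd order G"
  obtains x where "x \<in> carrier G" "x \<noteq> \<one>" "x [^] r = \<one>"
proof -
  obtain m where "order G = r ^ 1 * m" using assms(3) by auto
  then obtain H where H: "subgroup H G" "card H = r"
    using sylow_thm[OF assms(2) is_group _ assms(1), of 1 m] by auto
  interpret H: subgroup H G by fact
  have "H \<noteq> {\<one>}" using H(2) assms(2) by auto
  then obtain x where x: "x \<in> H" "x \<noteq> \<one>" using H.one_closed by blast
  have "x [^]\<^bsub>G\<lparr>carrier := H\<rparr>\<^esub> order (G\<lparr>carrier := H\<rparr>) = \<one>\<^bsub>G\<lparr>carrier := H\<rparr>\<^esub>"
    by (rule group.pow_order_eq_1[OF subgroup_imp_group[OF H(1)]]) (use x in simp)
  then have "x [^] r = \<one>" using H(2) nat_pow_consistent by (simp add: order_def)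
  then show ?thesis using that[of x] x H.mem_carrier by blast
qed

text \<open>Any other prime \<open>r\<close> dividing the order would give, by Cauchy, a nontrivial
  element whose order divides both \<open>r\<close> and \<open>p ^ k\<close>.\<close>

lemma (in group) order_prime_power_if_exponent:
  fixes p k :: nat
  assumes "finite (carrier G)" "prime p" "\<And>x. x \<in> carrier G \<Longrightarrow> x [^] (p ^ k) = \<one>"
  shows "\<exists>m. order G = p ^ m"
proof -
  have pos: "order G > 0" using assms(1) order_gt_0_iff_finite by blast
  obtain m where m: "order G = p ^ multiplicity p (order G) * m" "\<not> p dvd m"
    using multiplicity_decompose'[of "order G" p] pos assms(2)
    by (metis not_prime_unit less_numeral_extra(3))
  have "m = 1"
  proof (rule ccontr)
    assume "m \<noteq> 1"
    then obtain r where r: "prime r" "r dvd m" using prime_factor_nat by blast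
    then have "r \<noteq> p" using m by blast
    have "r dvd order G" using r(2) m(1) dvd_mult by metis
    then obtain x where x: "x \<in> carrier G" "x \<noteq> \<one>" "x [^] r = \<one>"
      using \<open>r dvd order G\<close> cauchy_element[OF assms(1) r(1)] by blast
    have "ord x dvd r" "ord x dvd p ^ k" using x assms(3) pow_eq_id by auto
    moreover have "coprime r (p ^ k)"
      using r(1) assms(2) \<open>r \<noteq> p\<close> by (simp add: primes_coprime coprime_power_right_iff)
    ultimately have "ord x = 1" by (meson coprime_common_divisor_nat)
    then show False using x ord_eq_1 by blast
  qed
  then show ?thesis using m by auto
qed

text \<open>For a prime \<open>p\<close> dividing the order, the map x -> x^p is an endomorphism.
  Its kernel has exponent \<open>p\<close>, so it is a \<open>p\<close>-group, and is nontrivial by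
  Cauchy; the image is therefore smaller and covered by induction.\<close>

lemma prime_fact_comm_group:
  assumes "comm_group G" "finite (carrier G)"
  shows "prime_fact G (carrier G)"
  using assms
proof (induction "order G" arbitrary: G rule: less_induct)
  case less
  interpret comm_group G by fact
  show ?case
  proof (cases "order G = 1")
    case True
    then have "carrier G = {\<one>\<^bsub>G\<^esub>}" by (metis card_1_singletonE one_closed order_def singletonD)
    then show ?thesis using prime_fact.one[of G] by simp
  next
    case False
    then obtain p where p: "prime p" "p dvd order G" using prime_factor_nat by blast
    define f where "f x = x [^]\<^bsub>G\<^esub> p" for x
    define I where "I = f ` carrier G"
    let ?H = "G\<lparr>carrier := I\<rparr>"
    have fhom: "f \<in> hom G G" unfolding f_def by (auto simp: hom_def nat_pow_distrib)
    interpret f: group_hom G G f by unfold_locales (rule fhom)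
    have sub: "subgroup I G" unfolding I_def by (rule f.img_is_subgroup)
    have I: "I \<subseteq> carrier G" using subgroup.subset[OF sub] .
    have grpH: "comm_group ?H"
      by (rule group.group_comm_groupI[OF subgroup_imp_group[OF sub]]) (use I m_comm in auto)
    have "card I < order G"
    proof -
      obtain x where x: "x \<in> carrier G" "x \<noteq> \<one>\<^bsub>G\<^esub>" "x [^]\<^bsub>G\<^esub> p = \<one>\<^bsub>G\<^esub>"
        using cauchy_element[OF less.prems(2) p] by blast
      have "\<not> inj_on f (carrier G)"
      proof
        assume "inj_on f (carrier G)"
        then have "x = \<one>\<^bsub>G\<^esub>" using x unfolding f_def by (auto dest!: inj_onD[of _ _ x "\<one>\<^bsub>G\<^esub>"])
        then show False using x by simp
      qed
      then have "card I \<noteq> order G"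
        unfolding I_def order_def using less.prems(2) eq_card_imp_inj_on by blast
      then show ?thesis using card_mono[OF less.prems(2) I] unfolding order_def by simp
    qed
    then have pI: "prime_fact ?H (carrier ?H)"
      using less.hyps[of ?H] grpH finite_subset[OF I less.prems(2)] by (simp add: order_def)
    have sK: "subgroup (kernel G G f) G" by (rule f.subgroup_kernel)
    let ?K = "G\<lparr>carrier := kernel G G f\<rparr>"
    have K: "kernel G G f \<subseteq> carrier G" by (auto simp: kernel_def)
    have "\<exists>m. order ?K = p ^ m"
      using group.order_prime_power_if_exponent[OF subgroup_imp_group[OF sK], of p 1] p(1)
        finite_subset[OF K less.prems(2)] nat_pow_consistent
      by (auto simp: kernel_def f_def)
    then have "prime_fact ?K (carrier ?K)"
      using prime_fact_p_group[OF subgroup_imp_group[OF sK] p(1)] by blast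
    then have pK: "prime_fact G (kernel G ?H f)"
      using prime_fact_mono[OF _ K] by (simp add: kernel_def)
    have "f \<in> hom G ?H" using fhom unfolding hom_def I_def by auto
    then show ?thesis
      by (rule prime_fact_hom[OF comm_group.axioms(2)[OF grpH] _ _ pI pK]) (simp add: I_def)
  qed
qed

lemma (in group) prime_fact_abelian_subgroup:
  assumes "finite (carrier G)" "subgroup A G" "\<And>x y. x \<in> A \<Longrightarrow> y \<in> A \<Longrightarrow> x \<otimes> y = y \<otimes> x"
  shows "prime_fact G A"
proof -
  have A: "A \<subseteq> carrier G" using assms(2) by (rule subgroup.subset)
  have "comm_group (G\<lparr>carrier := A\<rparr>)"
    by (rule group.group_comm_groupI[OF subgroup_imp_group[OF assms(2)]]) (use assms(3) in auto)
  then have "prime_fact (G\<lparr>carrier := A\<rparr>) A"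
    using prime_fact_comm_group[of "G\<lparr>carrier := A\<rparr>"] finite_subset[OF A assms(1)] by simp
  then show ?thesis using prime_fact_mono[OF _ A] by blast
qed

lemma (in group) subgroup_if_mult_closed:
  assumes "finite (carrier G)" "A \<subseteq> carrier G" "\<one> \<in> A" "\<And>x y. x \<in> A \<Longrightarrow> y \<in> A \<Longrightarrow> x \<otimes> y \<in> A"
  shows "subgroup A G"
proof (rule subgroupI)
  fix a assume a: "a \<in> A"
  then have ac: "a \<in> carrier G" using assms(2) by auto
  have "finite A" using assms(1,2) finite_subset by auto
  moreover have "inj_on ((\<otimes>) a) A"
    using ac assms(2) by (auto simp: inj_on_def subset_iff)
  ultimately have "(\<otimes>) a ` A = A"
    using assms(4) a by (intro endo_inj_surj) auto
  then obtain b where b: "b \<in> A" "a \<otimes> b = \<one>" using assms(3) by (metis imageE)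
  then have "inv b = a" using inv_equality[of a b] ac assms(2) by blast
  then show "inv a \<in> A" using b assms(2) by auto
qed (use assms in auto)

text \<open>The exponent condition makes the kernel of \<open>f\<close> a \<open>p\<close>-group.
  Replacing \<open>H\<close> by the image of \<open>f\<close> supplies the surjectivity that
  \<open>prime_fact_hom\<close> asks for.\<close>

lemma (in group) prime_fact_p_by_abelian:
  fixes p k :: nat
  assumes fin: "finite (carrier G)" and H: "comm_group H" "finite (carrier H)" and f: "f \<in> hom G H"
    and p: "prime p" and exp: "\<And>x. x \<in> carrier G \<Longrightarrow> f x = \<one>\<^bsub>H\<^esub> \<Longrightarrow> x [^] (p ^ k) = \<one>"
  shows "prime_fact G (carrier G)"
proof -
  interpret H: comm_group H by fact
  interpret f: group_hom G H f by unfold_locales (rule f)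
  define I where "I = f ` carrier G"
  have sub: "subgroup I H" unfolding I_def by (rule f.img_is_subgroup)
  have I: "I \<subseteq> carrier H" using subgroup.subset[OF sub] .
  let ?H = "H\<lparr>carrier := I\<rparr>"
  have grpH: "comm_group ?H"
    by (rule group.group_comm_groupI[OF H.subgroup_imp_group[OF sub]]) (use I H.m_comm in auto)
  have pI: "prime_fact ?H (carrier ?H)"
    using prime_fact_comm_group[OF grpH] finite_subset[OF I H(2)] by simp
  have sK: "subgroup (kernel G H f) G" by (rule f.subgroup_kernel)
  let ?K = "G\<lparr>carrier := kernel G H f\<rparr>"
  have K: "kernel G H f \<subseteq> carrier G" by (auto simp: kernel_def)
  have "\<exists>m. order ?K = p ^ m"
    using group.order_prime_power_if_exponent[OF subgroup_imp_group[OF sK], of p k] p exp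
      finite_subset[OF K fin] nat_pow_consistent
    by (auto simp: kernel_def)
  then have "prime_fact ?K (carrier ?K)"
    using prime_fact_p_group[OF subgroup_imp_group[OF sK] p] by blast
  then have pK: "prime_fact G (kernel G ?H f)"
    using prime_fact_mono[OF _ K] by (simp add: kernel_def)
  have "f \<in> hom G ?H" using f unfolding hom_def I_def by auto
  then show ?thesis
    by (rule prime_fact_hom[OF comm_group.axioms(2)[OF grpH] _ _ pI pK]) (simp add: I_def)
qed

section \<open>Fields of order \<open>q^2\<close> with \<open>q\<close> even\<close>

lemma power_2_power_add:
  fixes x y :: "'a::comm_ring_1"
  assumes "(1::'a) + 1 = 0"
  shows "(x + y) ^ (2 ^ k) = x ^ (2 ^ k) + y ^ (2 ^ k)"
proof (induction k)
  case (Suc k)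
  have two: "z + z = 0" for z :: 'a
    using assms by (metis mult.right_neutral mult_zero_right distrib_left)
  have "(x + y) ^ (2 ^ Suc k) = ((x + y) ^ (2 ^ k))\<^sup>2"
    by (simp add: power_mult[symmetric] mult.commute)
  also have "\<dots> = (x ^ (2 ^ k))\<^sup>2 + (y ^ (2 ^ k))\<^sup>2 + (x ^ (2 ^ k) * y ^ (2 ^ k) + x ^ (2 ^ k) * y ^ (2 ^ k))"
    by (simp add: Suc power2_eq_square algebra_simps)
  also have "\<dots> = x ^ (2 ^ Suc k) + y ^ (2 ^ Suc k)"
    by (simp add: two power_mult[symmetric] mult.commute)
  finally show ?case .
qed simp

lemma power_card_field:
  fixes x :: "'a::{field,finite}"
  shows "x ^ CARD('a) = x"
proof (cases "x = 0")
  case False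
  have "x ^ card (UNIV - {0::'a}) * \<Prod>(UNIV - {0}) = (\<Prod>y\<in>UNIV - {0}. x * y)"
    by (simp add: prod.distrib)
  also have "\<dots> = \<Prod>(UNIV - {0})"
    by (rule prod.reindex_bij_witness[of _ "\<lambda>y. y / x" "\<lambda>y. x * y"]) (use False in auto)
  finally have "x ^ (CARD('a) - 1) = 1" by (simp add: card_Diff_singleton)
  then have "x * x ^ (CARD('a) - 1) = x" by simp
  then show ?thesis by (metis power_minus_mult zero_less_card_finite mult.commute)
qed (simp add: zero_power)

locale unitary_setup =
  fixes n q :: nat and F :: "'a::{field,finite} itself"
  assumes q: "q = 2 ^ n" and n: "n > 1" and card_F: "CARD('a) = q\<^sup>2"
begin

definition cj :: "'a \<Rightarrow> 'a" where "cj x = x ^ q"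

lemma card_F': "CARD('a) = 2 ^ (2 * n)"
  by (simp add: card_F q power_mult[symmetric] mult.commute)

lemma q_ge: "q \<ge> 4"
proof -
  have "(2::nat) ^ 2 \<le> 2 ^ n" using n by (intro power_increasing) auto
  then show ?thesis using q by simp
qed

text \<open>Translation by 1 permutes the field, so summing over all elements gives |F| 1 = 0, and
  |F| is a power of 2.\<close>

lemma one_plus_one: "(1::'a) + 1 = 0"
proof -
  have "(\<Sum>x\<in>UNIV. x + 1) = (\<Sum>x\<in>(UNIV::'a set). x)"
    by (rule sum.reindex_bij_witness[of _ "\<lambda>y. y - 1" "\<lambda>y. y + 1"]) auto
  then have "(of_nat CARD('a) :: 'a) = 0" by (simp add: sum.distrib)
  then have "(2::'a) ^ (2 * n) = 0" unfolding card_F' by simp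
  then show ?thesis by simp
qed

lemma add_self [simp]: "x + x = 0" for x :: 'a
  using one_plus_one by (metis mult.right_neutral mult_zero_right distrib_left)

text \<open>Together with \<open>add_self\<close> this cancels equal summands once
  \<open>algebra_simps\<close> has sorted them, which is how the simplifier settles the
  characteristic 2 identities below.\<close>

lemma add_self' [simp]: "x + (x + y) = y" for x y :: 'a
  by (simp add: add.assoc[symmetric])

lemma uminus_eq [simp]: "- x = x" for x :: 'a
  by (rule minus_unique) simp

lemma add_eq_0: "x + y = 0 \<longleftrightarrow> x = y" for x y :: 'a
  by (metis add_eq_0_iff uminus_eq)

lemma two_eq_0 [simp]: "(2::'a) = 0"
  using one_plus_one by (metis one_add_one)

lemma cj_add [simp]: "cj (x + y) = cj x + cj y"
  using power_2_power_add[OF one_plus_one, of x y n] by (simp only: cj_def flip: q)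

lemma cj_mult [simp]: "cj (x * y) = cj x * cj y"
  by (simp add: cj_def power_mult_distrib)

lemma cj_divide [simp]: "cj (x / y) = cj x / cj y"
  by (simp add: cj_def power_divide)

lemma cj_power [simp]: "cj (x ^ k) = cj x ^ k"
  by (simp add: cj_def power_mult[symmetric] mult.commute)

lemma cj_0 [simp]: "cj 0 = 0" and cj_1 [simp]: "cj 1 = 1"
  using q_ge by (auto simp: cj_def)

lemma cj_cj [simp]: "cj (cj x) = x"
  using power_card_field[of x] by (simp add: cj_def card_F power_mult[symmetric] power2_eq_square)

lemma cj_eq_0 [simp]: "cj x = 0 \<longleftrightarrow> x = 0"
  using q_ge by (simp add: cj_def)

lemma cj_sum: "cj (sum f A) = (\<Sum>x\<in>A. cj (f x))"
  by (induction A rule: infinite_finite_induct) auto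

lemma cj_prod: "cj (prod f A) = (\<Prod>x\<in>A. cj (f x))"
  by (induction A rule: infinite_finite_induct) auto

lemma square_inj: "x\<^sup>2 = y\<^sup>2 \<Longrightarrow> x = y" for x y :: 'a
  by (metis power2_eq_iff uminus_eq)

lemma square_eq_1: "x * x = 1 \<longleftrightarrow> x = 1" for x :: 'a
  by (metis mult_1 power2_eq_square square_inj)

lemma square_surj: obtains y :: 'a where "y\<^sup>2 = x"
proof -
  have "surj (\<lambda>y::'a. y\<^sup>2)" by (rule finite_UNIV_inj_surj) (auto intro!: injI square_inj)
  then show ?thesis using that by (metis surjD)
qed

section \<open>Norms and traces from GF(q^2) to GF(q), and polynomials without roots\<close>

definition \<mu> :: "'a set" where "\<mu> = {x. x * cj x = 1}"

lemma mu_nonzero: "x \<in> \<mu> \<Longrightarrow> x \<noteq> 0"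
  by (auto simp: \<mu>_def)

text \<open>Square roots are unique in characteristic 2, so the root of an element of GF(q) is
  itself fixed by \<open>cj\<close>, and its norm is its square.\<close>

lemma norm_square_root:
  assumes "cj c = c"
  obtains b where "cj b = b" "b * b = c" "b * cj b = c"
proof -
  obtain b where b: "b\<^sup>2 = c" by (rule square_surj)
  then have "(cj b)\<^sup>2 = b\<^sup>2" using assms by auto
  then have "cj b = b" by (rule square_inj)
  then show ?thesis using that[of b] b by (simp add: power2_eq_square)
qed

lemma card_power_eq_le:
  assumes "k > 0"
  shows "card {x::'a. x ^ k = 1} \<le> k"
proof -
  let ?p = "Polynomial.monom 1 k - 1 :: 'a poly"
  have "Polynomial.coeff ?p 0 \<noteq> 0" using assms by simp
  then have "?p \<noteq> 0" by (metis Polynomial.coeff_0)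
  moreover have "degree ?p \<le> k" by (intro degree_diff_le) (auto simp: Polynomial.degree_monom_eq)
  ultimately have "card {x. poly ?p x = 0} \<le> k"
    using card_poly_roots_bound[of ?p] by simp
  then show ?thesis by (simp add: Polynomial.poly_monom)
qed

text \<open>A polar decomposition: each nonzero y is uniquely u s with u of norm 1 and s in GF(q),
  where s is the square root of the norm of y. The two factors have at most q + 1 and q - 1
  elements, as roots of polynomials, and the product of their sizes is q^2 - 1, so both bounds are
  attained.\<close>

lemma card_fixed: "card {x. cj x = x} = q"
  and card_mu: "card \<mu> = q + 1"
proof -
  let ?E = "{x. x \<noteq> 0 \<and> cj x = x}"
  have mu: "\<mu> = {x. x ^ (q + 1) = 1}" by (auto simp: \<mu>_def cj_def)
  have "x ^ q = x \<longleftrightarrow> x ^ (q - 1) = 1" if "x \<noteq> 0" for x :: 'a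
  proof -
    have "x ^ q = x * x ^ (q - 1)" using q_ge by (metis power_eq_if not_numeral_le_zero)
    then show ?thesis using that by auto
  qed
  then have "?E \<subseteq> {x. x ^ (q - 1) = 1}" by (auto simp: cj_def)
  then have "card ?E \<le> card {x::'a. x ^ (q - 1) = 1}" by (intro card_mono) auto
  then have le: "card \<mu> \<le> q + 1" "card ?E \<le> q - 1"
    unfolding mu using card_power_eq_le[of "q + 1"] card_power_eq_le[of "q - 1"] q_ge by auto
  have "bij_betw (\<lambda>(u, s). u * s) (\<mu> \<times> ?E) (UNIV - {0})"
  proof (rule bij_betwI')
    fix x y assume "x \<in> \<mu> \<times> ?E" "y \<in> \<mu> \<times> ?E"
    then obtain u s v t where xy: "x = (u, s)" "y = (v, t)" "u * cj u = 1" "v * cj v = 1"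
      "s \<noteq> 0" "t \<noteq> 0" "cj s = s" "cj t = t" unfolding \<mu>_def by auto
    have "s = t \<and> u = v" if eq: "u * s = v * t"
    proof -
      have "(u * s) * cj (u * s) = (v * t) * cj (v * t)" using eq by simp
      then have "(u * cj u) * (s * s) = (v * cj v) * (t * t)"
        using xy by (simp add: mult_ac)
      then have "s\<^sup>2 = t\<^sup>2" using xy(3,4) by (simp add: power2_eq_square)
      then have "s = t" by (rule square_inj)
      then show ?thesis using eq xy by simp
    qed
    then show "((\<lambda>(u, s). u * s) x = (\<lambda>(u, s). u * s) y) = (x = y)"
      using xy by auto
  next
    fix x assume "x \<in> \<mu> \<times> ?E"
    then show "(\<lambda>(u, s). u * s) x \<in> UNIV - {0}" using mu_nonzero by auto
  next
    fix y :: 'a assume "y \<in> UNIV - {0}"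
    then have y: "y \<noteq> 0" by simp
    have "cj (y * cj y) = y * cj y" by (simp add: mult.commute)
    then obtain s where s: "cj s = s" "s * s = y * cj y" by (rule norm_square_root)
    then have "s \<noteq> 0" using y by auto
    then have "y / s \<in> \<mu>" using s y by (simp add: \<mu>_def)
    then show "\<exists>x\<in>\<mu> \<times> ?E. y = (\<lambda>(u, s). u * s) x"
      using s \<open>s \<noteq> 0\<close> by (intro bexI[of _ "(y / s, s)"]) auto
  qed
  then have "card \<mu> * card ?E = card (UNIV - {0::'a})"
    using bij_betw_same_card by (fastforce simp: card_cartesian_product)
  also have "\<dots> = q\<^sup>2 - 1" by (simp add: card_F)
  also have "\<dots> = (q + 1) * (q - 1)" by (simp add: power2_eq_square algebra_simps)
  finally have eq: "card \<mu> * card ?E = (q + 1) * (q - 1)" .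
  have "1 \<in> ?E" by simp
  then have "card ?E > 0" by (metis card_gt_0_iff empty_iff finite)
  have mu_eq: "card \<mu> = q + 1"
  proof (rule ccontr)
    assume "card \<mu> \<noteq> q + 1"
    then have "card \<mu> < q + 1" using le by simp
    then have "card \<mu> * card ?E < (q + 1) * (q - 1)"
      using le(2) q_ge \<open>card ?E > 0\<close> by (intro mult_less_le_imp_less) auto
    then show False using eq by simp
  qed
  then show "card \<mu> = q + 1" .
  have "card ?E = q - 1" using eq unfolding mu_eq by (metis add_gr_0 less_one mult_left_cancel neq0_conv)
  moreover have "{x. cj x = x} = insert 0 ?E" by auto
  ultimately show "card {x. cj x = x} = q" using q_ge by simp
qed

lemma card_norm_fiber:
  assumes "cj c = c" "c \<noteq> 0"
  shows "card {b. b * cj b = c} = q + 1"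
proof -
  obtain r where r: "r * cj r = c" using assms(1) by (rule norm_square_root)
  have "{b. b * cj b = c} = (\<lambda>u. u * r) ` \<mu>"
  proof
    show "{b. b * cj b = c} \<subseteq> (\<lambda>u. u * r) ` \<mu>"
    proof clarify
      fix b assume "c = b * cj b"
      then have "b / r \<in> \<mu>" "b = (b / r) * r" using r assms(2) by (auto simp: \<mu>_def)
      then show "b \<in> (\<lambda>u. u * r) ` \<mu>" by blast
    qed
    have "(u * r) * cj (u * r) = (u * cj u) * (r * cj r)" for u by (simp add: mult_ac)
    then show "(\<lambda>u. u * r) ` \<mu> \<subseteq> {b. b * cj b = c}" using r by (auto simp: \<mu>_def)
  qed
  moreover have "inj_on (\<lambda>u. u * r) \<mu>" using r assms(2) by (auto simp: inj_on_def)
  ultimately show ?thesis by (simp add: card_image card_mu)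
qed

text \<open>Divide any x outside GF(q) by its trace, which is nonzero. Such an element serves as the
  parameter of \<open>hypb\<close>, where it links the standard form to the hyperbolic one.\<close>

lemma trace_one: obtains c where "c + cj c = 1"
proof -
  have "{x. cj x = x} \<noteq> (UNIV :: 'a set)"
  proof
    assume "{x. cj x = x} = (UNIV :: 'a set)"
    then have "q\<^sup>2 = q" using card_fixed card_F by simp
    then show False using q_ge by (simp add: power2_eq_square)
  qed
  then obtain x where "cj x \<noteq> x" by blast
  then have t: "x + cj x \<noteq> 0" using add_eq_0 by metis
  have "cj (x + cj x) = x + cj x" by (simp add: add.commute)
  then have "x / (x + cj x) + cj (x / (x + cj x)) = 1"
    using t by (metis add_divide_distrib cj_divide divide_self)
  then show ?thesis using that by blast
qed

text \<open>The map x -> x^2 + x identifies 0 and 1; on a finite field it therefore misses a value,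
  which is taken as \<open>m\<close>. The form a^2 + a b + m b^2 is then anisotropic and defines the
  non-split torus.\<close>

lemma anisotropic_quadratic: obtains m :: 'a where "\<And>x. x\<^sup>2 + x + m \<noteq> 0"
proof -
  have "\<not> inj (\<lambda>x::'a. x\<^sup>2 + x)"
    using inj_eq[of "\<lambda>x::'a. x\<^sup>2 + x" 0 1] by auto
  then have "\<not> surj (\<lambda>x::'a. x\<^sup>2 + x)"
    using finite_UNIV_surj_inj[OF finite] by blast
  then obtain m where "\<And>x::'a. x\<^sup>2 + x \<noteq> m" unfolding surj_def by metis
  then show ?thesis using that add_eq_0 by metis
qed

text \<open>A root is an element of GF(8) outside GF(2): it satisfies x^7 = 1 with x and x^3
  different from 1. As 4^3 = 64 is 1 modulo 7, the residue of 4^n is 4 or 2 when 3 does not divide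
  n, and x^(4^n) = x turns into x^4 = x or x^2 = x.\<close>

lemma cubic_no_root:
  assumes "\<not> 3 dvd n"
  shows "x ^ 3 + x\<^sup>2 + 1 \<noteq> (0::'a)"
proof
  assume "x ^ 3 + x\<^sup>2 + 1 = 0"
  then have x3: "x ^ 3 = x\<^sup>2 + 1" using add_eq_0[of "x ^ 3" "x\<^sup>2 + 1"] by (simp add: add.assoc)
  have x4: "x ^ 4 = x\<^sup>2 + x + 1"
  proof -
    have "x ^ 4 = x * x ^ 3" by (simp add: power_eq_if)
    also have "\<dots> = x * x\<^sup>2 + x" unfolding x3 by (simp add: distrib_left)
    also have "x * x\<^sup>2 = x ^ 3" by (simp add: power_eq_if)
    finally show ?thesis using x3 by (simp add: algebra_simps)
  qed
  have x7: "x ^ 7 = 1"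
  proof -
    have "x ^ 7 = x ^ 3 * x ^ 4" by (simp add: power_add[symmetric])
    also have "\<dots> = x ^ 4 + x ^ 3 + x + 1"
      unfolding x3 x4 using x4 x3 by (simp add: power_eq_if algebra_simps)
    also have "\<dots> = 1" unfolding x3 x4 by (simp add: algebra_simps)
    finally show ?thesis .
  qed
  have x0: "x \<noteq> 0" using x3 by auto
  have x1: "x ^ 3 \<noteq> 1" using x3 x0 by auto
  have x1': "x \<noteq> 1" using x1 by auto
  have r: "(4::nat) ^ n mod 7 = 4 \<or> (4::nat) ^ n mod 7 = 2"
  proof -
    have n': "n = 3 * (n div 3) + n mod 3" by simp
    have "(4::nat) ^ n = (4 ^ 3) ^ (n div 3) * 4 ^ (n mod 3)"
      by (subst n') (simp only: power_add power_mult)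
    also have "\<dots> mod 7 = ((4 ^ 3) mod 7) ^ (n div 3) * 4 ^ (n mod 3) mod 7"
      by (metis mod_mult_left_eq power_mod)
    finally have "(4::nat) ^ n mod 7 = 4 ^ (n mod 3) mod 7" by simp
    moreover have "n mod 3 = 1 \<or> n mod 3 = 2" using assms by presburger
    ultimately show ?thesis by auto
  qed
  have "CARD('a) = 4 ^ n" unfolding card_F' by (simp add: power_mult)
  then have "x ^ (4 ^ n) = x" using power_card_field[of x] by simp
  moreover have "x ^ (4 ^ n) = (x ^ 7) ^ (4 ^ n div 7) * x ^ (4 ^ n mod 7)"
    by (simp add: power_mult[symmetric] power_add[symmetric])
  ultimately have "x ^ (4 ^ n mod 7) = x" using x7 by simp
  with r have "x ^ 4 = x \<or> x\<^sup>2 = x" by auto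
  then show False
  proof
    assume "x ^ 4 = x"
    then have "x * x ^ 3 = x * 1" by (simp add: power_eq_if)
    then show False using x0 x1 by (metis mult_cancel_left)
  next
    assume "x\<^sup>2 = x"
    then have "x * x = x * 1" by (simp add: power2_eq_square)
    then show False using x0 x1' by (metis mult_cancel_left)
  qed
qed

end

section \<open>Unitary matrices\<close>

lemma vector_4:
  "(vector [w, x, y, z] :: 'a::zero^4) $ 1 = w"
  "(vector [w, x, y, z] :: 'a::zero^4) $ 2 = x"
  "(vector [w, x, y, z] :: 'a::zero^4) $ 3 = y"
  "(vector [w, x, y, z] :: 'a::zero^4) $ 4 = z"
  unfolding vector_def by simp_all

lemma mat_mult_4: "(A ** B) $ i $ j = A $ i $ 1 * B $ 1 $ j + A $ i $ 2 * B $ 2 $ j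
    + A $ i $ 3 * B $ 3 $ j + A $ i $ 4 * B $ 4 $ j" for A B :: "'a::semiring_1^4^4"
  by (simp add: matrix_matrix_mult_def sum_4)

lemma mat_vec_4: "(A *v x) $ i = A $ i $ 1 * x $ 1 + A $ i $ 2 * x $ 2
    + A $ i $ 3 * x $ 3 + A $ i $ 4 * x $ 4" for A :: "'a::semiring_1^4^4"
  by (simp add: matrix_vector_mult_def sum_4)

definition smat :: "'a::times \<Rightarrow> 'a^4^4 \<Rightarrow> 'a^4^4" where
  "smat c A = (\<chi> i j. c * A $ i $ j)"

lemma smat_nth [simp]: "smat c A $ i $ j = c * A $ i $ j"
  by (simp add: smat_def)

lemma smat_mult: "smat c A ** smat d B = smat (c * d) (A ** B)" for c d :: "'a::comm_semiring_1"
  by (simp add: vec_eq_iff mat_mult_4 algebra_simps)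

lemma smat_vec: "smat c A *v x = c *s (A *v x)" for c :: "'a::comm_semiring_1"
  by (simp add: vec_eq_iff mat_vec_4 algebra_simps)

lemma det_smat: "det (smat c A) = c ^ 4 * det A" for c :: "'a::comm_ring_1"
proof -
  have "smat c A = (\<chi> i. c *s A $ i)" by (simp add: vec_eq_iff)
  then show ?thesis using det_rows_mul[of "\<lambda>i. c" "\<lambda>i. A $ i"] by simp
qed

definition act :: "'a::semiring_1^4^4 \<Rightarrow> ('a^4) set \<Rightarrow> ('a^4) set" where
  "act A L = (\<lambda>x. A *v x) ` L"

lemma act_mult: "act (A ** B) L = act A (act B L)" for A :: "'a::comm_semiring_1^4^4"
  by (auto simp: act_def image_image matrix_vector_mul_assoc)

lemma act_one: "act (mat 1) L = L"
  by (simp add: act_def)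

lemma act_smat:
  fixes c :: "'a::field"
  assumes "c \<noteq> 0" "\<And>x d. x \<in> L \<Longrightarrow> d *s x \<in> L"
  shows "act (smat c A) L = act A L"
proof -
  have scale: "A *v (d *s x) = d *s (A *v x)" for d x by (simp add: vec_eq_iff mat_vec_4 algebra_simps)
  show ?thesis
  proof
    show "act (smat c A) L \<subseteq> act A L"
      unfolding act_def smat_vec using assms(2) scale[symmetric] by auto
    show "act A L \<subseteq> act (smat c A) L"
    proof
      fix y assume "y \<in> act A L"
      then obtain x where x: "x \<in> L" "y = A *v x" by (auto simp: act_def)
      then have "y = smat c A *v ((1 / c) *s x)"
        using assms(1) by (simp add: smat_vec scale vec_eq_iff)
      then show "y \<in> act (smat c A) L" using assms(2) x by (auto simp: act_def)
    qed
  qed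
qed

section \<open>The Hermitian form and the unitary groups\<close>

context unitary_setup
begin

definition h :: "'a^4 \<Rightarrow> 'a^4 \<Rightarrow> 'a" where
  "h x y = (\<Sum>i\<in>UNIV. cj (x $ i) * y $ i)"

lemma h_4: "h x y = cj (x $ 1) * y $ 1 + cj (x $ 2) * y $ 2 + cj (x $ 3) * y $ 3 + cj (x $ 4) * y $ 4"
  by (simp add: h_def sum_4)

abbreviation ct :: "'a^4^4 \<Rightarrow> 'a^4^4" where "ct \<equiv> conj_transpose q"

lemma ct_nth [simp]: "ct A $ i $ j = cj (A $ j $ i)"
  by (simp add: conj_transpose_def cj_def)

lemma ct_mult: "ct (A ** B) = ct B ** ct A"
  by (simp add: vec_eq_iff mat_mult_4 algebra_simps)

lemma ct_ct [simp]: "ct (ct A) = A"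
  by (simp add: vec_eq_iff)

lemma ct_one [simp]: "ct (mat 1) = mat 1"
  by (simp add: vec_eq_iff mat_def)

lemma det_ct: "det (ct A) = cj (det A)"
proof -
  \<comment> \<open>Signs disappear because -1 = 1, so \<open>cj\<close> passes through the Leibniz
    formula as a mere field automorphism.\<close>
  have sgn: "(of_int (sign p) :: 'a) = 1" for p :: "4 \<Rightarrow> 4"
    by (auto simp: sign_def)
  have "det (ct A) = det (transpose (ct A))" by simp
  also have "\<dots> = cj (det A)"
    unfolding det_def by (simp add: sgn cj_sum cj_prod transpose_def)
  finally show ?thesis .
qed

text \<open>The full unitary group: the matrices moving lines and the tori are built here without
  regard to the determinant and pushed into \<open>SU4 q\<close> by \<open>to_SU\<close>.\<close>

definition GU :: "('a^4^4) set" where "GU = {A. ct A ** A = mat 1}"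

lemma GU_D: "A \<in> GU \<Longrightarrow> ct A ** A = mat 1" "A \<in> GU \<Longrightarrow> A ** ct A = mat 1"
  by (auto simp: GU_def intro: matrix_left_right_inverse1)

lemma GU_mult: "A \<in> GU \<Longrightarrow> B \<in> GU \<Longrightarrow> A ** B \<in> GU"
  unfolding GU_def by (simp add: ct_mult) (metis matrix_mul_assoc matrix_mul_lid)

lemma GU_one: "mat 1 \<in> GU"
  by (simp add: GU_def)

lemma GU_ct: "A \<in> GU \<Longrightarrow> ct A \<in> GU"
  using GU_D(2) by (auto simp: GU_def)

lemma h_adjoint: "h (A *v x) y = h x (ct A *v y)"
  by (simp add: h_4 mat_vec_4 algebra_simps)

lemma GU_h: "A \<in> GU \<Longrightarrow> h (A *v x) (A *v y) = h x y"
  by (simp add: h_adjoint matrix_vector_mul_assoc GU_D)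

lemma GU_det: "A \<in> GU \<Longrightarrow> det A * cj (det A) = 1"
  by (metis GU_D(2) det_I det_ct det_mul)

lemma SU4_carrier: "carrier (SU4 q) = {A \<in> GU. det A = 1}"
  by (simp add: SU4_def GU_def)

lemma SU4_mult [simp]: "A \<otimes>\<^bsub>SU4 q\<^esub> B = A ** B" for A B :: "'a^4^4"
  by (simp add: SU4_def)

lemma SU4_one [simp]: "\<one>\<^bsub>SU4 q\<^esub> = (mat 1 :: 'a^4^4)"
  by (simp add: SU4_def)

lemma SU4_group: "group (SU4 q :: ('a^4^4) monoid)"
proof (rule groupI)
  fix A :: "'a^4^4" assume A: "A \<in> carrier (SU4 q)"
  then have "ct A \<in> carrier (SU4 q)"
    by (simp add: SU4_carrier GU_ct det_ct)
  then show "\<exists>B\<in>carrier (SU4 q). B \<otimes>\<^bsub>SU4 q\<^esub> A = \<one>\<^bsub>SU4 q\<^esub>"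
    using A GU_D by (intro bexI[of _ "ct A"]) (auto simp: SU4_carrier)
qed (auto simp: SU4_carrier GU_mult det_mul matrix_mul_assoc GU_one)

sublocale SU: group "SU4 q :: ('a^4^4) monoid"
  by (rule SU4_group)

lemma SU_finite: "finite (carrier (SU4 q :: ('a^4^4) monoid))"
  by (rule finite)

lemma SU_inv: "A \<in> carrier (SU4 q) \<Longrightarrow> inv\<^bsub>SU4 q\<^esub> A = ct A" for A :: "'a^4^4"
  by (rule SU.inv_equality) (auto simp: SU4_carrier GU_D GU_ct det_ct)

text \<open>Since \<open>q + 1\<close> is prime to 4, every unitary matrix has a unique scalar multiple of
  determinant 1; taking it is a homomorphism onto \<open>SU\<close>.\<close>

definition to_SU :: "'a^4^4 \<Rightarrow> 'a^4^4" where
  "to_SU A = smat (det A ^ (q div 4)) A"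

lemma to_SU_mult: "to_SU (A ** B) = to_SU A ** to_SU B"
  by (simp add: to_SU_def smat_mult det_mul power_mult_distrib)

text \<open>With d = \<open>det A\<close>, the fourth power of d^(q/4) is d^q = \<open>cj d\<close>,
  and this is the inverse of d because d has norm 1. Divisibility of q by 4 comes from n >
  1.\<close>

lemma to_SU_factor:
  assumes "A \<in> GU"
  shows "det A ^ (q div 4) * cj (det A ^ (q div 4)) = 1" "(det A ^ (q div 4)) ^ 4 * det A = 1"
proof -
  show "det A ^ (q div 4) * cj (det A ^ (q div 4)) = 1"
    using GU_det[OF assms] by (simp add: power_mult_distrib[symmetric])
  have "4 dvd q" using n unfolding q by (metis power2_eq_square num_double numeral_times_numeral
      le_imp_power_dvd One_nat_def Suc_leI numeral_2_eq_2)
  then have "(det A ^ (q div 4)) ^ 4 = cj (det A)"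
    by (simp add: power_mult[symmetric] cj_def)
  then show "(det A ^ (q div 4)) ^ 4 * det A = 1"
    using GU_det[OF assms] by (simp add: mult.commute)
qed

lemma to_SU_in:
  assumes "A \<in> GU"
  shows "to_SU A \<in> carrier (SU4 q)"
proof -
  have "ct (smat c A) ** smat c A = smat (cj c * c) (ct A ** A)" for c
    by (simp add: vec_eq_iff mat_mult_4 algebra_simps)
  then have "ct (to_SU A) ** to_SU A = mat 1"
    unfolding to_SU_def GU_D(1)[OF assms] using to_SU_factor(1)[OF assms]
    by (simp add: vec_eq_iff mult.commute)
  moreover have "det (to_SU A) = 1"
    unfolding to_SU_def det_smat by (rule to_SU_factor(2)[OF assms])
  ultimately show ?thesis by (simp add: SU4_carrier GU_def)
qed

lemma to_SU_one: "to_SU (mat 1) = mat 1"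
  by (simp add: to_SU_def vec_eq_iff)

lemma act_to_SU:
  assumes "A \<in> GU" "\<And>x d. x \<in> L \<Longrightarrow> d *s x \<in> L"
  shows "act (to_SU A) L = act A L"
proof -
  have "det A ^ (q div 4) \<noteq> 0" using to_SU_factor(2)[OF assms(1)] by auto
  then show ?thesis unfolding to_SU_def by (intro act_smat assms(2))
qed

lemma subgroup_to_SU:
  assumes "X \<subseteq> GU" "mat 1 \<in> X" "\<And>A B. A \<in> X \<Longrightarrow> B \<in> X \<Longrightarrow> A ** B \<in> X"
  shows "subgroup (to_SU ` X) (SU4 q)"
proof (rule SU.subgroup_if_mult_closed[OF SU_finite])
  show "to_SU ` X \<subseteq> carrier (SU4 q)" using assms(1) to_SU_in by auto
  show "\<one>\<^bsub>SU4 q\<^esub> \<in> to_SU ` X" using assms(2) to_SU_one by force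
  show "A \<otimes>\<^bsub>SU4 q\<^esub> B \<in> to_SU ` X" if "A \<in> to_SU ` X" "B \<in> to_SU ` X" for A B
    using that assms(3) to_SU_mult[symmetric] by auto
qed

lemma prime_fact_to_SU:
  assumes "X \<subseteq> GU" "mat 1 \<in> X" "\<And>A B. A \<in> X \<Longrightarrow> B \<in> X \<Longrightarrow> A ** B \<in> X"
    "\<And>A B. A \<in> X \<Longrightarrow> B \<in> X \<Longrightarrow> A ** B = B ** A"
  shows "prime_fact (SU4 q) (to_SU ` X)"
proof (rule SU.prime_fact_abelian_subgroup[OF SU_finite subgroup_to_SU])
  show "A \<otimes>\<^bsub>SU4 q\<^esub> B = B \<otimes>\<^bsub>SU4 q\<^esub> A" if AB: "A \<in> to_SU ` X" "B \<in> to_SU ` X" for A B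
  proof -
    obtain A' B' where "A' \<in> X" "B' \<in> X" "A = to_SU A'" "B = to_SU B'" using AB by blast
    then show ?thesis using assms(4)[of A' B'] by (simp add: to_SU_mult[symmetric])
  qed
qed (use assms in auto)

section \<open>Permutation and diagonal matrices, and the centre\<close>

definition swap_mat :: "4 \<Rightarrow> 4 \<Rightarrow> 'a^4^4" where
  "swap_mat a b = (\<chi> i j. if i = Transposition.transpose a b j then 1 else 0)"

lemma swap_mat_vec: "(swap_mat a b *v x) $ i = x $ (Transposition.transpose a b i)"
proof -
  have "i = Transposition.transpose a b j \<longleftrightarrow> j = Transposition.transpose a b i" for j
    by (metis Transposition.transpose_involutory)
  then have "(swap_mat a b *v x) $ i = (\<Sum>j\<in>UNIV. if j = Transposition.transpose a b i then x $ j else 0)"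
    unfolding swap_mat_def matrix_vector_mult_def by (simp add: if_distrib[of "\<lambda>c. c * _"] cong: if_cong)
  then show ?thesis by simp
qed

lemma GU_I: "(\<And>x y. h (A *v x) (A *v y) = h x y) \<Longrightarrow> A \<in> GU"
proof -
  assume *: "\<And>x y. h (A *v x) (A *v y) = h x y"
  have "h x y = h x ((ct A ** A) *v y)" for x y
    using *[of x y] by (simp add: h_adjoint matrix_vector_mul_assoc)
  then have "((ct A ** A) *v y) $ i = y $ i" for y i
  proof -
    assume **: "\<And>x y. h x y = h x ((ct A ** A) *v y)"
    have "h (axis i 1) z = z $ i" for z
    proof -
      have "h (axis i 1) z = (\<Sum>j\<in>UNIV. if j = i then z $ j else 0)"
        unfolding h_def axis_def by (rule sum.cong) auto
      then show ?thesis by simp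
    qed
    then show ?thesis using **[of "axis i 1" y] by simp
  qed
  then have "\<And>y. (ct A ** A) *v y = mat 1 *v y" by (simp add: vec_eq_iff)
  then have "ct A ** A = mat 1" using matrix_eq by blast
  then show "A \<in> GU" by (simp add: GU_def)
qed

lemma swap_mat_GU: "swap_mat a b \<in> GU"
proof (rule GU_I)
  fix x y
  show "h (swap_mat a b *v x) (swap_mat a b *v y) = h x y"
    unfolding h_def swap_mat_vec
    by (rule sum.reindex_bij_witness[of _ "Transposition.transpose a b" "Transposition.transpose a b"]) auto
qed

definition diag :: "'a \<Rightarrow> 'a \<Rightarrow> 'a \<Rightarrow> 'a \<Rightarrow> 'a^4^4" where
  "diag a b c d = vector [vector [a, 0, 0, 0], vector [0, b, 0, 0], vector [0, 0, c, 0], vector [0, 0, 0, d]]"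

lemma diag_mult: "diag a b c d ** diag a' b' c' d' = diag (a * a') (b * b') (c * c') (d * d')"
  unfolding vec_eq_iff forall_4 mat_mult_4 diag_def vector_4 by simp

lemma diag_vec: "diag a b c d *v x = vector [a * x $ 1, b * x $ 2, c * x $ 3, d * x $ 4]"
  unfolding vec_eq_iff forall_4 mat_vec_4 diag_def vector_4 by simp

lemma diag_GU:
  assumes "a \<in> \<mu>" "b \<in> \<mu>" "c \<in> \<mu>" "d \<in> \<mu>"
  shows "diag a b c d \<in> GU"
proof (rule GU_I)
  fix x y
  have "cj (u * s) * (u * t) = cj s * t" if "u \<in> \<mu>" for u s t
  proof -
    have "cj (u * s) * (u * t) = (u * cj u) * (cj s * t)" by (simp add: mult_ac)
    also have "u * cj u = 1" using that by (simp add: \<mu>_def)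
    finally show ?thesis by simp
  qed
  then show "h (diag a b c d *v x) (diag a b c d *v y) = h x y"
    using assms by (simp only: h_4 diag_vec vector_4)
qed

text \<open>A central matrix commutes with all of \<open>GU\<close>, whose members are scalar
  multiples of members of \<open>SU4 q\<close>. Diagonal matrices with a single entry other than 1
  force it to be diagonal, coordinate swaps force its diagonal to be constant, and z^4 = 1 leaves
  only z = 1 in characteristic 2.\<close>

lemma center_trivial: "grp_center (SU4 q :: ('a^4^4) monoid) = {mat 1}"
proof
  show "{mat 1} \<subseteq> grp_center (SU4 q :: ('a^4^4) monoid)"
    using SU.one_closed by (auto simp: grp_center_def)
  show "grp_center (SU4 q :: ('a^4^4) monoid) \<subseteq> {mat 1}"
  proof
    fix Z :: "'a^4^4" assume Z: "Z \<in> grp_center (SU4 q)"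
    have comm: "Z ** A = A ** Z" if A: "A \<in> GU" for A
    proof -
      define c where "c = det A ^ (q div 4)"
      have c: "c \<noteq> 0" using to_SU_factor(2)[OF A] unfolding c_def by auto
      have "Z ** smat c A = smat c A ** Z"
        using Z to_SU_in[OF A] unfolding grp_center_def to_SU_def c_def by auto
      then have "smat c (Z ** A) = smat c (A ** Z)"
        using smat_mult[of 1 Z c A] smat_mult[of c A 1 Z] by (simp add: smat_def)
      then show ?thesis using c by (simp add: vec_eq_iff)
    qed
    have "card \<mu> > card {1::'a}" using card_mu q_ge by simp
    then obtain t where t: "t \<in> \<mu>" "t \<noteq> 1"
      by (metis card_mono finite.emptyI finite.insertI insertCI leD subsetI)
    have one: "1 \<in> \<mu>" by (simp add: \<mu>_def)
    have comp: "(Z ** A) $ i $ j = (A ** Z) $ i $ j" if "A \<in> GU" for A i j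
      using comm[OF that] by simp
    have offdiag: "Z $ i $ j = 0" if "i \<noteq> j" for i j
    proof -
      have "\<forall>j. j \<noteq> 1 \<longrightarrow> Z $ 1 $ j = 0"
        unfolding forall_4 using t(2) comp[OF diag_GU[OF t(1) one one one], of 1 2] comp[OF diag_GU[OF t(1) one one one], of 1 3] comp[OF diag_GU[OF t(1) one one one], of 1 4]
        by (simp add: mat_mult_4 diag_def vector_4)
      moreover
      have "\<forall>j. j \<noteq> 2 \<longrightarrow> Z $ 2 $ j = 0"
        unfolding forall_4 using t(2) comp[OF diag_GU[OF one t(1) one one], of 2 1] comp[OF diag_GU[OF one t(1) one one], of 2 3] comp[OF diag_GU[OF one t(1) one one], of 2 4]
        by (simp add: mat_mult_4 diag_def vector_4)
      moreover
      have "\<forall>j. j \<noteq> 3 \<longrightarrow> Z $ 3 $ j = 0"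
        unfolding forall_4 using t(2) comp[OF diag_GU[OF one one t(1) one], of 3 1] comp[OF diag_GU[OF one one t(1) one], of 3 2] comp[OF diag_GU[OF one one t(1) one], of 3 4]
        by (simp add: mat_mult_4 diag_def vector_4)
      moreover
      have "\<forall>j. j \<noteq> 4 \<longrightarrow> Z $ 4 $ j = 0"
        unfolding forall_4 using t(2) comp[OF diag_GU[OF one one one t(1)], of 4 1] comp[OF diag_GU[OF one one one t(1)], of 4 2] comp[OF diag_GU[OF one one one t(1)], of 4 3]
        by (simp add: mat_mult_4 diag_def vector_4)
      ultimately have "\<forall>i j. i \<noteq> j \<longrightarrow> Z $ i $ j = 0"
        using forall_4[of "\<lambda>i. \<forall>j. i \<noteq> j \<longrightarrow> Z $ i $ j = 0"] by metis
      then show ?thesis using that by blast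
    qed
    have diag_eq: "Z $ i $ i = Z $ 1 $ 1" for i
    proof -
      let ?v = "Z *v axis 1 1"
      have "Z *v (swap_mat 1 i *v axis 1 1) = swap_mat 1 i *v (Z *v axis 1 1)"
        using comm[OF swap_mat_GU[of 1 i]] by (simp add: matrix_vector_mul_assoc)
      moreover have "swap_mat 1 i *v axis 1 1 = axis i 1"
        by (auto simp: vec_eq_iff swap_mat_vec axis_def Transposition.transpose_def)
      ultimately have "(Z *v axis i 1) $ i = (swap_mat 1 i *v (Z *v axis 1 1)) $ i" by simp
      moreover have "(Z *v axis k 1) $ l = Z $ l $ k" for k l
        by (simp add: matrix_vector_mult_def axis_def if_distrib[of "\<lambda>c. _ * c"] cong: if_cong)
      ultimately show ?thesis by (simp add: swap_mat_vec)
    qed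
    have "det Z = 1" using Z by (auto simp: grp_center_def SU4_carrier)
    moreover have "det Z = (Z $ 1 $ 1) ^ 4"
    proof -
      have "Z = smat (Z $ 1 $ 1) (mat 1)"
        using offdiag diag_eq by (auto simp: vec_eq_iff mat_def)
      then have "det Z = det (smat (Z $ 1 $ 1) (mat 1))" by simp
      then show ?thesis by (simp add: det_smat)
    qed
    ultimately have "((Z $ 1 $ 1)\<^sup>2)\<^sup>2 = (1\<^sup>2)\<^sup>2" by (simp add: power_mult[symmetric])
    then have "Z $ 1 $ 1 = 1" using square_inj by blast
    then show "Z \<in> {mat 1}"
      using offdiag diag_eq by (auto simp: vec_eq_iff mat_def)
  qed
qed

text \<open>Modulo the trivial centre every coset is a singleton, so \<open>the_elem\<close> is an
  isomorphism onto \<open>SU4 q\<close>, along which the factorisation is pulled back.\<close>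

lemma prime_fact_PSU4:
  assumes "prime_fact (SU4 q) (carrier (SU4 q :: ('a^4^4) monoid))"
  shows "prime_fact (PSU4 q) (carrier (PSU4 q :: ('a^4^4) set monoid))"
proof -
  have PSU: "(PSU4 q :: ('a^4^4) set monoid) = SU4 q Mod {\<one>\<^bsub>SU4 q\<^esub>}"
    by (simp add: PSU4_def center_trivial)
  have norm: "{\<one>\<^bsub>SU4 q\<^esub>} \<lhd> (SU4 q :: ('a^4^4) monoid)" by (rule SU.one_is_normal)
  then have grp: "group (PSU4 q :: ('a^4^4) set monoid)"
    unfolding PSU by (rule normal.factorgroup_is_group)
  have iso: "the_elem \<in> iso (PSU4 q :: ('a^4^4) set monoid) (SU4 q)"
    unfolding PSU by (rule SU.trivial_factor_iso)
  then have inj: "inj_on the_elem (carrier (PSU4 q :: ('a^4^4) set monoid))"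
    and hom: "the_elem \<in> hom (PSU4 q :: ('a^4^4) set monoid) (SU4 q)"
    and surj: "the_elem ` carrier (PSU4 q :: ('a^4^4) set monoid) = carrier (SU4 q)"
    by (auto simp: iso_def bij_betw_def)
  interpret P: group_hom "PSU4 q :: ('a^4^4) set monoid" "SU4 q" the_elem
    using grp hom SU4_group by (simp add: group_hom_def group_hom_axioms_def)
  have "kernel (PSU4 q) (SU4 q) the_elem = {\<one>\<^bsub>PSU4 q :: ('a^4^4) set monoid\<^esub>}"
    using inj P.inj_on_one_iff by (auto simp: kernel_def)
  then have "prime_fact (PSU4 q) (kernel (PSU4 q :: ('a^4^4) set monoid) (SU4 q) the_elem)"
    using prime_fact.one by metis
  with group.prime_fact_hom[OF grp SU4_group hom surj assms] show ?thesis .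
qed

section \<open>Totally isotropic lines\<close>

text \<open>The graph of the identity from the first coordinate plane to the second. It is isotropic
  for the standard form because each product occurs twice in \<open>h\<close> and cancels.\<close>

definition L0 :: "('a^4) set" where "L0 = {v. v $ 1 = v $ 3 \<and> v $ 2 = v $ 4}"

definition e0 :: "'a^4" where "e0 = vector [1, 0, 1, 0]"
definition f0 :: "'a^4" where "f0 = vector [0, 1, 0, 1]"

lemma L0_eq: "v \<in> L0 \<longleftrightarrow> v = v $ 1 *s e0 + v $ 2 *s f0"
  by (simp add: L0_def vec_eq_iff[of v] forall_4 e0_def f0_def vector_4) metis

lemma L0_scale: "x \<in> L0 \<Longrightarrow> d *s x \<in> L0"
  by (simp add: L0_def)

lemma h_add: "h (x + y) z = h x z + h y z" "h x (y + z) = h x y + h x z"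
  by (simp_all add: h_4 algebra_simps)

lemma h_scale: "h (c *s x) y = cj c * h x y" "h x (c *s y) = c * h x y"
  by (simp_all add: h_4 algebra_simps)

lemma h_sym: "h y x = cj (h x y)"
  by (simp add: h_4 algebra_simps)

definition isotropic_line :: "('a^4) set \<Rightarrow> bool" where
  "isotropic_line L \<longleftrightarrow> (\<exists>x y. L = {s *s x + t *s y | s t. True} \<and>
     (\<forall>s t. s *s x + t *s y = 0 \<longrightarrow> s = 0 \<and> t = 0) \<and> h x x = 0 \<and> h x y = 0 \<and> h y y = 0)"

lemma isotropic_line_closed:
  assumes "isotropic_line L" "v \<in> L" "w \<in> L"
  shows "v + w \<in> L" "c *s v \<in> L" "h v w = 0"
proof -
  obtain x y where L: "L = {s *s x + t *s y | s t. True}"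
    and h: "h x x = 0" "h x y = 0" "h y y = 0" using assms(1) unfolding isotropic_line_def by blast
  obtain s t s' t' where v: "v = s *s x + t *s y" and w: "w = s' *s x + t' *s y"
    using assms(2,3) L by blast
  have "v + w = (s + s') *s x + (t + t') *s y" unfolding v w by (simp add: vec_eq_iff algebra_simps)
  then show "v + w \<in> L" unfolding L by blast
  have "c *s v = (c * s) *s x + (c * t) *s y" unfolding v by (simp add: vec_eq_iff algebra_simps)
  then show "c *s v \<in> L" unfolding L by blast
  have "h y x = 0" using h(2) h_sym[of y x] by simp
  then show "h v w = 0" unfolding v w by (simp add: h_add h_scale h)
qed

lemma isotropic_line_act:
  assumes "A \<in> GU"
  shows "isotropic_line (act A L0)"
  unfolding isotropic_line_def
proof (intro exI conjI allI impI)
  let ?x = "A *v e0" and ?y = "A *v f0"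
  have lin: "A *v (s *s e0 + t *s f0) = s *s ?x + t *s ?y" for s t
    by (simp add: vec_eq_iff mat_vec_4 algebra_simps)
  show "act A L0 = {s *s ?x + t *s ?y | s t. True}"
  proof
    show "act A L0 \<subseteq> {s *s ?x + t *s ?y | s t. True}"
    proof
      fix w assume "w \<in> act A L0"
      then obtain v where "v \<in> L0" "w = A *v v" unfolding act_def by blast
      then have "w = A *v (v $ 1 *s e0 + v $ 2 *s f0)" using L0_eq by metis
      then show "w \<in> {s *s ?x + t *s ?y | s t. True}" unfolding lin by blast
    qed
    show "{s *s ?x + t *s ?y | s t. True} \<subseteq> act A L0"
    proof clarify
      fix s t
      have "s *s e0 + t *s f0 \<in> L0" by (simp add: L0_def e0_def f0_def vector_4)
      then show "s *s ?x + t *s ?y \<in> act A L0" unfolding lin[symmetric] act_def by blast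
    qed
  qed
  show "h ?x ?x = 0" "h ?x ?y = 0" "h ?y ?y = 0"
    unfolding GU_h[OF assms] by (simp_all add: h_4 e0_def f0_def vector_4)
  fix s t assume "s *s ?x + t *s ?y = 0"
  then have "ct A *v (A *v (s *s e0 + t *s f0)) = ct A *v 0" unfolding lin by simp
  then have "s *s e0 + t *s f0 = 0" by (simp add: matrix_vector_mul_assoc GU_D[OF assms])
  then have "(s *s e0 + t *s f0) $ 1 = 0" "(s *s e0 + t *s f0) $ 2 = 0" by simp_all
  then show "s = 0" "t = 0" by (simp_all add: e0_def f0_def vector_4)
qed

text \<open>The graph of the matrix with columns \<open>(a, b)\<close> and
  \<open>(l * cj b, l * cj a)\<close>. For a cj a + b cj b = 1 and l in \<open>\<mu>\<close> these
  are the 2 by 2 unitary matrices in characteristic 2, and l is the determinant.\<close>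

definition line1 :: "'a \<Rightarrow> 'a \<Rightarrow> 'a \<Rightarrow> ('a^4) set" where
  "line1 a b l = {v. v $ 3 = a * v $ 1 + l * cj b * v $ 2 \<and> v $ 4 = b * v $ 1 + l * cj a * v $ 2}"

text \<open>The span of (1, a, 0, 0) and (0, 0, 1, b). For a and b in \<open>\<mu>\<close> it joins
  an isotropic point of the first coordinate plane to one of the second.\<close>

definition line2 :: "'a \<Rightarrow> 'a \<Rightarrow> ('a^4) set" where
  "line2 a b = {v. v $ 2 = a * v $ 1 \<and> v $ 4 = b * v $ 3}"

lemma norm_eq_imp_mu: "x * cj x = y * cj y \<Longrightarrow> y \<noteq> 0 \<Longrightarrow> x / y \<in> \<mu>"
  by (simp add: \<mu>_def)

lemma mu_solve: "b \<in> \<mu> \<Longrightarrow> x + cj b * y = 0 \<Longrightarrow> y = b * x"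
proof -
  assume b: "b \<in> \<mu>" and eq: "x + cj b * y = 0"
  have "b * x = b * (cj b * y)" using eq add_eq_0 by metis
  also have "\<dots> = (b * cj b) * y" by (simp add: mult_ac)
  also have "b * cj b = 1" using b by (simp add: \<mu>_def)
  finally show "y = b * x" by simp
qed

text \<open>The two families are separated by the projection of \<open>L\<close> to the first two
  coordinates: if it is bijective, \<open>L\<close> is a graph, and isotropy makes the matrix of
  this graph unitary; otherwise \<open>L\<close> contains a nonzero vector supported on the last two
  coordinates.\<close>

lemma isotropic_line_cases:
  assumes L: "isotropic_line L"
  shows "(\<exists>a b l. a * cj a + b * cj b = 1 \<and> l \<in> \<mu> \<and> L = line1 a b l) \<or>
    (\<exists>a\<in>\<mu>. \<exists>b\<in>\<mu>. L = line2 a b)"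
proof -
  have addL: "v + w \<in> L" and hL: "h v w = 0" if "v \<in> L" "w \<in> L" for v w
    using isotropic_line_closed[OF L that] by blast+
  have scL: "c *s v \<in> L" if "v \<in> L" for v c
    using isotropic_line_closed(2)[OF L that that] .
  obtain x y where Lxy: "L = {s *s x + t *s y | s t. True}"
    and indep: "\<And>s t. s *s x + t *s y = 0 \<Longrightarrow> s = 0 \<and> t = 0"
    using L unfolding isotropic_line_def by blast
  have inL: "s *s x + t *s y \<in> L" for s t unfolding Lxy by blast
  have xL: "x \<in> L" and yL: "y \<in> L" using inL[of 1 0] inL[of 0 1] by simp_all
  \<comment> \<open>The determinant of the projection to the first two coordinates, with a plus sign
    by characteristic 2.\<close>
  define D where "D = x $ 1 * y $ 2 + x $ 2 * y $ 1"
  show ?thesis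
  proof (cases "D = 0")
    case False
    \<comment> \<open>By Cramer's rule \<open>p\<close> and \<open>r\<close> project to (1, 0) and
      (0, 1).\<close>
    define p where "p = (y $ 2 / D) *s x + (x $ 2 / D) *s y"
    define r where "r = (y $ 1 / D) *s x + (x $ 1 / D) *s y"
    have pL: "p \<in> L" and rL: "r \<in> L" unfolding p_def r_def by (rule inL)+
    have "y $ 2 * x $ 1 + x $ 2 * y $ 1 = D" "y $ 1 * x $ 2 + x $ 1 * y $ 2 = D"
      unfolding D_def by (simp_all add: mult_ac add_ac)
    then have p12: "p $ 1 = 1" "p $ 2 = 0" and r12: "r $ 1 = 0" "r $ 2 = 1"
      using False unfolding p_def r_def
      by (simp_all add: add_divide_distrib[symmetric] mult.commute)
    define a b c d where "a = p $ 3" and "b = p $ 4" and "c = r $ 3" and "d = r $ 4"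
    have L_pr: "v = v $ 1 *s p + v $ 2 *s r" if "v \<in> L" for v
    proof -
      define w where "w = v + ((v $ 1) *s p + (v $ 2) *s r)"
      have "w \<in> L" unfolding w_def using that pL rL by (intro addL scL)
      then obtain s t where w: "w = s *s x + t *s y" unfolding Lxy by blast
      have w12: "w $ 1 = 0" "w $ 2 = 0" unfolding w_def by (simp_all add: p12 r12)
      then have *: "s * x $ 1 + t * y $ 1 = 0" "s * x $ 2 + t * y $ 2 = 0" unfolding w by simp_all
      have "s * D = y $ 2 * (s * x $ 1 + t * y $ 1) + y $ 1 * (s * x $ 2 + t * y $ 2)"
        "t * D = x $ 2 * (s * x $ 1 + t * y $ 1) + x $ 1 * (s * x $ 2 + t * y $ 2)"
        unfolding D_def by (simp_all add: algebra_simps)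
      then have "s = 0" "t = 0" using False unfolding * by simp_all
      then have "w = 0" unfolding w by simp
      then have "v $ i + (v $ 1 *s p + v $ 2 *s r) $ i = 0" for i
        unfolding w_def by (metis vector_add_component zero_index)
      then have "v $ i = (v $ 1 *s p + v $ 2 *s r) $ i" for i
        by (rule add_eq_0[THEN iffD1])
      then show ?thesis using vec_eq_iff by blast
    qed
    have hpp: "1 + a * cj a + b * cj b = 0" and hrr: "1 + c * cj c + d * cj d = 0"
      and hpr: "cj a * c + cj b * d = 0"
      using hL[OF pL pL] hL[OF rL rL] hL[OF pL rL]
      unfolding h_4 p12 r12 a_def b_def c_def d_def by (simp_all add: mult.commute)
    have ab: "a * cj a + b * cj b = 1" using hpp add_eq_0 by (metis add.assoc)
    have cd: "c * cj c + d * cj d = 1" using hrr add_eq_0 by (metis add.assoc)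
    \<comment> \<open>The determinant of the matrix with columns \<open>(a, b)\<close> and
      \<open>(c, d)\<close>; unitarity expresses the second column through the first and this
      determinant.\<close>
    define l where "l = b * c + a * d"
    have "l * cj b = c * (a * cj a + b * cj b) + a * (cj a * c + cj b * d)"
      "l * cj a = d * (a * cj a + b * cj b) + b * (cj a * c + cj b * d)"
      unfolding l_def by (simp_all add: algebra_simps)
    then have lb: "l * cj b = c" and la: "l * cj a = d" unfolding ab hpr by simp_all
    have "l * cj l * (a * cj a + b * cj b) = (l * cj b) * cj (l * cj b) + (l * cj a) * cj (l * cj a)"
      by (simp add: algebra_simps)
    then have "l \<in> \<mu>" unfolding ab lb la cd by (simp add: \<mu>_def)
    moreover have "L = line1 a b l"
    proof
      show "L \<subseteq> line1 a b l"
      proof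
        fix v assume "v \<in> L"
        then have v: "v = v $ 1 *s p + v $ 2 *s r" by (rule L_pr)
        have "v $ 3 = v $ 1 * a + v $ 2 * c" "v $ 4 = v $ 1 * b + v $ 2 * d"
          by (subst v, simp add: a_def b_def c_def d_def)+
        then show "v \<in> line1 a b l" unfolding line1_def lb la by (simp add: mult.commute)
      qed
      show "line1 a b l \<subseteq> L"
      proof
        fix v assume "v \<in> line1 a b l"
        then have "v = v $ 1 *s p + v $ 2 *s r"
          unfolding line1_def lb la vec_eq_iff forall_4
          by (simp add: p12 r12 a_def b_def c_def d_def mult.commute)
        then show "v \<in> L" using pL rL addL scL by metis
      qed
    qed
    ultimately show ?thesis using ab by blast
  next
    case True
    \<comment> \<open>The projection is singular; depending on which coordinates vanish, an explicit
      nontrivial combination in its kernel is available.\<close>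
    obtain s t where st: "(s *s x + t *s y) $ 1 = 0" "(s *s x + t *s y) $ 2 = 0" "s \<noteq> 0 \<or> t \<noteq> 0"
    proof (cases "x $ 1 = 0 \<and> y $ 1 = 0")
      case True
      show ?thesis
      proof (cases "x $ 2 = 0 \<and> y $ 2 = 0")
        case T2: True
        with True show ?thesis using that[of 1 0] by simp
      next
        case False
        with True show ?thesis using that[of "y $ 2" "x $ 2"] by (auto simp: mult.commute)
      qed
    next
      case False
      then show ?thesis using that[of "y $ 1" "x $ 1"] True D_def by (auto simp: mult.commute add.commute)
    qed
    define z where "z = s *s x + t *s y"
    have zL: "z \<in> L" unfolding z_def by (rule inL)
    have z12: "z $ 1 = 0" "z $ 2 = 0" using st unfolding z_def by blast+
    have z_ne: "z \<noteq> 0" using st(3) indep unfolding z_def by blast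
    have z34: "z $ 3 * cj (z $ 3) = z $ 4 * cj (z $ 4)"
      using hL[OF zL zL] add_eq_0 unfolding h_4 z12 by (simp add: mult.commute)
    have z3: "z $ 3 \<noteq> 0"
    proof
      assume "z $ 3 = 0"
      then have "z $ 4 = 0" using z34 by simp
      then show False using z_ne z12 \<open>z $ 3 = 0\<close> by (simp add: vec_eq_iff forall_4)
    qed
    define b where "b = z $ 4 / z $ 3"
    have b: "b \<in> \<mu>" unfolding b_def using z34 z3 norm_eq_imp_mu by metis
    define z' where "z' = (1 / z $ 3) *s z"
    have z'L: "z' \<in> L" unfolding z'_def by (rule scL[OF zL])
    have z': "z' $ 1 = 0" "z' $ 2 = 0" "z' $ 3 = 1" "z' $ 4 = b"
      unfolding z'_def b_def using z12 z3 by simp_all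
    have v4: "v $ 4 = b * v $ 3" if "v \<in> L" for v
    proof -
      have "v $ 3 + cj b * v $ 4 = 0" using hL[OF z'L that] unfolding h_4 z' by simp
      then show ?thesis using b mu_solve by blast
    qed
    have norm34: "v $ 3 * cj (v $ 3) + v $ 4 * cj (v $ 4) = 0" if "v \<in> L" for v
    proof -
      have "v $ 4 * cj (v $ 4) = (b * cj b) * (v $ 3 * cj (v $ 3))"
        unfolding v4[OF that] by (simp add: mult_ac)
      then show ?thesis using b by (simp add: \<mu>_def)
    qed
    have norm12: "v $ 1 * cj (v $ 1) = v $ 2 * cj (v $ 2)" if "v \<in> L" for v
    proof -
      have "v $ 1 * cj (v $ 1) + v $ 2 * cj (v $ 2) + (v $ 3 * cj (v $ 3) + v $ 4 * cj (v $ 4)) = 0"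
        using hL[OF that that] unfolding h_4 by (simp add: mult.commute add.assoc)
      then show ?thesis unfolding norm34[OF that] using add_eq_0 by simp
    qed
    \<comment> \<open>If coordinate 1 vanished on \<open>L\<close>, so would coordinate 2 by
      \<open>norm12\<close>, and every vector of \<open>L\<close> would be a multiple of
      \<open>z'\<close>, against independence of \<open>x\<close> and \<open>y\<close>.\<close>
    have "\<exists>v\<in>L. v $ 1 \<noteq> 0"
    proof (rule ccontr)
      assume no: "\<not> (\<exists>v\<in>L. v $ 1 \<noteq> 0)"
      have mult: "v = v $ 3 *s z'" if "v \<in> L" for v
      proof -
        have v1: "v $ 1 = 0" using no that by blast
        moreover have "v $ 2 = 0" using norm12[OF that] v1 by simp
        ultimately show ?thesis using v4[OF that]
          unfolding vec_eq_iff forall_4 by (simp add: z' mult.commute)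
      qed
      have "y $ 3 *s x + x $ 3 *s y = y $ 3 *s (x $ 3 *s z') + x $ 3 *s (y $ 3 *s z')"
        using mult[OF xL] mult[OF yL] by metis
      also have "\<dots> = 0" by (simp add: vec_eq_iff algebra_simps)
      finally have "x $ 3 = 0" using indep by blast
      then have "x = 0" using mult[OF xL] by (simp add: vec_eq_iff)
      then show False using indep[of 1 0] by simp
    qed
    then obtain v where v: "v \<in> L" "v $ 1 \<noteq> 0" by blast
    define a where "a = v $ 2 / v $ 1"
    have a: "a \<in> \<mu>" unfolding a_def using norm12[OF v(1)] v(2) norm_eq_imp_mu by metis
    \<comment> \<open>The multiple of \<open>z'\<close> clears coordinate 3, and with it coordinate
      4, since both vectors satisfy \<open>v4\<close>.\<close>
    define w where "w = (1 / v $ 1) *s v + (v $ 3 / v $ 1) *s z'"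
    have wL: "w \<in> L" unfolding w_def using v z'L by (intro addL scL)
    have w: "w $ 1 = 1" "w $ 2 = a" "w $ 3 = 0" "w $ 4 = 0"
      unfolding w_def a_def using v z' v4[OF v(1)] by (simp_all add: mult.commute)
    have v2: "u $ 2 = a * u $ 1" if "u \<in> L" for u
    proof -
      have "u $ 1 + cj a * u $ 2 = 0" using hL[OF wL that] unfolding h_4 w by simp
      then show ?thesis using a mu_solve by blast
    qed
    have "L = line2 a b"
    proof
      show "L \<subseteq> line2 a b" using v2 v4 by (auto simp: line2_def)
      show "line2 a b \<subseteq> L"
      proof
        fix u assume "u \<in> line2 a b"
        then have "u = u $ 1 *s w + u $ 3 *s z'"
          unfolding line2_def vec_eq_iff forall_4 by (simp add: w z' mult.commute)
        then show "u \<in> L" using wL z'L addL scL by metis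
      qed
    qed
    then show ?thesis using a b by blast
  qed
qed

lemma act_L0_I:
  assumes "\<And>v. v \<in> L \<Longrightarrow> \<exists>s t. v = A *v vector [s, t, s, t]"
    and "\<And>s t. A *v vector [s, t, s, t] \<in> L"
  shows "act A L0 = L"
proof
  show "act A L0 \<subseteq> L"
  proof
    fix w assume "w \<in> act A L0"
    then obtain v where v: "v \<in> L0" "w = A *v v" unfolding act_def by blast
    have "v = vector [v $ 1, v $ 2, v $ 1, v $ 2]"
      using v(1) unfolding L0_def vec_eq_iff[of v] forall_4 by (simp add: vector_4)
    then show "w \<in> L" using v(2) assms(2) by metis
  qed
  show "L \<subseteq> act A L0"
  proof
    fix v assume "v \<in> L"
    then obtain s t where v: "v = A *v vector [s, t, s, t]" using assms(1) by blast
    have "vector [s, t, s, t] \<in> L0" by (simp add: L0_def vector_4)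
    then show "v \<in> act A L0" unfolding v act_def by blast
  qed
qed

section \<open>Transitivity on the isotropic lines and their number\<close>

definition \<Omega> :: "('a^4) set set" where "\<Omega> = (\<lambda>A. act A L0) ` carrier (SU4 q)"

lemma act_GU_in_Omega: "A \<in> GU \<Longrightarrow> act A L0 \<in> \<Omega>"
  using act_to_SU[of A L0] to_SU_in[of A] L0_scale unfolding \<Omega>_def by (metis imageI)

text \<open>The identity on the first plane together with the unitary matrix of the graph on the
  second carries \<open>L0\<close>, the graph of the identity, to the required graph.\<close>

lemma line1_in_Omega:
  assumes ab: "a * cj a + b * cj b = 1" and l: "l \<in> \<mu>"
  shows "line1 a b l \<in> \<Omega>"
proof -
  define A :: "'a^4^4" where
    "A = vector [vector [1, 0, 0, 0], vector [0, 1, 0, 0], vector [0, 0, a, l * cj b], vector [0, 0, b, l * cj a]]"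
  have Av: "A *v v = vector [v $ 1, v $ 2, a * v $ 3 + l * cj b * v $ 4, b * v $ 3 + l * cj a * v $ 4]" for v
    unfolding vec_eq_iff forall_4 mat_vec_4 A_def vector_4 by simp
  have ll: "l * cj l = 1" using l by (simp add: \<mu>_def)
  have "ct A ** A = mat 1"
  proof -
    have "cj a * a + cj b * b = 1" using ab by (simp add: mult.commute)
    moreover have "cj l * b * (l * cj b) + cj l * a * (l * cj a) = (l * cj l) * (a * cj a + b * cj b)"
      by (simp add: algebra_simps)
    moreover have "cj a * (l * cj b) + cj b * (l * cj a) = 0"
      "cj l * b * a + cj l * a * b = 0" by (simp_all add: algebra_simps)
    ultimately show ?thesis
      unfolding vec_eq_iff forall_4 mat_mult_4 ct_nth
      by (simp add: A_def vector_4 mat_def ll ab)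
  qed
  then have "A \<in> GU" by (simp add: GU_def)
  moreover have "act A L0 = line1 a b l"
  proof (rule act_L0_I)
    show "A *v vector [s, t, s, t] \<in> line1 a b l" for s t
      by (simp add: Av line1_def vector_4)
    show "\<exists>s t. v = A *v vector [s, t, s, t]" if "v \<in> line1 a b l" for v
      using that by (intro exI[of _ "v $ 1"] exI[of _ "v $ 2"])
        (simp add: Av line1_def vec_eq_iff[of v] forall_4 vector_4)
  qed
  ultimately show ?thesis using act_GU_in_Omega by metis
qed

text \<open>Exchanging coordinates 2 and 3 turns (s, t, s, t) into (s, s, t, t), and a diagonal
  matrix then scales coordinates 2 and 4 by a and b.\<close>

lemma line2_in_Omega:
  assumes "a \<in> \<mu>" "b \<in> \<mu>"
  shows "line2 a b \<in> \<Omega>"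
proof -
  define A :: "'a^4^4" where "A = diag 1 a 1 b ** swap_mat 2 3"
  have "1 \<in> \<mu>" by (simp add: \<mu>_def)
  then have "A \<in> GU" unfolding A_def using assms by (intro GU_mult diag_GU swap_mat_GU)
  have Av: "A *v v = vector [v $ 1, a * v $ 3, v $ 2, b * v $ 4]" for v
    unfolding A_def matrix_vector_mul_assoc[symmetric] diag_vec swap_mat_vec
    by (simp add: Transposition.transpose_def)
  have "act A L0 = line2 a b"
  proof (rule act_L0_I)
    show "A *v vector [s, t, s, t] \<in> line2 a b" for s t
      by (simp add: Av line2_def vector_4)
    show "\<exists>s t. v = A *v vector [s, t, s, t]" if "v \<in> line2 a b" for v
      using that by (intro exI[of _ "v $ 1"] exI[of _ "v $ 3"])
        (simp add: Av line2_def vec_eq_iff[of v] forall_4 vector_4)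
  qed
  then show ?thesis using act_GU_in_Omega[OF \<open>A \<in> GU\<close>] by simp
qed

lemma Omega_isotropic: "L \<in> \<Omega> \<Longrightarrow> isotropic_line L"
  using isotropic_line_act by (auto simp: \<Omega>_def SU4_carrier)

text \<open>For fixed a the norm of b is prescribed as 1 + a cj a. This is 0 for the q + 1 elements
  of \<open>\<mu>\<close>, leaving one b, and a nonzero element of GF(q) otherwise, leaving q +
  1.\<close>

lemma card_norm_pairs: "card {(a, b). a * cj a + b * cj b = 1} = (q + 1) * (q\<^sup>2 - q)"
proof -
  have "{(a, b). a * cj a + b * cj b = 1} = (SIGMA a:UNIV. {b. b * cj b = 1 + a * cj a})"
  proof -
    have "a * cj a + b * cj b = 1 \<longleftrightarrow> b * cj b = 1 + a * cj a" for a b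
      by (metis add_self' add.commute)
    then show ?thesis by auto
  qed
  then have "card {(a, b). a * cj a + b * cj b = 1} = (\<Sum>a\<in>UNIV. card {b. b * cj b = 1 + a * cj a})"
    by (simp add: card_SigmaI)
  also have "\<dots> = (\<Sum>a\<in>UNIV. if a \<in> \<mu> then 1 else q + 1)"
  proof (rule sum.cong[OF refl])
    fix a :: 'a
    show "card {b. b * cj b = 1 + a * cj a} = (if a \<in> \<mu> then 1 else q + 1)"
    proof (cases "a \<in> \<mu>")
      case True
      then have "{b. b * cj b = 1 + a * cj a} = {0}" by (auto simp: \<mu>_def)
      then show ?thesis using True by simp
    next
      case False
      then have "1 + a * cj a \<noteq> 0" by (simp add: \<mu>_def add_eq_0)
      moreover have "cj (1 + a * cj a) = 1 + a * cj a" by (simp add: mult.commute)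
      ultimately show ?thesis using card_norm_fiber False by simp
    qed
  qed
  also have "\<dots> = card \<mu> + card (- \<mu>) * (q + 1)"
    by (simp add: sum.If_cases)
  also have "card (- \<mu>) = q\<^sup>2 - (q + 1)"
    by (simp add: Compl_eq_Diff_UNIV card_Diff_subset card_F card_mu)
  also have "card \<mu> + (q\<^sup>2 - (q + 1)) * (q + 1) = (q + 1) * (q\<^sup>2 - q)"
  proof -
    have "q + 1 \<le> q\<^sup>2" using q_ge mult_le_mono1[of 4 q q] unfolding power2_eq_square by linarith
    then obtain m where m: "q\<^sup>2 = q + 1 + m" using le_Suc_ex by blast
    then show ?thesis unfolding card_mu m by (simp add: algebra_simps)
  qed
  finally show ?thesis .
qed

text \<open>A graph determines its matrix, so there are (q + 1)^2 (q^2 - q) lines of the first kind;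
  the second kind adds (q + 1)^2.\<close>

lemma card_Omega: "card \<Omega> = (q + 1)\<^sup>2 * (q\<^sup>2 - q + 1)"
proof -
  let ?N = "{(a, b). a * cj a + b * cj b = 1}"
  let ?f1 = "\<lambda>((a, b), l). line1 a b l" and ?f2 = "\<lambda>(a, b). line2 a b"
  have "\<Omega> = ?f1 ` (?N \<times> \<mu>) \<union> ?f2 ` (\<mu> \<times> \<mu>)"
  proof
    show "\<Omega> \<subseteq> ?f1 ` (?N \<times> \<mu>) \<union> ?f2 ` (\<mu> \<times> \<mu>)"
      using isotropic_line_cases[OF Omega_isotropic] by force
    show "?f1 ` (?N \<times> \<mu>) \<union> ?f2 ` (\<mu> \<times> \<mu>) \<subseteq> \<Omega>"
      using line1_in_Omega line2_in_Omega by auto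
  qed
  moreover have "inj_on ?f1 (?N \<times> \<mu>)"
  proof (rule inj_onI)
    fix x y assume x: "x \<in> ?N \<times> \<mu>" and eq': "?f1 x = ?f1 y"
    obtain a b l a' b' l' where xy: "x = ((a, b), l)" "y = ((a', b'), l')"
      by (metis surj_pair)
    have ab: "a * cj a + b * cj b = 1" and eq: "line1 a b l = line1 a' b' l'"
      using x eq' xy by auto
    have "vector [1, 0, a, b] \<in> line1 a b l" "vector [0, 1, l * cj b, l * cj a] \<in> line1 a b l"
      by (simp_all add: line1_def vector_4)
    then have "a = a'" "b = b'" "l * cj b = l' * cj b'" "l * cj a = l' * cj a'"
      unfolding eq by (simp_all add: line1_def vector_4)
    moreover have "a \<noteq> 0 \<or> b \<noteq> 0" using ab by auto
    ultimately show "x = y" using xy by auto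
  qed
  moreover have "inj_on ?f2 (\<mu> \<times> \<mu>)"
  proof (rule inj_onI, clarify)
    fix a b a' b' assume eq: "line2 a b = line2 a' b'"
    have "vector [1, a, 1, b] \<in> line2 a b" by (simp add: line2_def vector_4)
    then show "a = a' \<and> b = b'" unfolding eq by (simp add: line2_def vector_4)
  qed
  moreover have "?f1 ` (?N \<times> \<mu>) \<inter> ?f2 ` (\<mu> \<times> \<mu>) = {}"
  proof -
    have "line1 a b l \<noteq> line2 c d" for a b l c d
    proof -
      have "vector [0, 1, l * cj b, l * cj a] \<in> line1 a b l" by (simp add: line1_def vector_4)
      moreover have "vector [0, 1, l * cj b, l * cj a] \<notin> line2 c d" by (simp add: line2_def vector_4)
      ultimately show ?thesis by metis
    qed
    then show ?thesis by auto
  qed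
  ultimately have "card \<Omega> = card ?N * card \<mu> + card \<mu> * card \<mu>"
    by (simp add: card_Un_disjoint card_image card_cartesian_product)
  also have "\<dots> = (q + 1)\<^sup>2 * (q\<^sup>2 - q + 1)"
    unfolding card_norm_pairs card_mu power2_eq_square[of "q + 1"]
    by (metis add_mult_distrib2 mult.assoc mult.commute mult.right_neutral)
  finally show ?thesis .
qed

section \<open>The stabiliser of a line\<close>

definition line_stab :: "('a^4^4) set" where
  "line_stab = {A \<in> carrier (SU4 q). act A L0 = L0}"

definition flag_stab :: "('a^4^4) set" where
  "flag_stab = {A \<in> line_stab. \<exists>c. A *v e0 = c *s e0}"

lemma mat_vec_scale: "A *v (c *s x) = c *s (A *v x)" for A :: "'a^4^4"
  by (simp add: vec_eq_iff mat_vec_4 algebra_simps)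

lemma e0_in: "e0 \<in> L0" and f0_in: "f0 \<in> L0"
  by (simp_all add: L0_def e0_def f0_def vector_4)

lemma act_subset_imp_eq:
  assumes "A \<in> GU" "\<And>x. x \<in> L0 \<Longrightarrow> A *v x \<in> L0"
  shows "act A L0 = L0"
proof -
  have "inj_on (\<lambda>x. A *v x) L0"
  proof (rule inj_onI)
    fix x y assume "A *v x = A *v y"
    then have "ct A *v (A *v x) = ct A *v (A *v y)" by simp
    then show "x = y" by (simp add: matrix_vector_mul_assoc GU_D[OF assms(1)])
  qed
  then show ?thesis unfolding act_def using assms(2) by (intro endo_inj_surj) auto
qed

lemma line_stab_subgroup: "subgroup line_stab (SU4 q)"
proof (rule SU.subgroup_if_mult_closed[OF SU_finite])
  show "A \<otimes>\<^bsub>SU4 q\<^esub> B \<in> line_stab" if "A \<in> line_stab" "B \<in> line_stab" for A B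
  proof -
    have "A \<otimes>\<^bsub>SU4 q\<^esub> B \<in> carrier (SU4 q)" using that unfolding line_stab_def by blast
    then show ?thesis using that by (simp add: line_stab_def act_mult)
  qed
  show "\<one>\<^bsub>SU4 q\<^esub> \<in> line_stab" using SU.one_closed by (simp add: line_stab_def act_one)
qed (auto simp: line_stab_def)

lemma line_stab_vec: "A \<in> line_stab \<Longrightarrow> x \<in> L0 \<Longrightarrow> A *v x \<in> L0"
  unfolding line_stab_def act_def by blast

lemma flag_stab_subgroup: "subgroup flag_stab (SU4 q)"
proof (rule SU.subgroup_if_mult_closed[OF SU_finite])
  show "flag_stab \<subseteq> carrier (SU4 q)" by (auto simp: flag_stab_def line_stab_def)
  have "\<exists>c. mat 1 *v e0 = c *s e0" by (rule exI[of _ 1]) simp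
  then show "\<one>\<^bsub>SU4 q\<^esub> \<in> flag_stab"
    using subgroup.one_closed[OF line_stab_subgroup] unfolding flag_stab_def by simp
  show "A \<otimes>\<^bsub>SU4 q\<^esub> B \<in> flag_stab" if AB: "A \<in> flag_stab" "B \<in> flag_stab" for A B
  proof -
    obtain c d where "A *v e0 = c *s e0" "B *v e0 = d *s e0" using AB unfolding flag_stab_def by blast
    then have "(A ** B) *v e0 = (d * c) *s e0"
      by (simp add: matrix_vector_mul_assoc[symmetric] mat_vec_scale vector_smult_assoc)
    then show ?thesis
      using AB subgroup.m_closed[OF line_stab_subgroup, of A B] unfolding flag_stab_def by auto
  qed
qed

section \<open>Structure of the flag stabiliser\<close>

definition field_units :: "'a monoid" where
  "field_units = \<lparr>carrier = {x. x \<noteq> 0}, mult = (*), one = 1\<rparr>"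

lemma field_units_group: "comm_group field_units"
proof (rule comm_groupI)
  fix x assume "x \<in> carrier field_units"
  then show "\<exists>y\<in>carrier field_units. y \<otimes>\<^bsub>field_units\<^esub> x = \<one>\<^bsub>field_units\<^esub>"
    by (intro bexI[of _ "1 / x"]) (auto simp: field_units_def)
qed (auto simp: field_units_def mult_ac)

text \<open>\<open>A - 1\<close> is nilpotent: it moves each member of the flag formed by \<open>e0\<close>, \<open>L0\<close> and the
  perpendicular of \<open>e0\<close> into the previous one.\<close>

lemma flag_unipotent:
  assumes A: "A \<in> GU" and e: "A *v e0 = e0" and f: "A *v f0 = c *s e0 + f0"
  shows "A ** A ** A ** A = mat 1"
proof -
  define N where "N v = A *v v + v" for v
  have addA: "A *v (x + y) = A *v x + A *v y" for x y
    by (simp add: matrix_vector_right_distrib)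
  have add0: "v + v = 0" "v + (v + w) = w" for v w :: "'a^4" by (simp_all add: vec_eq_iff)
  have Av: "A *v v = v + N v" for v by (simp add: N_def vec_eq_iff add_ac)
  have N_add: "N (x + y) = N x + N y" for x y unfolding N_def addA by (simp add: add_ac)
  have N_scale: "N (d *s x) = d *s N x" for d x
    unfolding N_def mat_vec_scale by (simp add: vector_add_ldistrib)
  have Ne: "N e0 = 0" unfolding N_def e by (rule add0)
  have Nf: "N f0 = c *s e0" unfolding N_def f by (simp add: vec_eq_iff add_ac)
  have 1: "h e0 (N v) = 0" for v
  proof -
    have "h e0 (A *v v) = h e0 v" using GU_h[OF A, of e0 v] e by simp
    then show ?thesis unfolding N_def h_add by simp
  qed
  \<comment> \<open>\<open>N v\<close> turns out perpendicular to both \<open>e0\<close> and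
    \<open>f0\<close>, and \<open>L0\<close> is its own perpendicular space.\<close>
  have 2: "N v \<in> L0" if v: "h e0 v = 0" for v
  proof -
    have "h (A *v f0) (A *v v) = h f0 v" by (rule GU_h[OF A])
    moreover have "h e0 (A *v v) = 0" using GU_h[OF A, of e0 v] e v by simp
    ultimately have "h f0 (A *v v) = h f0 v" unfolding f h_add h_scale by simp
    then have "h f0 (N v) = 0" unfolding N_def h_add by simp
    with 1[of v] show ?thesis
      by (simp add: L0_def h_4 e0_def f0_def vector_4 add_eq_0)
  qed
  have 3: "N v = (v $ 2 * c) *s e0" if "v \<in> L0" for v
  proof -
    have "N v = N (v $ 1 *s e0 + v $ 2 *s f0)" using that L0_eq by metis
    then show ?thesis by (simp add: N_add N_scale Ne Nf vector_smult_assoc)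
  qed
  have N4: "N (N (N (N v))) = 0" for v
  proof -
    have "N (N (N v)) = ((N (N v)) $ 2 * c) *s e0" using 1 2 3 by blast
    then show ?thesis using N_scale Ne by (metis vector_smult_rzero)
  qed
  \<comment> \<open>In characteristic 2 the square of 1 + N is 1 + N^2, so the fourth power of A is
    1 + N^4 = 1.\<close>
  have A2: "A *v (A *v v) = v + N (N v)" for v
    unfolding Av[of "A *v v"] by (simp add: Av N_add add0 add.assoc)
  have "(A ** A ** A ** A) *v v = mat 1 *v v" for v
  proof -
    have "(A ** A ** A ** A) *v v = A *v (A *v (A *v (A *v v)))"
      by (simp only: matrix_vector_mul_assoc matrix_mul_assoc)
    also have "\<dots> = v" unfolding A2 by (simp add: N_add N4 add0 add.assoc)
    finally show ?thesis by simp
  qed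
  then show ?thesis using matrix_eq by blast
qed

text \<open>The scalars by which a matrix acts on the span of \<open>e0\<close> and on the quotient
  of \<open>L0\<close> by it give a homomorphism to an abelian group. Its kernel consists of
  matrices with A^4 = 1 by \<open>flag_unipotent\<close>, which is why the exponent is 2 to the
  power 2.\<close>

lemma prime_fact_flag_stab: "prime_fact (SU4 q) flag_stab"
proof -
  let ?U = "(SU4 q)\<lparr>carrier := flag_stab\<rparr>"
  let ?H = "field_units \<times>\<times> field_units"
  define \<alpha> where "\<alpha> A = (A *v e0) $ 1" for A :: "'a^4^4"
  define \<beta> where "\<beta> A = (A *v f0) $ 2" for A :: "'a^4^4"
  interpret U: group ?U by (rule SU.subgroup_imp_group[OF flag_stab_subgroup])
  have e0c: "e0 $ 1 = 1" "e0 $ 2 = 0" "f0 $ 1 = 0" "f0 $ 2 = 1"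
    by (simp_all add: e0_def f0_def vector_4)
  have Ae: "A *v e0 = \<alpha> A *s e0" if A: "A \<in> flag_stab" for A
  proof -
    obtain c where c: "A *v e0 = c *s e0" using A unfolding flag_stab_def by blast
    then have "\<alpha> A = c" unfolding \<alpha>_def by (simp add: e0c)
    then show ?thesis using c by simp
  qed
  have Af: "A *v f0 = (A *v f0) $ 1 *s e0 + \<beta> A *s f0" if A: "A \<in> flag_stab" for A
    using L0_eq line_stab_vec[OF _ f0_in] A unfolding flag_stab_def \<beta>_def by blast
  have mult: "\<alpha> (A ** B) = \<alpha> A * \<alpha> B" "\<beta> (A ** B) = \<beta> A * \<beta> B"
    if AB: "A \<in> flag_stab" "B \<in> flag_stab" for A B
  proof -
    have "(A ** B) *v e0 = A *v (\<alpha> B *s e0)" using Ae[OF AB(2)] by (simp add: matrix_vector_mul_assoc[symmetric])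
    also have "\<dots> = (\<alpha> B * \<alpha> A) *s e0" by (simp add: mat_vec_scale Ae[OF AB(1)] vector_smult_assoc)
    finally show "\<alpha> (A ** B) = \<alpha> A * \<alpha> B" unfolding \<alpha>_def[of "A ** B"] by (simp add: e0c)
    define d where "d = (B *v f0) $ 1"
    have "(A ** B) *v f0 = A *v (d *s e0 + \<beta> B *s f0)"
      unfolding d_def Af[OF AB(2), symmetric] by (simp add: matrix_vector_mul_assoc)
    also have "\<dots> = (d * \<alpha> A) *s e0 + \<beta> B *s (A *v f0)"
      by (simp add: matrix_vector_right_distrib mat_vec_scale Ae[OF AB(1)] vector_smult_assoc)
    finally show "\<beta> (A ** B) = \<beta> A * \<beta> B"
      unfolding \<beta>_def[of "A ** B"] by (simp add: e0c \<beta>_def)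
  qed
  have one: "\<alpha> (mat 1) = 1" "\<beta> (mat 1) = 1" by (simp_all add: \<alpha>_def \<beta>_def e0c)
  have nz: "\<alpha> A \<noteq> 0" "\<beta> A \<noteq> 0" if A: "A \<in> flag_stab" for A
  proof -
    have B: "inv\<^bsub>SU4 q\<^esub> A \<in> flag_stab" "A ** inv\<^bsub>SU4 q\<^esub> A = mat 1"
      using A subgroup.m_inv_closed[OF flag_stab_subgroup A] SU.r_inv[of A]
        subgroup.mem_carrier[OF flag_stab_subgroup] by auto
    show "\<alpha> A \<noteq> 0" "\<beta> A \<noteq> 0" using mult[OF A B(1)] one unfolding B(2) by auto
  qed
  have hom: "(\<lambda>A. (\<alpha> A, \<beta> A)) \<in> hom ?U ?H"
    by (rule homI) (use mult nz in \<open>auto simp: field_units_def\<close>)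
  have H: "comm_group ?H"
  proof (rule group.group_comm_groupI)
    show "group ?H" using field_units_group by (intro DirProd_group) (auto simp: comm_group_def)
  qed (auto simp: field_units_def mult.commute)
  have "prime_fact ?U (carrier ?U)"
  proof (rule U.prime_fact_p_by_abelian[OF _ H _ hom two_is_prime_nat, of 2])
    fix A assume A: "A \<in> carrier ?U" and "(\<alpha> A, \<beta> A) = \<one>\<^bsub>?H\<^esub>"
    then have ab: "\<alpha> A = 1" "\<beta> A = 1" and AU: "A \<in> flag_stab" by (auto simp: field_units_def)
    have "A \<in> GU" using AU by (auto simp: flag_stab_def line_stab_def SU4_carrier)
    moreover have "A *v e0 = e0" using Ae[OF AU] ab by simp
    moreover have "A *v f0 = (A *v f0) $ 1 *s e0 + f0" using Af[OF AU] ab by simp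
    ultimately have "A ** A ** A ** A = mat 1" by (rule flag_unipotent)
    then have "A [^]\<^bsub>SU4 q\<^esub> (4::nat) = \<one>\<^bsub>SU4 q\<^esub>" by (simp add: eval_nat_numeral SU.nat_pow_Suc)
    then show "A [^]\<^bsub>?U\<^esub> (2 ^ 2 :: nat) = \<one>\<^bsub>?U\<^esub>"
      by (simp add: SU.nat_pow_consistent[symmetric])
  qed auto
  then show ?thesis
    using prime_fact_mono[OF _ subgroup.subset[OF flag_stab_subgroup]] by simp
qed

section \<open>A torus acting regularly on the points of the line\<close>

text \<open>Conjugating by \<open>hypb k\<close> turns the standard form into the hyperbolic form that pairs the
  first two coordinates with the last two; there \<open>g\<close> acts together with its inverse adjoint.\<close>

definition hypb :: "'a \<Rightarrow> 'a^4^4" where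
  "hypb k = vector [vector [cj k, 0, k, 0], vector [0, cj k, 0, k], vector [1, 0, 1, 0], vector [0, 1, 0, 1]]"

text \<open>The columns are \<open>e0\<close>, \<open>f0\<close> and two vectors, mutually
  perpendicular and isotropic, that pair with them to the trace of k. For trace 1 this is a
  hyperbolic basis with Gram matrix \<open>hypJ\<close>.\<close>

definition hypb_inv :: "'a \<Rightarrow> 'a^4^4" where
  "hypb_inv k = vector [vector [1, 0, k, 0], vector [0, 1, 0, k], vector [1, 0, cj k, 0], vector [0, 1, 0, cj k]]"

definition hypJ :: "'a^4^4" where
  "hypJ = vector [vector [0, 0, 1, 0], vector [0, 0, 0, 1], vector [1, 0, 0, 0], vector [0, 1, 0, 0]]"

text \<open>The upper block is multiplication by a + b w in the basis 1, w of the quadratic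
  extension with w^2 = w + m. Its determinant is the norm a^2 + a b + m b^2, and if that is 1 the
  lower block is its inverse adjoint.\<close>

definition levi :: "'a \<Rightarrow> 'a \<Rightarrow> 'a \<Rightarrow> 'a^4^4" where
  "levi m a b = vector [vector [a, b * m, 0, 0], vector [b, a + b, 0, 0],
     vector [0, 0, cj (a + b), cj b], vector [0, 0, cj (b * m), cj a]]"

lemma hypb_inverse:
  assumes "k + cj k = 1"
  shows "hypb k ** hypb_inv k = mat 1" "hypb_inv k ** hypb k = mat 1"
proof -
  have "cj k + k = 1" using assms by (simp add: add.commute)
  then show *: "hypb k ** hypb_inv k = mat 1"
    unfolding vec_eq_iff forall_4 mat_mult_4 using assms
    by (simp add: hypb_def hypb_inv_def vector_4 mat_def mult.commute)
  then show "hypb_inv k ** hypb k = mat 1" by (rule matrix_left_right_inverse1)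
qed

lemma hypb_form:
  assumes "k + cj k = 1"
  shows "ct (hypb_inv k) ** hypb_inv k = hypJ"
proof -
  have "cj k + k = 1" using assms by (simp add: add.commute)
  then show ?thesis
    unfolding vec_eq_iff forall_4 mat_mult_4 ct_nth using assms
    by (simp add: hypJ_def hypb_inv_def vector_4 mult.commute)
qed

lemma levi_mult: "levi m a b ** levi m a' b' = levi m (a * a' + m * b * b') (a * b' + b * a' + b * b')"
  unfolding vec_eq_iff forall_4 mat_mult_4
  by (simp add: levi_def vector_4 algebra_simps)

lemma levi_form:
  assumes "a\<^sup>2 + a * b + m * b\<^sup>2 = 1"
  shows "ct (levi m a b) ** hypJ ** levi m a b = hypJ"
proof -
  have 1: "a * (a + b) + b * (b * m) = 1"
    using assms by (simp add: power2_eq_square algebra_simps)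
  have "cj (a * (a + b) + b * (b * m)) = 1" using 1 by simp
  then have 2: "cj a * (cj a + cj b) + cj b * (cj b * cj m) = 1" by simp
  show ?thesis
    unfolding vec_eq_iff forall_4 mat_mult_4 ct_nth using 1 2
    by (simp add: hypJ_def levi_def vector_4 algebra_simps)
qed

text \<open>\<open>X\<close> is the norm-one group of the quadratic extension with w^2 = w + m,
  acting on \<open>L0\<close> as on that extension, with \<open>e0\<close> in the role of 1. An
  element keeping \<open>e0\<close> up to a scalar lies in the base field, where norm 1 means a^2 =
  1 and so a = 1. Conversely any nonzero element is a base field scalar times one of norm 1, so
  \<open>X\<close> reaches every point of the line.\<close>

lemma prime_fact_line_stab: "prime_fact (SU4 q) line_stab"
proof -
  obtain k where k: "k + cj k = 1" by (rule trace_one)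
  obtain m :: 'a where m: "\<forall>x. x\<^sup>2 + x + m \<noteq> 0" using anisotropic_quadratic by blast
  define T where "T = hypb k"
  define Ti where "Ti = hypb_inv k"
  define B where "B a b = Ti ** levi m a b ** T" for a b
  define X where "X = {B a b | a b. a\<^sup>2 + a * b + m * b\<^sup>2 = 1}"
  have TTi: "T ** Ti = mat 1" "Ti ** T = mat 1" unfolding T_def Ti_def by (rule hypb_inverse[OF k])+
  have B_mult: "B a b ** B a' b' = B (a * a' + m * b * b') (a * b' + b * a' + b * b')" for a b a' b'
  proof -
    have "B a b ** B a' b' = Ti ** levi m a b ** (T ** Ti) ** levi m a' b' ** T"
      unfolding B_def by (simp add: matrix_mul_assoc)
    then show ?thesis unfolding B_def TTi levi_mult[symmetric] by (simp add: matrix_mul_assoc)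
  qed
  have "levi m 1 0 = mat 1"
    unfolding vec_eq_iff forall_4 by (simp add: levi_def vector_4 mat_def)
  then have B_one: "B 1 0 = mat 1" unfolding B_def by (simp add: TTi)
  have B_GU: "B a b \<in> GU" if "a\<^sup>2 + a * b + m * b\<^sup>2 = 1" for a b
  proof -
    have J: "ct Ti ** Ti = hypJ" unfolding Ti_def by (rule hypb_form[OF k])
    have "ct (B a b) ** B a b = ct T ** (ct (levi m a b) ** (ct Ti ** Ti) ** levi m a b) ** T"
      unfolding B_def by (simp add: ct_mult matrix_mul_assoc)
    also have "\<dots> = ct T ** (ct Ti ** Ti) ** T" unfolding J levi_form[OF that] ..
    also have "\<dots> = ct (Ti ** T) ** (Ti ** T)" by (simp add: ct_mult matrix_mul_assoc)
    finally show ?thesis unfolding TTi GU_def by simp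
  qed
  have X_GU: "X \<subseteq> GU" unfolding X_def using B_GU by blast
  have X_one: "mat 1 \<in> X" unfolding X_def using B_one[symmetric] by force
  have X_mult: "A ** C \<in> X" and X_comm: "A ** C = C ** A" if AC: "A \<in> X" "C \<in> X" for A C
  proof -
    obtain a b a' b' where A: "A = B a b" "a\<^sup>2 + a * b + m * b\<^sup>2 = 1"
      and C: "C = B a' b'" "a'\<^sup>2 + a' * b' + m * b'\<^sup>2 = 1" using AC unfolding X_def by blast
    show "A ** C = C ** A" unfolding A C B_mult by (simp add: algebra_simps)
    define u v where "u = a * a' + m * b * b'" and "v = a * b' + b * a' + b * b'"
    have "u\<^sup>2 + u * v + m * v\<^sup>2 = (a\<^sup>2 + a * b + m * b\<^sup>2) * (a'\<^sup>2 + a' * b' + m * b'\<^sup>2)"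
      unfolding u_def v_def by (simp add: power2_eq_square algebra_simps)
    then have "u\<^sup>2 + u * v + m * v\<^sup>2 = 1" unfolding A C by simp
    then show "A ** C \<in> X" unfolding A C B_mult X_def u_def v_def by blast
  qed
  have B_vec: "B a b *v vector [s, t, s, t] = (let x = a * s + b * m * t; y = b * s + (a + b) * t in vector [x, y, x, y])"
    for a b s t
  proof -
    have "cj k + k = 1" using k by (simp add: add.commute)
    moreover have "cj k * s + k * s = (cj k + k) * s" for s by (simp add: algebra_simps)
    ultimately have "cj k * s + k * s = s" for s by simp
    then have "T *v vector [s, t, s, t] = vector [s, t, 0, 0]"
      unfolding vec_eq_iff forall_4 mat_vec_4 by (simp add: T_def hypb_def vector_4)
    then have "B a b *v vector [s, t, s, t] = Ti *v (levi m a b *v vector [s, t, 0, 0])"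
      unfolding B_def by (simp add: matrix_vector_mul_assoc[symmetric])
    also have "levi m a b *v vector [s, t, 0, 0] = vector [a * s + b * m * t, b * s + (a + b) * t, 0, 0]"
      unfolding vec_eq_iff forall_4 mat_vec_4 by (simp add: levi_def vector_4)
    finally show ?thesis
      unfolding Let_def vec_eq_iff forall_4 mat_vec_4 by (simp add: Ti_def hypb_inv_def vector_4)
  qed
  have B_e0: "B a b *v e0 = vector [a, b, a, b]" for a b
    using B_vec[of a b 1 0] by (simp add: e0_def Let_def)
  have L0_vec: "x \<in> L0 \<Longrightarrow> x = vector [x $ 1, x $ 2, x $ 1, x $ 2]" for x
    unfolding vec_eq_iff[of x] forall_4 by (simp add: L0_def vector_4)
  have vec_L0: "vector [s, t, s, t] \<in> L0" for s t by (simp add: L0_def vector_4)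
  have B_stab: "act (B a b) L0 = L0" if "B a b \<in> GU" for a b
  proof (rule act_subset_imp_eq[OF that])
    fix x assume "x \<in> L0"
    then have "B a b *v x = B a b *v vector [x $ 1, x $ 2, x $ 1, x $ 2]" using L0_vec by metis
    then show "B a b *v x \<in> L0" unfolding B_vec Let_def using vec_L0 by simp
  qed
  have scal: "\<exists>c. c \<noteq> 0 \<and> to_SU A = smat c A" if "A \<in> GU" for A
    using to_SU_factor(2)[OF that] unfolding to_SU_def by (metis mult_zero_left power_eq_0_iff zero_neq_one zero_less_numeral)
  show ?thesis
  proof (rule SU.prime_fact_complement[OF subgroup_to_SU flag_stab_subgroup line_stab_subgroup])
    show "X \<subseteq> GU" "mat 1 \<in> X" by (fact X_GU, fact X_one)
    show "A ** C \<in> X" if "A \<in> X" "C \<in> X" for A C using that by (rule X_mult)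
    show "to_SU ` X \<subseteq> line_stab"
    proof clarify
      fix A assume "A \<in> X"
      then obtain a b where A: "A = B a b" "A \<in> GU" using X_GU unfolding X_def by blast
      then show "to_SU A \<in> line_stab"
        unfolding line_stab_def using to_SU_in act_to_SU[OF A(2) L0_scale] B_stab by auto
    qed
    show "flag_stab \<subseteq> line_stab" by (auto simp: flag_stab_def)
    show "prime_fact (SU4 q) (to_SU ` X)" by (rule prime_fact_to_SU[OF X_GU X_one X_mult X_comm])
    show "prime_fact (SU4 q) flag_stab" by (rule prime_fact_flag_stab)
    show "to_SU ` X \<inter> flag_stab \<subseteq> {\<one>\<^bsub>SU4 q\<^esub>}"
    proof clarify
      fix A assume AX: "A \<in> X" and "to_SU A \<in> flag_stab"
      then obtain d where d: "to_SU A *v e0 = d *s e0" unfolding flag_stab_def by blast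
      obtain a b where A: "A = B a b" "a\<^sup>2 + a * b + m * b\<^sup>2 = 1" using AX unfolding X_def by blast
      obtain c where c: "c \<noteq> 0" "to_SU A = smat c A" using scal AX X_GU by blast
      have "(c *s vector [a, b, a, b] :: 'a^4) $ 2 = (d *s e0) $ 2"
        using d unfolding c smat_vec unfolding A(1) B_e0 by simp
      then have "b = 0" using c by (simp add: vector_4 e0_def)
      then have "a * a = 1" using A(2) by (simp add: power2_eq_square)
      then have "a = 1" by (simp add: square_eq_1)
      then show "to_SU A = \<one>\<^bsub>SU4 q\<^esub>" using A \<open>b = 0\<close> B_one to_SU_one by simp
    qed
    fix K assume K: "K \<in> line_stab"
    have KG: "K \<in> carrier (SU4 q)" "K \<in> GU" using K by (auto simp: line_stab_def SU4_carrier)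
    define p r where "p = (K *v e0) $ 1" and "r = (K *v e0) $ 2"
    have Ke: "K *v e0 = vector [p, r, p, r]"
      unfolding p_def r_def by (rule L0_vec[OF line_stab_vec[OF K e0_in]])
    have pr: "p \<noteq> 0 \<or> r \<noteq> 0"
    proof (rule ccontr)
      assume "\<not> (p \<noteq> 0 \<or> r \<noteq> 0)"
      then have "K *v e0 = 0" unfolding Ke by (simp add: vec_eq_iff forall_4 vector_4)
      then have "ct K *v (K *v e0) = 0" by simp
      then have "e0 = 0" by (simp add: matrix_vector_mul_assoc GU_D[OF KG(2)])
      then have "e0 $ 1 = 0" by simp
      then show False by (simp add: e0_def vector_4)
    qed
    \<comment> \<open>The norm of p + r w, which represents \<open>K *v e0\<close>; it is nonzero by
      the choice of \<open>m\<close>.\<close>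
    define D where "D = p\<^sup>2 + p * r + m * r\<^sup>2"
    have "D \<noteq> 0"
    proof (cases "r = 0")
      case True
      then show ?thesis using pr by (simp add: D_def)
    next
      case False
      have "D = r\<^sup>2 * ((p / r)\<^sup>2 + p / r + m)"
        using False by (simp add: D_def power2_eq_square field_simps)
      then show ?thesis using m False by simp
    qed
    \<comment> \<open>Division by the square root of the norm gives an element of norm 1 spanning
      the same point.\<close>
    obtain t where t: "t\<^sup>2 = D" by (rule square_surj)
    then have t0: "t \<noteq> 0" using \<open>D \<noteq> 0\<close> by auto
    let ?A = "B (p / t) (r / t)"
    have "(p / t)\<^sup>2 + (p / t) * (r / t) + m * (r / t)\<^sup>2 = D / t\<^sup>2"
      by (simp add: D_def power2_eq_square add_divide_distrib)
    then have det1: "(p / t)\<^sup>2 + (p / t) * (r / t) + m * (r / t)\<^sup>2 = 1"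
      using t \<open>D \<noteq> 0\<close> by simp
    then have AX: "?A \<in> X" unfolding X_def by blast
    then have AG: "?A \<in> GU" using X_GU by blast
    obtain c where c: "c \<noteq> 0" "to_SU ?A = smat c ?A" using scal[OF AG] by blast
    define s where "s = to_SU ?A"
    have s: "s \<in> line_stab"
      unfolding line_stab_def s_def using to_SU_in[OF AG] act_to_SU[OF AG L0_scale] B_stab[OF AG] by auto
    then have sG: "s \<in> carrier (SU4 q)" "s \<in> GU" by (auto simp: line_stab_def SU4_carrier)
    have "s *v e0 = (c / t) *s (K *v e0)"
      unfolding s_def c smat_vec B_e0 Ke by (simp add: vec_eq_iff forall_4 vector_4)
    then have "K *v e0 = (t / c) *s (s *v e0)"
      using c t0 by (simp add: vec_eq_iff)
    then have "(ct s ** K) *v e0 = (t / c) *s ((ct s ** s) *v e0)"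
      by (simp add: matrix_vector_mul_assoc[symmetric] mat_vec_scale)
    then have e: "(ct s ** K) *v e0 = (t / c) *s e0" unfolding GU_D[OF sG(2)] by simp
    have "inv\<^bsub>SU4 q\<^esub> s \<otimes>\<^bsub>SU4 q\<^esub> K \<in> line_stab"
      using s K line_stab_subgroup by (simp add: subgroup.m_closed subgroup.m_inv_closed del: SU4_mult)
    then have "inv\<^bsub>SU4 q\<^esub> s \<otimes>\<^bsub>SU4 q\<^esub> K \<in> flag_stab"
      unfolding flag_stab_def using e SU_inv[OF sG(1)] by auto
    then show "\<exists>s\<in>to_SU ` X. inv\<^bsub>SU4 q\<^esub> s \<otimes>\<^bsub>SU4 q\<^esub> K \<in> flag_stab"
      using AX unfolding s_def by blast
  qed
qed

section \<open>Tori acting freely on the isotropic lines\<close>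

text \<open>Multiplication of a + b X + c X^2 modulo X^3 + X^2 + 1, using X^4 = X^2 + X + 1.\<close>

definition cmul :: "'a \<times> 'a \<times> 'a \<Rightarrow> 'a \<times> 'a \<times> 'a \<Rightarrow> 'a \<times> 'a \<times> 'a" where
  "cmul = (\<lambda>(a, b, c) (a', b', c'). (a * a' + b * c' + c * b' + c * c', a * b' + b * a' + c * c',
     a * c' + b * b' + c * a' + b * c' + c * b' + c * c'))"

text \<open>Conjugation of the coefficients with X fixed. When the cubic is irreducible this is the
  involution of GF(q^6) with fixed field GF(q^3).\<close>

definition ccj :: "'a \<times> 'a \<times> 'a \<Rightarrow> 'a \<times> 'a \<times> 'a" where
  "ccj = (\<lambda>(a, b, c). (cj a, cj b, cj c))"

definition cunit :: "'a \<times> 'a \<times> 'a" where "cunit = (1, 0, 0)"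

lemma cmul_commute: "cmul x y = cmul y x"
  by (cases x; cases y) (simp add: cmul_def algebra_simps)

lemma cmul_assoc: "cmul (cmul x y) z = cmul x (cmul y z)"
  by (cases x; cases y; cases z) (simp add: cmul_def algebra_simps)

lemma cmul_left_commute: "cmul x (cmul y z) = cmul y (cmul x z)"
  by (metis cmul_assoc cmul_commute)

lemmas cmul_ac = cmul_assoc cmul_commute cmul_left_commute

lemma cmul_one [simp]: "cmul cunit x = x" "cmul x cunit = x"
  by (cases x; simp add: cmul_def cunit_def)+

lemma cmul_zero [simp]: "cmul 0 x = 0" "cmul x 0 = 0"
  by (cases x; simp add: cmul_def zero_prod_def)+

lemma cmul_add: "cmul x (y + z) = cmul x y + cmul x z"
  by (cases x; cases y; cases z) (simp add: cmul_def algebra_simps)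

lemma ccj_cmul: "ccj (cmul x y) = cmul (ccj x) (ccj y)"
  by (cases x; cases y) (simp add: cmul_def ccj_def)

lemma ccj_ccj [simp]: "ccj (ccj x) = x" and ccj_one [simp]: "ccj cunit = cunit"
  by (cases x; simp add: ccj_def cunit_def)+

lemma cmul_square: "cmul (a, b, c) (a, b, c) = (a\<^sup>2 + c\<^sup>2, c\<^sup>2, b\<^sup>2 + c\<^sup>2)"
  by (simp add: cmul_def power2_eq_square algebra_simps)

lemma cmul_square_inj:
  assumes "cmul x x = cmul y y"
  shows "x = y"
proof -
  obtain a b c a' b' c' where xy: "x = (a, b, c)" "y = (a', b', c')" by (metis surj_pair)
  have "a\<^sup>2 + c\<^sup>2 = a'\<^sup>2 + c'\<^sup>2" "c\<^sup>2 = c'\<^sup>2" "b\<^sup>2 + c\<^sup>2 = b'\<^sup>2 + c'\<^sup>2"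
    using assms unfolding xy cmul_square prod.inject by blast+
  then have "a\<^sup>2 = a'\<^sup>2" "b\<^sup>2 = b'\<^sup>2" "c\<^sup>2 = c'\<^sup>2" by simp_all
  then show ?thesis unfolding xy using square_inj by blast
qed

text \<open>The 3 by 3 block is \<open>a + b X + c X^2\<close> for a symmetric matrix \<open>X\<close> over GF(2) with
  \<open>X^3 = X^2 + 1\<close>: multiplication by a generator of GF(8) in its self-dual normal basis. Symmetry
  makes the conjugate transpose the same polynomial with conjugated coefficients.\<close>

definition cmat :: "'a \<times> 'a \<times> 'a \<Rightarrow> 'a^4^4" where
  "cmat = (\<lambda>(a, b, c). vector [vector [a + c, b, c, 0], vector [b, a, b + c, 0],
     vector [c, b + c, a + b, 0], vector [0, 0, 0, 1]])"

lemma cmat_mult: "cmat x ** cmat y = cmat (cmul x y)"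
  by (cases x; cases y)
    (simp add: vec_eq_iff forall_4 mat_mult_4 cmat_def cmul_def vector_4 algebra_simps)

lemma ct_cmat: "ct (cmat x) = cmat (ccj x)"
  by (cases x) (simp add: vec_eq_iff forall_4 cmat_def ccj_def vector_4)

lemma cmat_one: "cmat cunit = mat 1"
  by (simp add: vec_eq_iff forall_4 cmat_def cunit_def vector_4 mat_def)

lemma cmat_inj: "cmat x = cmat y \<Longrightarrow> x = y"
  by (cases x; cases y) (auto simp: vec_eq_iff forall_4 cmat_def vector_4)

text \<open>The three equations say that (x, y, z) is an eigenvector, for the eigenvalue l, of the
  symmetric matrix X of \<open>cmat\<close>. Its characteristic polynomial is the cubic, which has
  no root.\<close>

lemma cubic_eigenvector:
  fixes l x y z :: 'a
  assumes no: "\<And>x::'a. x ^ 3 + x\<^sup>2 + 1 \<noteq> 0"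
    and "y = l * x" "x + z = l * y" "y + z = l * z"
  shows "x = 0 \<and> y = 0 \<and> z = 0"
proof -
  have z: "z = (l * l + 1) * x"
  proof -
    have "z = x + (x + z)" by simp
    then show ?thesis unfolding assms(3) unfolding assms(2) by (simp add: algebra_simps)
  qed
  have "(l ^ 3 + l\<^sup>2 + 1) * x = (y + z) + l * z"
    unfolding z assms(2) by (simp add: power2_eq_square power3_eq_cube algebra_simps)
  then have "(l ^ 3 + l\<^sup>2 + 1) * x = 0" unfolding assms(4) by simp
  then have "x = 0" using no by simp
  then show ?thesis using z assms(2) by simp
qed

text \<open>A nonzero polynomial of degree at most 2 in the matrix X cannot kill a nonzero vector:
  division with remainder into the cubic would produce an eigenvector of X or a root of the
  cubic.\<close>

lemma cubic_nonsingular: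
  fixes a b c x y z :: 'a
  assumes no: "\<And>x::'a. x ^ 3 + x\<^sup>2 + 1 \<noteq> 0"
    and 1: "(a + c) * x + b * y + c * z = 0"
    and 2: "b * x + a * y + (b + c) * z = 0"
    and 3: "c * x + (b + c) * y + (a + b) * z = 0"
    and nz: "\<not> (x = 0 \<and> y = 0 \<and> z = 0)"
  shows "a = 0 \<and> b = 0 \<and> c = 0"
proof -
  note eigen = cubic_eigenvector[OF no]
  have solve: "u = (r / s) * v" if "s \<noteq> 0" "r * v + s * u = 0" for r s u v :: 'a
    using that by (simp add: add_eq_0 field_simps)
  show ?thesis
  proof (cases "c = 0")
    case c: True
    show ?thesis
    proof (cases "b = 0")
      case True
      then show ?thesis using 1 2 3 nz c by auto
    next
      case False
      have "a * x + b * y = 0" "a * y + b * (x + z) = 0" "a * z + b * (y + z) = 0"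
        using 1 2 3 c by (simp_all add: algebra_simps)
      then have "y = (a / b) * x" "x + z = (a / b) * y" "y + z = (a / b) * z"
        using solve[OF False] by blast+
      then show ?thesis using eigen nz by blast
    qed
  next
    case False
    define \<alpha> \<beta> where "\<alpha> = b / c" and "\<beta> = a / c"
    have ab: "b = \<alpha> * c" "a = \<beta> * c" using False by (simp_all add: \<alpha>_def \<beta>_def)
    define D1 D2 D3 where "D1 = x + z + \<alpha> * y + \<beta> * x" and "D2 = z + \<alpha> * (x + z) + \<beta> * y"
      and "D3 = x + y + \<alpha> * (y + z) + \<beta> * z"
    have "c * D1 = 0" "c * D2 = 0" "c * D3 = 0"
      using 1 2 3 unfolding ab D1_def D2_def D3_def by (simp_all add: algebra_simps)
    then have D: "D1 = 0" "D2 = 0" "D3 = 0" using False by simp_all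
    \<comment> \<open>Dividing X^3 + X^2 + 1 by X^2 + \<alpha> X + \<beta> gives the quotient X +
      \<alpha> + 1 and the remainder \<rho> X + \<sigma>. The cubic vanishes at the matrix X, so the
      remainder also kills the vector.\<close>
    define \<rho> \<sigma> where "\<rho> = \<alpha> * \<alpha> + \<alpha> + \<beta>" and "\<sigma> = \<alpha> * \<beta> + \<beta> + 1"
    have "\<sigma> * x + \<rho> * y = D2 + (1 + \<alpha>) * D1"
      "\<sigma> * y + \<rho> * (x + z) = D1 + D3 + (1 + \<alpha>) * D2"
      "\<sigma> * z + \<rho> * (y + z) = D2 + D3 + (1 + \<alpha>) * D3"
      unfolding \<rho>_def \<sigma>_def D1_def D2_def D3_def by (simp_all add: algebra_simps)
    then have E: "\<sigma> * x + \<rho> * y = 0" "\<sigma> * y + \<rho> * (x + z) = 0" "\<sigma> * z + \<rho> * (y + z) = 0"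
      unfolding D by simp_all
    show ?thesis
    proof (cases "\<rho> = 0")
      case True
      then have "\<sigma> = 0" using E nz by auto
      \<comment> \<open>With zero remainder the quotient X + \<alpha> + 1 is a factor of the cubic,
        so \<alpha> + 1 would be a root.\<close>
      have "\<beta> = \<alpha> * \<alpha> + \<alpha>" using True unfolding \<rho>_def by (simp add: add_eq_0)
      then have "(\<alpha> + 1) ^ 3 + (\<alpha> + 1)\<^sup>2 + 1 = \<sigma>"
        unfolding \<sigma>_def by (simp add: power2_eq_square power3_eq_cube algebra_simps)
      then show ?thesis using no \<open>\<sigma> = 0\<close> by metis
    next
      case False
      have "y = (\<sigma> / \<rho>) * x" "x + z = (\<sigma> / \<rho>) * y" "y + z = (\<sigma> / \<rho>) * z"
        using solve[OF False] E by blast+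
      then show ?thesis using eigen nz by blast
    qed
  qed
qed

text \<open>The vector \<open>(r + t, s, t)\<close> is the nonzero part of the first column of
  \<open>cmat y\<close>. The block of \<open>cmat x\<close> maps it to the corresponding part for
  \<open>cmul x y\<close>, which is zero, so \<open>cubic_nonsingular\<close> applies.\<close>

lemma cmul_eq_0:
  assumes no: "\<And>x::'a. x ^ 3 + x\<^sup>2 + 1 \<noteq> 0" and "cmul x y = 0"
  shows "x = 0 \<or> y = 0"
proof (rule disjCI)
  assume y: "y \<noteq> 0"
  obtain a b c r s t where xy: "x = (a, b, c)" "y = (r, s, t)" by (metis surj_pair)
  have eqs: "a * r + b * t + c * s + c * t = 0" "a * s + b * r + c * t = 0"
    "a * t + b * s + c * r + b * t + c * s + c * t = 0"
    using assms(2) unfolding xy cmul_def by (simp_all add: zero_prod_def)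
  have "(a + c) * (r + t) + b * s + c * t =
      (a * r + b * t + c * s + c * t) + (a * t + b * s + c * r + b * t + c * s + c * t)"
    "b * (r + t) + a * s + (b + c) * t = a * s + b * r + c * t"
    "c * (r + t) + (b + c) * s + (a + b) * t = a * t + b * s + c * r + b * t + c * s + c * t"
    by (simp_all add: algebra_simps)
  then have "a = 0 \<and> b = 0 \<and> c = 0"
    unfolding eqs by (intro cubic_nonsingular[OF no, of a c "r + t" b s t])
      (use y in \<open>auto simp: xy zero_prod_def\<close>)
  then show "x = 0" by (simp add: xy zero_prod_def)
qed

lemma cmul_cancel:
  assumes no: "\<And>x::'a. x ^ 3 + x\<^sup>2 + 1 \<noteq> 0" and "x \<noteq> 0" "cmul x y = cmul x z"
  shows "y = z"
proof -
  have self: "u + u = 0" for u :: "'a \<times> 'a \<times> 'a" by (cases u) (simp add: zero_prod_def)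
  have "cmul x (y + z) = 0" unfolding cmul_add assms(3) by (rule self)
  then have "y + z = 0" using cmul_eq_0[OF no] assms(2) by blast
  then have "y + z + z = z" by simp
  then show ?thesis by (simp add: add.assoc self)
qed

definition cnorm1 :: "('a \<times> 'a \<times> 'a) set" where "cnorm1 = {x. cmul x (ccj x) = cunit}"

text \<open>The polar decomposition of GF(q^2) again, one level up: every nonzero p is uniquely u f
  with u of norm 1 and f fixed by \<open>ccj\<close>, where f is the square root of the norm of p.
  The size is therefore (q^6 - 1) / (q^3 - 1).\<close>

lemma card_cnorm1:
  assumes no: "\<And>x::'a. x ^ 3 + x\<^sup>2 + 1 \<noteq> 0"
  shows "card cnorm1 = q ^ 3 + 1"
proof -
  let ?Q = "{x. cj x = x}"
  define E where "E = ?Q \<times> ?Q \<times> ?Q - {0}"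
  have E_iff: "x \<in> E \<longleftrightarrow> x \<noteq> 0 \<and> ccj x = x" for x
    by (cases x) (auto simp: E_def ccj_def)
  have cunit_ne: "cunit \<noteq> 0" by (simp add: cunit_def zero_prod_def)
  have bij: "bij_betw (\<lambda>(u, f). cmul u f) (cnorm1 \<times> E) (UNIV - {0})"
  proof (rule bij_betwI')
    fix x y assume "x \<in> cnorm1 \<times> E" "y \<in> cnorm1 \<times> E"
    then obtain u f v g where xy: "x = (u, f)" "y = (v, g)" "cmul u (ccj u) = cunit"
      "cmul v (ccj v) = cunit" "f \<noteq> 0" "g \<noteq> 0" "ccj f = f" "ccj g = g"
      unfolding cnorm1_def E_iff by (auto simp: E_iff)
    have "u = v \<and> f = g" if eq: "cmul u f = cmul v g"
    proof -
      have "cmul (cmul u f) (ccj (cmul u f)) = cmul (cmul v g) (ccj (cmul v g))" using eq by simp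
      moreover have "cmul (cmul w d) (ccj (cmul w d)) = cmul (cmul w (ccj w)) (cmul d (ccj d))" for w d
        unfolding ccj_cmul by (simp add: cmul_ac)
      ultimately have "cmul f f = cmul g g" using xy by simp
      then have "f = g" by (rule cmul_square_inj)
      then show ?thesis using eq cmul_cancel[OF no xy(5)] by (simp add: cmul_commute)
    qed
    then show "((\<lambda>(u, f). cmul u f) x = (\<lambda>(u, f). cmul u f) y) = (x = y)" using xy by auto
  next
    fix x assume "x \<in> cnorm1 \<times> E"
    then obtain u f where x: "x = (u, f)" "cmul u (ccj u) = cunit" "f \<noteq> 0"
      unfolding cnorm1_def by (auto simp: E_iff)
    then have "u \<noteq> 0" using cunit_ne by auto
    then show "(\<lambda>(u, f). cmul u f) x \<in> UNIV - {0}" using x cmul_eq_0[OF no, of u f] by auto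
  next
    fix p :: "'a \<times> 'a \<times> 'a" assume "p \<in> UNIV - {0}"
    then have p: "p \<noteq> 0" by simp
    define N where "N = cmul p (ccj p)"
    have N_cj: "ccj N = N" unfolding N_def ccj_cmul by (simp add: cmul_commute)
    have "ccj p \<noteq> 0" using p by (cases p) (auto simp: ccj_def zero_prod_def)
    then have N0: "N \<noteq> 0" unfolding N_def using cmul_eq_0[OF no] p by blast
    obtain x y z where N: "N = (x, y, z)" by (metis surj_pair)
    have xyz: "cj x = x" "cj y = y" "cj z = z" using N_cj unfolding N ccj_def by simp_all
    \<comment> \<open>Solving a^2 + c^2 = x, c^2 = y and b^2 + c^2 = z, the coefficients in
      \<open>cmul_square\<close>, for a square root of N.\<close>
    obtain c where c: "cj c = c" "c * c = y" using xyz(2) by (rule norm_square_root)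
    obtain a where a: "cj a = a" "a * a = x + y" using norm_square_root[of "x + y"] xyz by auto
    obtain b where b: "cj b = b" "b * b = z + y" using norm_square_root[of "z + y"] xyz by auto
    define f where "f = (a, b, c)"
    have ff: "cmul f f = N"
      unfolding f_def cmul_square N using a b c by (simp add: power2_eq_square add.assoc)
    have f_cj: "ccj f = f" unfolding f_def ccj_def using a b c by simp
    have f0: "f \<noteq> 0" using ff N0 by auto
    have "surj (cmul f)"
      by (rule finite_UNIV_inj_surj) (auto intro!: injI cmul_cancel[OF no f0])
    then obtain f' where f': "cmul f f' = cunit" by (metis surjD)
    have "cmul f (ccj f') = cunit" using arg_cong[OF f', of ccj] unfolding ccj_cmul f_cj by simp
    then have f'_cj: "ccj f' = f'" using f' cmul_cancel[OF no f0] by metis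
    have "cmul (cmul f' p) (ccj (cmul f' p)) = cmul (cmul f' f') N"
      unfolding ccj_cmul f'_cj N_def by (simp add: cmul_ac)
    also have "\<dots> = cmul (cmul f f') (cmul f f')" unfolding ff[symmetric] by (simp add: cmul_ac)
    finally have "cmul f' p \<in> cnorm1" unfolding cnorm1_def f' by simp
    moreover have "p = cmul (cmul f' p) f"
    proof -
      have "cmul (cmul f' p) f = cmul (cmul f f') p" by (simp add: cmul_ac)
      then show ?thesis unfolding f' by simp
    qed
    ultimately show "\<exists>x\<in>cnorm1 \<times> E. p = (\<lambda>(u, f). cmul u f) x"
      using f0 f_cj E_iff by (intro bexI[of _ "(cmul f' p, f)"]) auto
  qed
  have "0 \<in> ?Q \<times> ?Q \<times> ?Q" by (simp add: zero_prod_def)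
  then have cardE: "card E = q ^ 3 - 1"
    unfolding E_def by (simp add: card_Diff_singleton card_cartesian_product card_fixed power3_eq_cube)
  have "card cnorm1 * (q ^ 3 - 1) = card (UNIV - {0 :: 'a \<times> 'a \<times> 'a})"
    using bij_betw_same_card[OF bij] by (simp add: card_cartesian_product cardE)
  also have "\<dots> = q\<^sup>2 * (q\<^sup>2 * q\<^sup>2) - 1"
    by (simp add: card_Diff_singleton card_F)
  also have "\<dots> = (q ^ 3 + 1) * (q ^ 3 - 1)"
    by (simp add: power2_eq_square power3_eq_cube algebra_simps)
  finally have eq: "card cnorm1 * (q ^ 3 - 1) = (q ^ 3 + 1) * (q ^ 3 - 1)" .
  have "(4::nat) ^ 3 \<le> q ^ 3" using q_ge by (intro power_mono) auto
  then have "q ^ 3 - 1 \<noteq> 0" by simp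
  then show ?thesis using eq by (metis mult_right_cancel)
qed

text \<open>The hyperplane of vectors with last coordinate 0 is nondegenerate of dimension 3 and
  contains no isotropic line, as inspection of both families confirms. Hence the last coordinate is
  a nonzero functional on \<open>L\<close>, with a kernel of dimension 1.\<close>

lemma isotropic_line_coord4:
  assumes L: "isotropic_line L"
  shows "\<exists>u w. u \<in> L \<and> w \<in> L \<and> u \<noteq> 0 \<and> u $ 4 = 0 \<and> w $ 4 = 1 \<and> (\<forall>v\<in>L. v $ 4 = 0 \<longrightarrow> (\<exists>s. v = s *s u))"
proof -
  obtain x y where Lxy: "L = {s *s x + t *s y | s t. True}"
    and indep: "\<And>s t. s *s x + t *s y = 0 \<Longrightarrow> s = 0 \<and> t = 0"
    using L unfolding isotropic_line_def by blast
  have inL: "s *s x + t *s y \<in> L" for s t unfolding Lxy by blast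
  show ?thesis
  proof (cases "y $ 4 = 0")
    case False
    \<comment> \<open>The coefficients 1 and 0 stay written out so that \<open>inL\<close> applies
      to \<open>u\<close> and \<open>w\<close> directly.\<close>
    define u where "u = 1 *s x + (x $ 4 / y $ 4) *s y"
    define w where "w = 0 *s x + (1 / y $ 4) *s y"
    have "v = s *s u" if "v = s *s x + t *s y" "v $ 4 = 0" for v s t
    proof -
      have "s * x $ 4 + t * y $ 4 = 0" using that by simp
      then have "t = s * (x $ 4 / y $ 4)" using False by (simp add: add_eq_0 field_simps)
      then show ?thesis unfolding that(1) u_def by (simp add: vec_eq_iff algebra_simps)
    qed
    then have "\<forall>v\<in>L. v $ 4 = 0 \<longrightarrow> (\<exists>s. v = s *s u)" unfolding Lxy by blast
    moreover have "u \<noteq> 0" unfolding u_def using indep[of 1] by force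
    moreover have "u $ 4 = 0" "w $ 4 = 1" unfolding u_def w_def using False by simp_all
    moreover have "u \<in> L" "w \<in> L" unfolding u_def w_def by (rule inL)+
    ultimately show ?thesis by blast
  next
    case y4: True
    have "\<exists>v\<in>L. v $ 4 \<noteq> 0"
      using isotropic_line_cases[OF L]
    proof
      assume "\<exists>a b l. a * cj a + b * cj b = 1 \<and> l \<in> \<mu> \<and> L = line1 a b l"
      then obtain a b l where ab: "a * cj a + b * cj b = 1" "l \<in> \<mu>" "L = line1 a b l" by blast
      have "vector [1, 0, a, b] \<in> L" "vector [0, 1, l * cj b, l * cj a] \<in> L"
        unfolding ab line1_def by (simp_all add: vector_4)
      moreover have "b \<noteq> 0 \<or> l * cj a \<noteq> 0" using ab mu_nonzero by auto
      ultimately show ?thesis by (metis vector_4(4))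
    next
      assume "\<exists>a\<in>\<mu>. \<exists>b\<in>\<mu>. L = line2 a b"
      then obtain a b where ab: "a \<in> \<mu>" "b \<in> \<mu>" "L = line2 a b" by blast
      have "vector [1, a, 1, b] \<in> L" unfolding ab line2_def by (simp add: vector_4)
      then show ?thesis using mu_nonzero[OF ab(2)] by (metis vector_4(4))
    qed
    then have x4: "x $ 4 \<noteq> 0" using y4 unfolding Lxy by auto
    define u where "u = 0 *s x + 1 *s y"
    define w where "w = (1 / x $ 4) *s x + 0 *s y"
    have "v = t *s u" if "v = s *s x + t *s y" "v $ 4 = 0" for v s t
      using that x4 y4 unfolding u_def by (auto simp: vec_eq_iff)
    then have "\<forall>v\<in>L. v $ 4 = 0 \<longrightarrow> (\<exists>s. v = s *s u)" unfolding Lxy by blast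
    moreover have "u \<noteq> 0" unfolding u_def using indep[of 0 1] by force
    moreover have "u $ 4 = 0" "w $ 4 = 1" unfolding u_def w_def using x4 y4 by simp_all
    moreover have "u \<in> L" "w \<in> L" unfolding u_def w_def by (rule inL)+
    ultimately show ?thesis by blast
  qed
qed

text \<open>\<open>A\<close> preserves the point where \<open>L\<close> meets the hyperplane of last
  coordinate 0, and the difference of \<open>A *v w\<close> and \<open>w\<close>, written as a sum
  in characteristic 2, lies on that point.\<close>

lemma fixed_line_coord4:
  assumes L: "isotropic_line L" and A: "act A L = L" "\<And>v. (A *v v) $ 4 = v $ 4"
  obtains u w s t where "u \<noteq> 0" "u $ 4 = 0" "w $ 4 = 1" "h u u = 0" "h w w = 0"
    "A *v u = s *s u" "A *v w + w = t *s u"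
proof -
  obtain u w where uw: "u \<in> L" "w \<in> L" "u \<noteq> 0" "u $ 4 = 0" "w $ 4 = 1"
    and mult: "\<forall>v\<in>L. v $ 4 = 0 \<longrightarrow> (\<exists>s. v = s *s u)"
    using isotropic_line_coord4[OF L] by blast
  have AL: "A *v v \<in> L" if "v \<in> L" for v using that A(1) unfolding act_def by blast
  have "(A *v u) $ 4 = 0" "(A *v w + w) $ 4 = 0" using A(2) uw by simp_all
  moreover have "A *v w + w \<in> L" using isotropic_line_closed(1)[OF L AL uw(2)] uw by blast
  ultimately obtain s t where "A *v u = s *s u" "A *v w + w = t *s u"
    using mult AL[OF uw(1)] by blast
  moreover have "h u u = 0" "h w w = 0" using isotropic_line_closed(3)[OF L] uw by blast+
  ultimately show ?thesis using that uw by blast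
qed

lemma norm_scaled:
  assumes "w1 = k * u1" "w2 = k * u2" "w3 = k * u3"
    "u1 * cj u1 + u2 * cj u2 + u3 * cj u3 = 0"
  shows "w1 * cj w1 + w2 * cj w2 + w3 * cj w3 = 0"
proof -
  have "w1 * cj w1 + w2 * cj w2 + w3 * cj w3 = k * cj k * (u1 * cj u1 + u2 * cj u2 + u3 * cj u3)"
    unfolding assms(1-3) by (simp add: algebra_simps)
  then show ?thesis unfolding assms(4) by simp
qed

text \<open>Two nonzero coordinates of u give a = b = s. If s differs from 1, the first two
  coordinates of w are a multiple of those of u. The third must break the pattern, since u has norm
  0 there and w has norm 1; this forces u3 = 0 and c = 1, and then a b c = 1 reads s^2 = 1.\<close>

lemma torus_fixed:
  assumes "a * u1 = s * u1" "b * u2 = s * u2" "c * u3 = s * u3"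
    "(a + 1) * w1 = t * u1" "(b + 1) * w2 = t * u2" "(c + 1) * w3 = t * u3"
    and u: "u1 * cj u1 + u2 * cj u2 + u3 * cj u3 = 0" and w: "w1 * cj w1 + w2 * cj w2 + w3 * cj w3 = 1"
    and abc: "a * b * c = 1" and nz: "u1 \<noteq> 0" "u2 \<noteq> 0"
  shows "a = 1 \<and> b = 1 \<and> c = 1"
proof -
  have ab: "a = s" "b = s" using assms(1,2) nz by simp_all
  show ?thesis
  proof (cases "s = 1")
    case True
    then show ?thesis using ab abc by simp
  next
    case False
    define k where "k = t / (s + 1)"
    have s1: "s + 1 \<noteq> 0" using False by (simp add: add_eq_0)
    have k: "w1 = k * u1" "w2 = k * u2" using assms(4,5) s1 unfolding ab k_def by (simp_all add: field_simps)
    have w3: "w3 \<noteq> k * u3" using norm_scaled[OF k _ u] w by auto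
    have u3: "u3 = 0"
    proof (rule ccontr)
      assume "u3 \<noteq> 0"
      then have "c = s" using assms(3) by simp
      then have "w3 = k * u3" using assms(6) s1 unfolding k_def by (simp add: field_simps)
      then show False using w3 by simp
    qed
    then have "(c + 1) * w3 = 0" "w3 \<noteq> 0" using assms(6) w3 by simp_all
    then have "c = 1" by (simp add: add_eq_0)
    then have "s * s = 1" using abc ab by simp
    then show ?thesis using False square_eq_1 by blast
  qed
qed

lemma torus_free:
  assumes "isotropic_line L" "act (diag a b c 1) L = L" "a * b * c = 1"
  shows "diag a b c 1 = mat 1"
proof -
  have "(diag a b c 1 *v v) $ 4 = v $ 4" for v by (simp add: diag_vec vector_4)
  then obtain u w s t where uw: "u \<noteq> 0" "u $ 4 = 0" "w $ 4 = 1" "h u u = 0" "h w w = 0"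
    and us: "diag a b c 1 *v u = s *s u" and wt: "diag a b c 1 *v w + w = t *s u"
    by (rule fixed_line_coord4[OF assms(1,2)]) blast
  have e: "a * u $ 1 = s * u $ 1" "b * u $ 2 = s * u $ 2" "c * u $ 3 = s * u $ 3"
    using us unfolding vec_eq_iff forall_4 by (simp_all add: diag_vec vector_4)
  have f: "(a + 1) * w $ 1 = t * u $ 1" "(b + 1) * w $ 2 = t * u $ 2" "(c + 1) * w $ 3 = t * u $ 3"
    using wt unfolding vec_eq_iff forall_4 by (simp_all add: diag_vec vector_4 algebra_simps)
  have u: "u $ 1 * cj (u $ 1) + u $ 2 * cj (u $ 2) + u $ 3 * cj (u $ 3) = 0"
    using uw(4) unfolding h_4 uw(2) by (simp add: mult.commute)
  have w: "w $ 1 * cj (w $ 1) + w $ 2 * cj (w $ 2) + w $ 3 * cj (w $ 3) = 1"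
    using uw(5) unfolding h_4 uw(3) by (simp add: mult.commute add_eq_0)
  have "u $ 1 \<noteq> 0 \<or> u $ 2 \<noteq> 0 \<or> u $ 3 \<noteq> 0"
    using uw(1,2) by (auto simp: vec_eq_iff forall_4)
  \<comment> \<open>A vector with a single nonzero coordinate is not isotropic, so two are nonzero
    and \<open>torus_fixed\<close> applies after a permutation of the coordinates.\<close>
  then have "u $ 1 \<noteq> 0 \<and> u $ 2 \<noteq> 0 \<or> u $ 1 \<noteq> 0 \<and> u $ 3 \<noteq> 0 \<or> u $ 2 \<noteq> 0 \<and> u $ 3 \<noteq> 0"
    using u by auto
  then have "a = 1 \<and> b = 1 \<and> c = 1"
  proof (elim disjE conjE)
    assume "u $ 1 \<noteq> 0" "u $ 2 \<noteq> 0"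
    then show ?thesis using torus_fixed[OF e f u w assms(3)] by blast
  next
    assume nz: "u $ 1 \<noteq> 0" "u $ 3 \<noteq> 0"
    have "u $ 1 * cj (u $ 1) + u $ 3 * cj (u $ 3) + u $ 2 * cj (u $ 2) = 0"
      "w $ 1 * cj (w $ 1) + w $ 3 * cj (w $ 3) + w $ 2 * cj (w $ 2) = 1" "a * c * b = 1"
      using u w assms(3) by (simp_all add: add_ac mult_ac)
    then show ?thesis using torus_fixed[OF e(1,3,2) f(1,3,2) _ _ _ nz] by blast
  next
    assume nz: "u $ 2 \<noteq> 0" "u $ 3 \<noteq> 0"
    have "u $ 2 * cj (u $ 2) + u $ 3 * cj (u $ 3) + u $ 1 * cj (u $ 1) = 0"
      "w $ 2 * cj (w $ 2) + w $ 3 * cj (w $ 3) + w $ 1 * cj (w $ 1) = 1" "b * c * a = 1"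
      using u w assms(3) by (simp_all add: add_ac mult_ac)
    then show ?thesis using torus_fixed[OF e(2,3,1) f(2,3,1) _ _ _ nz] by blast
  qed
  then show ?thesis by (simp add: vec_eq_iff forall_4 diag_def vector_4 mat_def)
qed

lemma cmat_vec: "cmat (a, b, c) *v v = vector [(a + c) * v $ 1 + b * v $ 2 + c * v $ 3,
    b * v $ 1 + a * v $ 2 + (b + c) * v $ 3, c * v $ 1 + (b + c) * v $ 2 + (a + b) * v $ 3, v $ 4]"
  by (simp add: vec_eq_iff forall_4 mat_vec_4 cmat_def vector_4)

text \<open>The eigenvector u is killed by a + s + b X + c X^2, so this polynomial is zero and the
  matrix is the scalar s on the hyperplane. If s were not 1, the first three coordinates of w would
  be a multiple of those of u, contradicting their norms 1 and 0.\<close>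

lemma cmat_free:
  assumes no: "\<And>x::'a. x ^ 3 + x\<^sup>2 + 1 \<noteq> 0"
    and L: "isotropic_line L" "act (cmat x) L = L"
  shows "cmat x = mat 1"
proof -
  obtain a b c where x: "x = (a, b, c)" by (metis surj_pair)
  have "(cmat x *v v) $ 4 = v $ 4" for v by (simp add: x cmat_vec vector_4)
  then obtain u w s t where uw: "u \<noteq> 0" "u $ 4 = 0" "w $ 4 = 1" "h u u = 0" "h w w = 0"
    and us: "cmat x *v u = s *s u" and wt: "cmat x *v w + w = t *s u"
    by (rule fixed_line_coord4[OF L]) blast
  have e: "(a + c) * u $ 1 + b * u $ 2 + c * u $ 3 = s * u $ 1"
    "b * u $ 1 + a * u $ 2 + (b + c) * u $ 3 = s * u $ 2"
    "c * u $ 1 + (b + c) * u $ 2 + (a + b) * u $ 3 = s * u $ 3"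
    using us unfolding vec_eq_iff forall_4 by (simp_all add: x cmat_vec vector_4)
  have "((a + s) + c) * u $ 1 + b * u $ 2 + c * u $ 3 = ((a + c) * u $ 1 + b * u $ 2 + c * u $ 3) + s * u $ 1"
    "b * u $ 1 + (a + s) * u $ 2 + (b + c) * u $ 3 = (b * u $ 1 + a * u $ 2 + (b + c) * u $ 3) + s * u $ 2"
    "c * u $ 1 + (b + c) * u $ 2 + ((a + s) + b) * u $ 3 = (c * u $ 1 + (b + c) * u $ 2 + (a + b) * u $ 3) + s * u $ 3"
    by (simp_all add: algebra_simps)
  then have "((a + s) + c) * u $ 1 + b * u $ 2 + c * u $ 3 = 0"
    "b * u $ 1 + (a + s) * u $ 2 + (b + c) * u $ 3 = 0"
    "c * u $ 1 + (b + c) * u $ 2 + ((a + s) + b) * u $ 3 = 0"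
    unfolding e by simp_all
  moreover have "\<not> (u $ 1 = 0 \<and> u $ 2 = 0 \<and> u $ 3 = 0)"
    using uw(1,2) by (auto simp: vec_eq_iff forall_4)
  ultimately have "a + s = 0 \<and> b = 0 \<and> c = 0" by (rule cubic_nonsingular[OF no])
  then have abc: "a = s" "b = 0" "c = 0" by (simp_all add: add_eq_0)
  have f: "(s + 1) * w $ 1 = t * u $ 1" "(s + 1) * w $ 2 = t * u $ 2" "(s + 1) * w $ 3 = t * u $ 3"
    using wt unfolding vec_eq_iff forall_4 by (simp_all add: x abc cmat_vec vector_4 algebra_simps)
  have u: "u $ 1 * cj (u $ 1) + u $ 2 * cj (u $ 2) + u $ 3 * cj (u $ 3) = 0"
    using uw(4) unfolding h_4 uw(2) by (simp add: mult.commute)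
  have w: "w $ 1 * cj (w $ 1) + w $ 2 * cj (w $ 2) + w $ 3 * cj (w $ 3) = 1"
    using uw(5) unfolding h_4 uw(3) by (simp add: mult.commute add_eq_0)
  have "s = 1"
  proof (rule ccontr)
    assume "s \<noteq> 1"
    then have s1: "s + 1 \<noteq> 0" by (simp add: add_eq_0)
    have "w $ 1 = t / (s + 1) * u $ 1" "w $ 2 = t / (s + 1) * u $ 2" "w $ 3 = t / (s + 1) * u $ 3"
      using f s1 by (simp_all add: field_simps)
    then show False using norm_scaled[OF _ _ _ u] w by (metis zero_neq_one)
  qed
  then show ?thesis using cmat_one unfolding x abc cunit_def by simp
qed

section \<open>From a free torus to the whole group, in both cases\<close>

lemma prime_fact_from_torus:
  assumes X: "X \<subseteq> GU" "mat 1 \<in> X" "\<And>A B. A \<in> X \<Longrightarrow> B \<in> X \<Longrightarrow> A ** B \<in> X"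
    and comm: "\<And>A B. A \<in> X \<Longrightarrow> B \<in> X \<Longrightarrow> A ** B = B ** A"
    and free: "\<And>A L. A \<in> X \<Longrightarrow> isotropic_line L \<Longrightarrow> act A L = L \<Longrightarrow> A = mat 1"
    and X44: "\<And>A. A \<in> X \<Longrightarrow> A $ 4 $ 4 = 1"
    and p: "prime p" "card X * p = (q + 1)\<^sup>2 * (q\<^sup>2 - q + 1)"
  shows "prime_fact (SU4 q) (carrier (SU4 q :: ('a^4^4) monoid))"
proof (rule SU.prime_fact_orbits[where act = act and w = L0 and A = "to_SU ` X" and p = p])
  show "subgroup (to_SU ` X) (SU4 q)" by (rule subgroup_to_SU[OF X])
  show "finite (carrier (SU4 q :: ('a^4^4) monoid))" by (rule SU_finite)
  show "act (A \<otimes>\<^bsub>SU4 q\<^esub> B) L = act A (act B L)" for A B :: "'a^4^4" and L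
    by (simp add: act_mult)
  show "act \<one>\<^bsub>SU4 q\<^esub> L = L" for L :: "('a^4) set" by (simp add: act_one)
  show "prime p" by (rule p)
  show "prime_fact (SU4 q) (to_SU ` X)" by (rule prime_fact_to_SU[OF X comm])
  show "prime_fact (SU4 q) {A \<in> carrier (SU4 q). act A L0 = L0}"
    using prime_fact_line_stab unfolding line_stab_def .
  show "B = \<one>\<^bsub>SU4 q\<^esub>"
    if B: "B \<in> to_SU ` X" "C \<in> carrier (SU4 q)" "act B (act C L0) = act C L0" for B C
  proof -
    obtain A where A: "A \<in> X" "B = to_SU A" using B(1) by blast
    have L: "isotropic_line (act C L0)" using B(2) isotropic_line_act by (simp add: SU4_carrier)
    have "act A (act C L0) = act C L0"
      using B(3) act_to_SU[of A "act C L0"] isotropic_line_closed(2)[OF L] A X(1) by auto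
    then have "A = mat 1" using free[OF A(1) L] by simp
    then show ?thesis using A(2) to_SU_one by simp
  qed
  \<comment> \<open>Equal images differ at most by a scalar before rescaling, and the normalised
    entry \<open>A $ 4 $ 4 = 1\<close> determines that scalar.\<close>
  have "inj_on to_SU X"
  proof (rule inj_onI)
    fix A B assume AB: "A \<in> X" "B \<in> X" "to_SU A = to_SU B"
    have ne: "det A ^ (q div 4) \<noteq> 0" using to_SU_factor(2)[of A] AB(1) X(1) by auto
    have eq: "det A ^ (q div 4) * A $ i $ j = det B ^ (q div 4) * B $ i $ j" for i j
      using AB(3) unfolding to_SU_def by (metis smat_nth)
    have "det A ^ (q div 4) = det B ^ (q div 4)" using eq[of 4 4] X44 AB by simp
    then have "A $ i $ j = B $ i $ j" for i j using eq[of i j] ne by (metis mult_left_cancel)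
    then show "A = B" by (simp add: vec_eq_iff)
  qed
  then have "card (to_SU ` X) = card X" by (rule card_image)
  then show "card ((\<lambda>g. act g L0) ` carrier (SU4 q)) = card (to_SU ` X) * p"
    using card_Omega p(2) unfolding \<Omega>_def by simp
qed

lemma prime_fact_if_prime_quadratic:
  assumes "prime (q\<^sup>2 - q + 1)"
  shows "prime_fact (SU4 q) (carrier (SU4 q :: ('a^4^4) monoid))"
proof -
  \<comment> \<open>On \<open>\<mu>\<close> conjugation is inversion, so the third entry makes the
    product of the first three equal to 1.\<close>
  define f where "f = (\<lambda>(a, b). diag a b (cj (a * b)) 1)"
  have one: "1 \<in> \<mu>" by (simp add: \<mu>_def)
  have mu_mult: "a * b \<in> \<mu>" if "a \<in> \<mu>" "b \<in> \<mu>" for a b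
  proof -
    have "a * b * cj (a * b) = (a * cj a) * (b * cj b)" by (simp add: mult_ac)
    also have "\<dots> = 1" using that by (simp add: \<mu>_def)
    finally show ?thesis unfolding \<mu>_def by blast
  qed
  have mu_cj: "cj a \<in> \<mu>" if "a \<in> \<mu>" for a using that by (simp add: \<mu>_def mult.commute)
  have f_mult: "f (a, b) ** f (a', b') = f (a * a', b * b')" for a b a' b'
    unfolding f_def by (simp add: diag_mult mult_ac)
  have "f (1, 1) = mat 1"
    by (simp add: f_def vec_eq_iff forall_4 diag_def vector_4 mat_def)
  then have f_one: "mat 1 \<in> f ` (\<mu> \<times> \<mu>)" using one by (metis SigmaI image_eqI)
  have inj: "inj_on f (\<mu> \<times> \<mu>)"
  proof (rule inj_onI, clarify)
    fix a b a' b' assume eq: "f (a, b) = f (a', b')"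
    have "f (x, y) $ 1 $ 1 = x" "f (x, y) $ 2 $ 2 = y" for x y
      by (simp_all add: f_def diag_def vector_4)
    then show "a = a' \<and> b = b'" using eq by metis
  qed
  show ?thesis
  proof (rule prime_fact_from_torus[where X = "f ` (\<mu> \<times> \<mu>)", OF _ f_one _ _ _ _ assms])
    show "f ` (\<mu> \<times> \<mu>) \<subseteq> GU"
      unfolding f_def using diag_GU mu_mult mu_cj one by auto
    show "A ** B \<in> f ` (\<mu> \<times> \<mu>)" if AB: "A \<in> f ` (\<mu> \<times> \<mu>)" "B \<in> f ` (\<mu> \<times> \<mu>)" for A B
      using AB f_mult mu_mult by auto
    show "A ** B = B ** A" if AB: "A \<in> f ` (\<mu> \<times> \<mu>)" "B \<in> f ` (\<mu> \<times> \<mu>)" for A B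
      using AB f_mult by (auto simp: mult.commute)
    show "A = mat 1" if AL: "A \<in> f ` (\<mu> \<times> \<mu>)" "isotropic_line L" "act A L = L" for A L
    proof -
      obtain a b where ab: "a \<in> \<mu>" "b \<in> \<mu>" "A = diag a b (cj (a * b)) 1"
        using AL(1) unfolding f_def by auto
      have "a * b * cj (a * b) = 1" using mu_mult[OF ab(1,2)] by (simp add: \<mu>_def)
      then show ?thesis using torus_free AL(2,3) unfolding ab(3) by blast
    qed
    show "A $ 4 $ 4 = 1" if "A \<in> f ` (\<mu> \<times> \<mu>)" for A
      using that by (auto simp: f_def diag_def vector_4)
    show "card (f ` (\<mu> \<times> \<mu>)) * (q\<^sup>2 - q + 1) = (q + 1)\<^sup>2 * (q\<^sup>2 - q + 1)"
      using inj by (simp add: card_image card_cartesian_product card_mu power2_eq_square)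
  qed
qed

lemma prime_fact_if_prime_linear:
  assumes "prime (q + 1)"
  shows "prime_fact (SU4 q) (carrier (SU4 q :: ('a^4^4) monoid))"
proof -
  have cube: "q ^ 3 + 1 = (q + 1) * (q\<^sup>2 - q + 1)"
  proof -
    have "q \<le> q\<^sup>2" by (simp add: power2_eq_square)
    then obtain r where r: "q\<^sup>2 = q + r" using le_Suc_ex by blast
    have "q ^ 3 = q * q\<^sup>2" by (simp add: power2_eq_square power3_eq_cube)
    also have "\<dots> + 1 = (q + 1) * (r + 1)" using r by (simp add: power2_eq_square algebra_simps)
    finally show ?thesis using r by simp
  qed
  \<comment> \<open>For n = 3 k and r = 2^k, the number q + 1 = r^3 + 1 has the proper divisor r +
    1.\<close>
  have "\<not> 3 dvd n"
  proof
    assume "3 dvd n"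
    then obtain k where k: "n = 3 * k" by blast
    define r :: nat where "r = 2 ^ k"
    have q_r: "q = r ^ 3" unfolding r_def q k by (simp add: power_mult[symmetric] mult.commute)
    have "r \<noteq> 0" by (simp add: r_def)
    moreover have "r \<noteq> 1" using q_r q_ge by auto
    ultimately have r2: "r \<ge> 2" by simp
    have "r * 2 \<le> r * r" using r2 by (intro mult_le_mono) auto
    \<comment> \<open>Here d is r^2 - 2 r, so the cofactor r^2 - r + 1 becomes
      \<open>r + d + 1\<close> without subtraction of natural numbers.\<close>
    then obtain d where d: "r * r = r * 2 + d" using le_Suc_ex by blast
    have "q + 1 = (r + 1) * (r + d + 1)"
      unfolding q_r power3_eq_cube d using d by (simp add: algebra_simps)
    then have "(r + 1) dvd q + 1" by (metis dvd_triv_left)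
    then have "r + 1 = 1 \<or> r + 1 = q + 1" using assms prime_nat_iff by blast
    then have "r = r ^ 3" using r2 q_r by simp
    then have "r * r * r = 1 * r" by (simp add: power3_eq_cube)
    then show False using r2 by simp
  qed
  then have no: "\<And>x::'a. x ^ 3 + x\<^sup>2 + 1 \<noteq> 0" by (rule cubic_no_root)
  have ccj: "cmul (ccj x) x = cmul x (ccj x)" for x by (rule cmul_commute)
  show ?thesis
  proof (rule prime_fact_from_torus[where X = "cmat ` cnorm1", OF _ _ _ _ _ _ assms])
    show "cmat ` cnorm1 \<subseteq> GU"
      by (auto simp: GU_def ct_cmat cmat_mult ccj cnorm1_def cmat_one)
    have "cunit \<in> cnorm1" by (simp add: cnorm1_def)
    then show "mat 1 \<in> cmat ` cnorm1" using cmat_one by (metis image_eqI)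
    have "cmul x y \<in> cnorm1" if "x \<in> cnorm1" "y \<in> cnorm1" for x y
    proof -
      have "cmul (cmul x y) (ccj (cmul x y)) = cmul (cmul x (ccj x)) (cmul y (ccj y))"
        unfolding ccj_cmul by (simp add: cmul_ac)
      then show ?thesis using that by (simp add: cnorm1_def)
    qed
    then show "A ** B \<in> cmat ` cnorm1" if "A \<in> cmat ` cnorm1" "B \<in> cmat ` cnorm1" for A B
      using that by (auto simp: cmat_mult)
    show "A ** B = B ** A" if "A \<in> cmat ` cnorm1" "B \<in> cmat ` cnorm1" for A B
      using that by (auto simp: cmat_mult cmul_commute)
    show "A = mat 1" if "A \<in> cmat ` cnorm1" "isotropic_line L" "act A L = L" for A L
      using that cmat_free[OF no] by blast
    show "A $ 4 $ 4 = 1" if "A \<in> cmat ` cnorm1" for A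
      using that by (auto simp: cmat_def vector_4)
    have C: "card (cmat ` cnorm1) = q ^ 3 + 1"
      using card_cnorm1[OF no] cmat_inj by (subst card_image) (auto simp: inj_on_def)
    show "card (cmat ` cnorm1) * (q + 1) = (q + 1)\<^sup>2 * (q\<^sup>2 - q + 1)"
      unfolding C cube power2_eq_square[of "q + 1"] by (simp only: mult_ac)
  qed
qed

end

theorem theorem4p3:
  fixes n q :: nat
  assumes "q = 2 ^ n" and "n > 1"
    and "prime (q + 1) \<or> prime (q ^ 2 - q + 1)"
    and "CARD('a::{field,finite}) = q ^ 2"
  shows "has_MLS (PSU4 q :: ('a^4^4) set monoid)"
proof -
  interpret unitary_setup n q "TYPE('a)"
    using assms by unfold_locales auto
  have "prime_fact (SU4 q) (carrier (SU4 q :: ('a^4^4) monoid))"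
    using assms(3) prime_fact_if_prime_linear prime_fact_if_prime_quadratic by blast
  then show ?thesis
    by (intro has_MLS_if_prime_fact prime_fact_PSU4)
qed

end
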